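(* For any Schwartz function $\varphi$ on $\mathbb{R}$ there exists a finite constant $C_\varphi$ such that for any $F,G\in\mathrm{L}^4(\mathbb{R}^2)$ we have $$\Big( \sum_{i=-\infty}^\infty \big\| \|A_t^\varphi (F,G)(x,y)\|_{\mathrm{V}_t^2([2^i,2^{i+1}],\mathbb{C})} \big\|^2_{\mathrm{L}^2_{(x,y)}(\mathbb{R}^2)}\Big)^{1/2} \leq C_\varphi \|F\|_{\mathrm{L}^4(\mathbb{R}^2)} \|G\|_{\mathrm{L}^4(\mathbb{R}^2)}.$$
   Context: For an integrable function $\varphi$ on $\mathbb{R}$, functions $F,G\in \mathrm{L}^4(\mathbb{R}^2)$ (complex-valued), and $t>0$, the bilinear average is $$A_t^{\varphi}(F,G)(x,y) := \int_{\mathbb{R}} F(x+s,y)\, G(x,y+s) \,t^{-1} \varphi(t^{-1}s) \,ds,\quad (x,y)\in\mathbb{R}^2.$$ For $1\le\varrho<\infty$, a Banach space $B$, a set $\mathcal{U}\subseteq\mathbb{R}$ and a function $a\colon\mathcal{U}\to B$, the $\varrho$-variation is $$\|a(t)\|_{\mathrm{V}_t^\varrho(\mathcal{U},B)} := \sup_{\substack{m\in\mathbb{N}\cup\{0\}\\ t_0<t_1<\cdots<t_m,\ t_j\in\mathcal{U}}} \Big( \sum_{j=1}^{m} \|a(t_j)-a(t_{j-1})\|_{B}^\varrho \Big)^{1/\varrho}.$$ In the claim the variation is taken in $t$ for each fixed $(x,y)$, and then the $\mathrm{L}^2$ norm is taken in $(x,y)$. *)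

theory Defs
  imports "HOL-Analysis.Analysis"
begin

definition iter_deriv :: "nat \<Rightarrow> (real \<Rightarrow> 'b::real_normed_vector) \<Rightarrow> real \<Rightarrow> 'b" where
  "iter_deriv n f = ((\<lambda>g x. vector_derivative g (at x)) ^^ n) f"

definition schwartz :: "(real \<Rightarrow> 'b::real_normed_vector) \<Rightarrow> bool" where
  "schwartz f \<longleftrightarrow>
     (\<forall>n x. iter_deriv n f differentiable (at x)) \<and>
     (\<forall>k n. bounded (range (\<lambda>x. x ^ k *\<^sub>R iter_deriv n f x)))"

(* Powers of extended nonnegative numbers, meant only for exponents p > 0. *)
definition epowr :: "ennreal \<Rightarrow> real \<Rightarrow> ennreal" where
  "epowr x p = (if x = \<infinity> then \<infinity> else ennreal (enn2real x powr p))"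

(* For 0 < p < \<infinity>. The integrand may take the value \<infinity>, as a variation can be infinite
   at some points. *)
definition lp_norm :: "real \<Rightarrow> 'a measure \<Rightarrow> ('a \<Rightarrow> ennreal) \<Rightarrow> ennreal" where
  "lp_norm p M f = epowr (\<integral>\<^sup>+ z. epowr (f z) p \<partial>M) (1 / p)"

(* Functions are representatives, not classes modulo equality almost everywhere;
   measurability is with respect to the completed Lebesgue measure. *)
definition lp_space :: "real \<Rightarrow> ('a::euclidean_space \<Rightarrow> complex) set" where
  "lp_space p = {F \<in> borel_measurable lebesgue.
     lp_norm p lebesgue (\<lambda>z. ennreal (norm (F z))) < \<infinity>}"

definition variation :: "real \<Rightarrow> real set \<Rightarrow> (real \<Rightarrow> 'b::banach) \<Rightarrow> ennreal" where
  "variation \<rho> U a =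
     (SUP (m, t) \<in> {(m :: nat, t :: nat \<Rightarrow> real). strict_mono_on {..m} t \<and> t ` {..m} \<subseteq> U}.
        ennreal ((\<Sum>j = 1..m. norm (a (t j) - a (t (j - 1))) powr \<rho>) powr (1 / \<rho>)))"

(* For F and G in L^4 and phi rapidly decaying, the integrand is integrable for all t > 0 at
   almost every (x, y); at the exceptional points the Bochner integral is 0 by convention. *)
definition bilinear_average ::
  "(real \<Rightarrow> complex) \<Rightarrow> (real \<times> real \<Rightarrow> complex) \<Rightarrow> (real \<times> real \<Rightarrow> complex)
     \<Rightarrow> real \<Rightarrow> real \<times> real \<Rightarrow> complex" where
  "bilinear_average \<phi> F G t = (\<lambda>(x, y).
     (LINT s|lebesgue. F (x + s, y) * G (x, y + s) * (of_real (inverse t) * \<phi> (inverse t * s))))"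

end

theory Submission
  imports Defs "HOL-Probability.Distributions" "HOL-Probability.Sinc_Integral" "HOL-Real_Asymp.Real_Asymp"
begin

text \<open>
  Within a dyadic range of scales the squared 2-variation of $t \mapsto A_t^\varphi(F,G)(x,y)$ is at
  most the integral of $|A_u^\psi(F,G)(x,y)|^2\,du/u$ over this range, where
  $\psi(s) = -(s\,\varphi(s))'$, because $u\,\partial_u A_u^\varphi = A_u^\psi$. Summed over all
  ranges, the claim becomes the square function estimate
  \[ \int_{\mathbb{R}^2}\int_0^\infty |A_u^\psi(F,G)|^2\,\frac{du}{u}
     \le C\,\|F\|_4^2\,\|G\|_4^2 \]
  for a profile \<open>\<psi>\<close> that is the derivative of a rapidly decaying function
  (\<open>square_energy_bound\<close>). By scaling \<open>F\<close> against \<open>G\<close> it suffices to bound the left side by a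
  multiple of $\|F\|_4^4 + \|G\|_4^4$, and by Fatou's lemma \<open>F\<close> and \<open>G\<close> may be bounded with bounded
  support.

  A Calderon formula on scales at most one (\<open>reproducing_formula\<close>) writes \<open>\<psi>\<close> as a superposition of
  shifted and dilated derivatives of Gaussians. After Cauchy-Schwarz, the square function of \<open>\<psi>\<close> is
  dominated pointwise by that of the derivative of a Gaussian, averaged over the shift \<open>a\<close> with the
  Poisson weight $t/(t^2+a^2)$ (\<open>square_function_pointwise\<close>). This weight is a superposition of
  Gaussian weights, so everything is reduced to Gaussians. It is essential to keep the average over
  the shift: a single shifted kernel has no symmetry, whereas the averaged one is even.

  Now substitute \<open>z = x + y + s\<close> and expand the square. There appears an integral of
  $F(z,y)\,F(z',y)\,G(x,z)\,G(x,z')$, with sheared \<open>F\<close> and \<open>G\<close>, against an explicit kernel in \<open>z - z'\<close>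
  and in $M = (z+z')/2 - x - y$. The identity \<open>hermite_correlation\<close> writes this kernel as the scale
  derivative of a Gaussian minus a Gaussian in \<open>z - z'\<close> times a second derivative of a Gaussian in
  \<open>M\<close>. The first part telescopes in the scale, and its end terms are bounded by Young's
  inequality (\<open>cross_heat_bound\<close>). In the second part the kernel in \<open>M\<close> is positive definite, and
  for fixed \<open>z, z'\<close> it couples the product $F(z,y)F(z',y)$ as a function of \<open>y\<close> with the product
  $G(x,z)G(x,z')$ as a function of \<open>x\<close>. Cauchy-Schwarz for this form (\<open>pd_slice_Cauchy_Schwarz\<close>)
  leaves integrals that involve only \<open>F\<close> or only \<open>G\<close>. For these, the scale derivative of a product
  of two Gaussians is a sum of two nonnegative terms, each of which is therefore bounded by the
  telescoping sum (\<open>pd_slice_energy_bound\<close>).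
\<close>

section \<open>Gaussian integrals and a positive definite kernel\<close>

lemma has_bochner_integral_quadratic_gaussian:
  fixes c m \<alpha> \<beta> \<gamma> :: real
  assumes c: "0 < c"
  shows "has_bochner_integral lborel
    (\<lambda>r. (\<alpha> + \<beta> * (r - m) + \<gamma> * (r - m)\<^sup>2) * exp (- c * (r - m)\<^sup>2))
    (sqrt (pi / c) * (\<alpha> + \<gamma> / (2 * c)))"
proof -
  define \<sigma> where "\<sigma> = sqrt (1 / (2 * c))"
  have \<sigma>: "0 < \<sigma>" "\<sigma>\<^sup>2 = 1 / (2 * c)" using c by (auto simp: \<sigma>_def)
  have nd: "sqrt (pi / c) * normal_density m \<sigma> r = exp (- c * (r - m)\<^sup>2)" for r
    using c by (simp add: normal_density_def \<sigma> real_sqrt_divide field_simps)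
  note m0 = normal_moment_even[OF \<sigma>(1), of m 0]
  note m1 = normal_moment_odd[OF \<sigma>(1), of m 0]
  note m2 = normal_moment_even[OF \<sigma>(1), of m 1]
  have "has_bochner_integral lborel
     (\<lambda>r. sqrt (pi / c) * (\<alpha> * (normal_density m \<sigma> r * (r - m) ^ (2 * 0))
        + \<beta> * (normal_density m \<sigma> r * (r - m) ^ (2 * 0 + 1)) + \<gamma> * (normal_density m \<sigma> r * (r - m) ^ (2 * 1))))
     (sqrt (pi / c) * (\<alpha> * (fact (2 * 0) / ((2 / \<sigma>\<^sup>2)^0 * fact 0)) + \<beta> * 0
        + \<gamma> * (fact (2 * 1) / ((2 / \<sigma>\<^sup>2)^1 * fact 1))))"
    using c by (intro has_bochner_integral_mult_right has_bochner_integral_add m0 m1 m2)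
  moreover have "(sqrt (pi / c) * (\<alpha> * (fact (2 * 0) / ((2 / \<sigma>\<^sup>2)^0 * fact 0)) + \<beta> * 0
        + \<gamma> * (fact (2 * 1) / ((2 / \<sigma>\<^sup>2)^1 * fact 1)))) = sqrt (pi / c) * (\<alpha> + \<gamma> / (2 * c))"
    using c by (simp add: \<sigma> fact_2)
  moreover have "(\<lambda>r. sqrt (pi / c) * (\<alpha> * (normal_density m \<sigma> r * (r - m) ^ (2 * 0))
        + \<beta> * (normal_density m \<sigma> r * (r - m) ^ (2 * 0 + 1)) + \<gamma> * (normal_density m \<sigma> r * (r - m) ^ (2 * 1))))
     = (\<lambda>r. (\<alpha> + \<beta> * (r - m) + \<gamma> * (r - m)\<^sup>2) * exp (- c * (r - m)\<^sup>2))"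
  proof (rule ext)
    fix r
    show "sqrt (pi / c) * (\<alpha> * (normal_density m \<sigma> r * (r - m) ^ (2 * 0))
        + \<beta> * (normal_density m \<sigma> r * (r - m) ^ (2 * 0 + 1)) + \<gamma> * (normal_density m \<sigma> r * (r - m) ^ (2 * 1)))
     = (\<alpha> + \<beta> * (r - m) + \<gamma> * (r - m)\<^sup>2) * exp (- c * (r - m)\<^sup>2)"
      unfolding nd[symmetric] by (simp add: distrib_left distrib_right mult_ac)
  qed
  ultimately show ?thesis by (simp only:)
qed

text \<open>A positive multiple of minus the second derivative of a Gaussian: its Fourier transform is
  $\xi^2$ times a Gaussian, so it is both cancellative and positive definite.\<close>
definition pd_kernel :: "real \<Rightarrow> real \<Rightarrow> real" where
  "pd_kernel c u = (1 / 2 - c * u\<^sup>2) * exp (- c * u\<^sup>2)"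

text \<open>The kernel is the autocorrelation of the derivative of a narrower Gaussian. This is its
  positive definiteness, made explicit without the Fourier transform.\<close>
lemma pd_kernel_convolution:
  fixes c u v :: real
  assumes c: "0 < c"
  shows "has_bochner_integral lborel
    (\<lambda>q. ((u - q) * exp (- 2 * c * (u - q)\<^sup>2)) * ((v - q) * exp (- 2 * c * (v - q)\<^sup>2)))
    (sqrt (pi / (4 * c)) / (4 * c) * pd_kernel c (u - v))"
proof -
  \<comment> \<open>Complete the square: centre and half-distance of the two Gaussians.\<close>
  define m where "m = (u + v) / 2"
  define d where "d = (u - v) / 2"
  have uv: "u = m + d" "v = m - d" by (auto simp: m_def d_def field_simps)
  have ex: "exp (- 2 * c * (u - q)\<^sup>2) * exp (- 2 * c * (v - q)\<^sup>2)
      = exp (- c * (u - v)\<^sup>2) * exp (- (4 * c) * (q - m)\<^sup>2)" for q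
    unfolding uv exp_add[symmetric] by (simp add: power2_eq_square algebra_simps)
  have "has_bochner_integral lborel
    (\<lambda>q. exp (- c * (u - v)\<^sup>2) * ((- d\<^sup>2 + 0 * (q - m) + 1 * (q - m)\<^sup>2) * exp (- (4 * c) * (q - m)\<^sup>2)))
    (exp (- c * (u - v)\<^sup>2) * (sqrt (pi / (4 * c)) * (- d\<^sup>2 + 1 / (2 * (4 * c)))))"
    by (intro has_bochner_integral_mult_right has_bochner_integral_quadratic_gaussian) (use c in auto)
  moreover have "exp (- c * (u - v)\<^sup>2) * ((- d\<^sup>2 + 0 * (q - m) + 1 * (q - m)\<^sup>2) * exp (- (4 * c) * (q - m)\<^sup>2))
     = ((u - q) * exp (- 2 * c * (u - q)\<^sup>2)) * ((v - q) * exp (- 2 * c * (v - q)\<^sup>2))" for q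
  proof -
    have "- d\<^sup>2 + 0 * (q - m) + 1 * (q - m)\<^sup>2 = (u - q) * (v - q)"
      unfolding uv by (simp add: power2_eq_square algebra_simps)
    then show ?thesis using ex[of q] by (simp only: mult_ac)
  qed
  moreover have "exp (- c * (u - v)\<^sup>2) * (sqrt (pi / (4 * c)) * (- d\<^sup>2 + 1 / (2 * (4 * c))))
     = sqrt (pi / (4 * c)) / (4 * c) * pd_kernel c (u - v)"
    using c by (simp add: pd_kernel_def d_def field_simps power2_eq_square)
  ultimately show ?thesis by simp
qed

lemma measurable_pd_kernel [measurable]: "pd_kernel c \<in> borel_measurable borel"
  unfolding pd_kernel_def by measurable

lemma abs_mult_exp_le: "0 \<le> x \<Longrightarrow> x * exp (- x) \<le> (1 :: real)"
  using order_trans[OF _ exp_ge_add_one_self, of x x] by (simp add: exp_minus divide_simps)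

lemma abs_pd_kernel_le: "0 < c \<Longrightarrow> \<bar>pd_kernel c u\<bar> \<le> 2"
proof -
  assume c: "0 < c"
  have "\<bar>pd_kernel c u\<bar> \<le> 1 / 2 * exp (- (c * u\<^sup>2)) + (c * u\<^sup>2) * exp (- (c * u\<^sup>2))"
    unfolding pd_kernel_def distrib_right[symmetric] abs_mult
    using c by (intro mult_mono) (auto simp: abs_le_iff)
  also have "\<dots> \<le> 1 / 2 * 1 + 1"
    using c by (intro add_mono mult_left_mono abs_mult_exp_le) auto
  finally show ?thesis by simp
qed

definition pd_form :: "real \<Rightarrow> (real \<Rightarrow> real) \<Rightarrow> (real \<Rightarrow> real) \<Rightarrow> real" where
  "pd_form c u v = (\<integral>p. u (fst p) * v (snd p) * pd_kernel c (fst p - snd p) \<partial>(lborel \<Otimes>\<^sub>M lborel))"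

lemma integrable_mult_product:
  fixes u :: "'a \<Rightarrow> real" and v :: "'b \<Rightarrow> real"
  assumes "sigma_finite_measure M" "sigma_finite_measure N"
    and u: "integrable M u" and v: "integrable N v"
  shows "integrable (M \<Otimes>\<^sub>M N) (\<lambda>p. u (fst p) * v (snd p))"
proof -
  interpret pair_sigma_finite M N using assms by (simp add: pair_sigma_finite_def)
  have [measurable]: "u \<in> borel_measurable M" "v \<in> borel_measurable N"
    using assms by auto
  show ?thesis
    by (rule Fubini_integrable) (use u v in \<open>auto simp: abs_mult\<close>)
qed

lemma integrable_mult_pair:
  fixes u v :: "real \<Rightarrow> real"
  assumes "integrable lborel u" "integrable lborel v"
  shows "integrable (lborel \<Otimes>\<^sub>M lborel) (\<lambda>p. u (fst p) * v (snd p))"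
  by (rule integrable_mult_product[OF lborel.sigma_finite_measure_axioms lborel.sigma_finite_measure_axioms assms])

lemma integrable_mult_bounded:
  fixes f g :: "'a \<Rightarrow> real"
  assumes "integrable M f" "g \<in> borel_measurable M" "\<And>x. \<bar>g x\<bar> \<le> B"
  shows "integrable M (\<lambda>x. f x * g x)"
proof (rule Bochner_Integration.integrable_bound)
  show "integrable M (\<lambda>x. B * \<bar>f x\<bar>)" using assms by auto
  show "AE x in M. norm (f x * g x) \<le> norm (B * \<bar>f x\<bar>)"
  proof (rule AE_I2)
    fix x
    have "\<bar>f x\<bar> * \<bar>g x\<bar> \<le> \<bar>f x\<bar> * \<bar>B\<bar>"
      by (intro mult_left_mono order_trans[OF assms(3)]) auto
    then show "norm (f x * g x) \<le> norm (B * \<bar>f x\<bar>)" by (simp add: abs_mult mult.commute)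
  qed
qed (use assms in measurable)

lemma integrable_pd_form:
  fixes u v :: "real \<Rightarrow> real"
  assumes "0 < c" "integrable lborel u" "integrable lborel v"
  shows "integrable (lborel \<Otimes>\<^sub>M lborel) (\<lambda>p. u (fst p) * v (snd p) * pd_kernel c (fst p - snd p))"
  by (rule integrable_mult_bounded[OF integrable_mult_pair, where B = 2])
     (use assms in \<open>auto intro: abs_pd_kernel_le\<close>)

text \<open>By the autocorrelation identity and Fubini, the form of \<open>u\<close> with itself is a positive multiple
  of the integral over $q$ of the square of $\int u(a)\,h(a-q)\,da$, where \<open>h\<close> is the
  derivative of a Gaussian.\<close>
lemma pd_form_nonneg:
  fixes u :: "real \<Rightarrow> real"
  assumes c: "0 < c" and u: "integrable lborel u"
  shows "0 \<le> pd_form c u u"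
proof -
  define h where "h r = r * exp (- 2 * c * r\<^sup>2)" for r :: real
  have [measurable]: "h \<in> borel_measurable borel" "u \<in> borel_measurable lborel"
    unfolding h_def using u by auto
  define K where "K = sqrt (pi / (4 * c)) / (4 * c)"
  have K: "0 < K" using c by (simp add: K_def)
  have conv: "has_bochner_integral lborel (\<lambda>q. h (a - q) * h (b - q)) (K * pd_kernel c (a - b))" for a b
    unfolding h_def K_def by (rule pd_kernel_convolution[OF c])
  have hsq: "(\<integral>\<^sup>+q. ennreal ((h (a - q))\<^sup>2) \<partial>lborel) = ennreal (K / 2)" for a
    using conv[of a a] by (subst nn_integral_eq_integral)
       (auto simp: has_bochner_integral_iff power2_eq_square pd_kernel_def)
  let ?P = "lborel \<Otimes>\<^sub>M lborel :: (real \<times> real) measure"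
  define w where "w = (\<lambda>(p, q). u (fst p) * u (snd p) * (h (fst p - q) * h (snd p - q)))"
  have wm [measurable]: "w \<in> borel_measurable (?P \<Otimes>\<^sub>M lborel)" unfolding w_def by measurable
  have iw: "integrable (?P \<Otimes>\<^sub>M lborel) w"
  proof (rule integrableI_bounded)
    show "w \<in> borel_measurable (?P \<Otimes>\<^sub>M lborel)" by measurable
    have "(\<integral>\<^sup>+x. ennreal (norm (w x)) \<partial>(?P \<Otimes>\<^sub>M lborel)) = (\<integral>\<^sup>+p. (\<integral>\<^sup>+q. ennreal (norm (w (p, q))) \<partial>lborel) \<partial>?P)"
      by (subst lborel.nn_integral_fst[symmetric]) auto
    also have "\<dots> \<le> (\<integral>\<^sup>+p. ennreal \<bar>u (fst p) * u (snd p)\<bar> * ennreal K \<partial>?P)"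
    proof (rule nn_integral_mono)
      fix p :: "real \<times> real"
      have "ennreal (norm (w (p, q))) \<le> ennreal \<bar>u (fst p) * u (snd p)\<bar> * (ennreal ((h (fst p - q))\<^sup>2) + ennreal ((h (snd p - q))\<^sup>2))" for q
      proof -
        have "\<bar>h (fst p - q) * h (snd p - q)\<bar> \<le> (h (fst p - q))\<^sup>2 + (h (snd p - q))\<^sup>2"
        proof -
          have "2 * \<bar>h (fst p - q) * h (snd p - q)\<bar> \<le> (h (fst p - q))\<^sup>2 + (h (snd p - q))\<^sup>2"
            using sum_squares_bound[of "\<bar>h (fst p - q)\<bar>" "\<bar>h (snd p - q)\<bar>"] by (simp add: abs_mult)
          then show ?thesis by (smt (verit) zero_le_power2)
        qed
        then have "norm (w (p, q)) \<le> \<bar>u (fst p) * u (snd p)\<bar> * ((h (fst p - q))\<^sup>2 + (h (snd p - q))\<^sup>2)"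
          unfolding w_def by (auto simp: abs_mult intro!: mult_left_mono)
        then have "ennreal (norm (w (p, q))) \<le> ennreal (\<bar>u (fst p) * u (snd p)\<bar> * ((h (fst p - q))\<^sup>2 + (h (snd p - q))\<^sup>2))"
          by (rule ennreal_leI)
        then show ?thesis by (simp add: ennreal_mult)
      qed
      then have "(\<integral>\<^sup>+q. ennreal (norm (w (p, q))) \<partial>lborel) \<le>
        (\<integral>\<^sup>+q. ennreal \<bar>u (fst p) * u (snd p)\<bar> * (ennreal ((h (fst p - q))\<^sup>2) + ennreal ((h (snd p - q))\<^sup>2)) \<partial>lborel)"
        by (intro nn_integral_mono)
      also have "\<dots> = ennreal \<bar>u (fst p) * u (snd p)\<bar> * (ennreal (K / 2) + ennreal (K / 2))"
        by (subst nn_integral_cmult) (auto simp: nn_integral_add hsq)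
      also have "\<dots> = ennreal \<bar>u (fst p) * u (snd p)\<bar> * ennreal K"
        using K by (simp flip: ennreal_plus)
      finally show "(\<integral>\<^sup>+q. ennreal (norm (w (p, q))) \<partial>lborel) \<le> ennreal \<bar>u (fst p) * u (snd p)\<bar> * ennreal K" .
    qed
    also have "\<dots> = (\<integral>\<^sup>+p. ennreal \<bar>u (fst p) * u (snd p)\<bar> \<partial>?P) * ennreal K"
      by (rule nn_integral_multc) auto
    also have "\<dots> < \<infinity>"
      using integrable_mult_pair[OF u u] by (auto simp: integrable_iff_bounded ennreal_mult_less_top)
    finally show "(\<integral>\<^sup>+x. ennreal (norm (w x)) \<partial>(?P \<Otimes>\<^sub>M lborel)) < \<infinity>" .
  qed
  interpret PQ: pair_sigma_finite ?P lborel ..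
  have "K * pd_form c u u = (\<integral>p. u (fst p) * u (snd p) * (K * pd_kernel c (fst p - snd p)) \<partial>?P)"
    unfolding pd_form_def by (simp add: mult_ac)
  also have "\<dots> = (\<integral>p. (\<integral>q. w (p, q) \<partial>lborel) \<partial>?P)"
    by (intro Bochner_Integration.integral_cong refl)
       (simp add: w_def has_bochner_integral_integral_eq[OF conv])
  also have "\<dots> = (\<integral>q. (\<integral>p. w (p, q) \<partial>?P) \<partial>lborel)"
    by (rule PQ.Fubini_integral[symmetric]) (use iw in \<open>simp add: case_prod_eta\<close>)
  also have "\<dots> \<ge> 0"
  proof (rule Bochner_Integration.integral_nonneg)
    fix q
    have "(\<integral>p. w (p, q) \<partial>?P) = (\<integral>p. (u (fst p) * h (fst p - q)) * (u (snd p) * h (snd p - q)) \<partial>?P)"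
      unfolding w_def by (simp add: mult_ac)
    also have "\<dots> = (\<integral>a. u a * h (a - q) \<partial>lborel) * (\<integral>a. u a * h (a - q) \<partial>lborel)"
    proof (cases "integrable lborel (\<lambda>a. u a * h (a - q))")
      case True
      have "(\<integral>p. (u (fst p) * h (fst p - q)) * (u (snd p) * h (snd p - q)) \<partial>?P) =
        (\<integral>a. (\<integral>b. (u a * h (a - q)) * (u b * h (b - q)) \<partial>lborel) \<partial>lborel)"
        by (subst lborel_pair.integral_fst'[symmetric])
           (use integrable_mult_pair[OF True True] in auto)
      then show ?thesis by simp
    next
      case False
      have hb: "\<bar>h r\<bar> \<le> 1 / (2 * c) + 1" for r
      proof -
        have "\<bar>r\<bar> \<le> r\<^sup>2 + 1"
          using sum_squares_bound[of "\<bar>r\<bar>" 1] zero_le_power2[of r] by (simp add: power2_abs)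
        then have "\<bar>h r\<bar> \<le> (r\<^sup>2 + 1) * exp (- (2 * c * r\<^sup>2))"
          unfolding h_def by (simp add: abs_mult)
        also have "\<dots> = 1 / (2 * c) * ((2 * c * r\<^sup>2) * exp (- (2 * c * r\<^sup>2))) + exp (- (2 * c * r\<^sup>2))"
          using c by (simp add: field_simps)
        also have "\<dots> \<le> 1 / (2 * c) * 1 + 1"
          using c by (intro add_mono mult_left_mono abs_mult_exp_le) auto
        finally show ?thesis by simp
      qed
      have "integrable lborel (\<lambda>a. u a * h (a - q))"
        by (rule integrable_mult_bounded[OF u _ hb]) auto
      with False show ?thesis by simp
    qed
    finally show "0 \<le> (\<integral>p. w (p, q) \<partial>?P)" by simp
  qed
  finally show ?thesis using K by (simp add: zero_le_mult_iff)
qed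

lemma pd_form_swap:
  assumes "u \<in> borel_measurable lborel" "v \<in> borel_measurable lborel"
  shows "pd_form c v u = pd_form c u v"
proof -
  note [measurable] = assms
  have "pd_form c v u = (\<integral>(x, y). v x * u y * pd_kernel c (x - y) \<partial>(lborel \<Otimes>\<^sub>M lborel))"
    unfolding pd_form_def by (simp add: case_prod_beta')
  also have "\<dots> = (\<integral>(x, y). v y * u x * pd_kernel c (y - x) \<partial>(lborel \<Otimes>\<^sub>M lborel))"
    using lborel_pair.integral_product_swap[of "\<lambda>(x, y). v x * u y * pd_kernel c (x - y)"]
    by (simp add: case_prod_beta')
  also have "\<dots> = pd_form c u v"
    unfolding pd_form_def by (simp add: case_prod_beta' pd_kernel_def power2_commute mult_ac)
  finally show ?thesis .
qed

text \<open>Expand the nonnegative numbers \<open>pd_form c (u \<plusminus> v) (u \<plusminus> v)\<close>. This inequality is what later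
  separates the two functions \<open>F\<close> and \<open>G\<close> from each other.\<close>
lemma pd_form_Cauchy_Schwarz:
  fixes u v :: "real \<Rightarrow> real"
  assumes c: "0 < c" and u: "integrable lborel u" and v: "integrable lborel v"
  shows "2 * \<bar>pd_form c u v\<bar> \<le> pd_form c u u + pd_form c v v"
proof -
  note i = integrable_pd_form[OF c]
  have "pd_form c (\<lambda>x. u x + s * v x) (\<lambda>x. u x + s * v x) =
     pd_form c u u + s * pd_form c u v + s * pd_form c v u + s * s * pd_form c v v" for s
  proof -
    have "pd_form c (\<lambda>x. u x + s * v x) (\<lambda>x. u x + s * v x) =
      (\<integral>p. u (fst p) * u (snd p) * pd_kernel c (fst p - snd p) + s * (u (fst p) * v (snd p) * pd_kernel c (fst p - snd p))
       + s * (v (fst p) * u (snd p) * pd_kernel c (fst p - snd p)) + s * s * (v (fst p) * v (snd p) * pd_kernel c (fst p - snd p)) \<partial>(lborel \<Otimes>\<^sub>M lborel))"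
      unfolding pd_form_def by (intro Bochner_Integration.integral_cong refl) (simp add: algebra_simps)
    also have "\<dots> = pd_form c u u + s * pd_form c u v + s * pd_form c v u + s * s * pd_form c v v"
      unfolding pd_form_def using i[OF u u] i[OF u v] i[OF v u] i[OF v v] by simp
    finally show ?thesis .
  qed
  from this[of 1] this[of "-1"] show ?thesis
    using pd_form_nonneg[OF c, of "\<lambda>x. u x + 1 * v x"] pd_form_nonneg[OF c, of "\<lambda>x. u x + (-1) * v x"] u v
    by (simp add: pd_form_swap[of u v c] borel_measurable_integrable)
qed

section \<open>Quadrilinear forms and telescoping in the scale\<close>

abbreviation plane :: "(real \<times> real) measure" where
  "plane \<equiv> lborel \<Otimes>\<^sub>M lborel"

abbreviation quad :: "((real \<times> real) \<times> (real \<times> real)) measure" where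
  "quad \<equiv> plane \<Otimes>\<^sub>M plane"

text \<open>Bounded functions with bounded support: all the multiple integrals below converge absolutely
  for them, and truncation with Fatou's lemma reaches all of $L^4$ at the end.\<close>
definition test_fun :: "(real \<times> real \<Rightarrow> real) \<Rightarrow> bool" where
  "test_fun F \<longleftrightarrow> F \<in> borel_measurable plane \<and> (\<exists>B. \<forall>p. \<bar>F p\<bar> \<le> B)
     \<and> (\<exists>R. \<forall>x y. F (x, y) \<noteq> 0 \<longrightarrow> \<bar>x\<bar> \<le> R \<and> \<bar>y\<bar> \<le> R)"

lemma test_fun_measurable: "test_fun F \<Longrightarrow> F \<in> borel_measurable plane"
  by (simp add: test_fun_def)

lemma test_fun_bounds:
  assumes "test_fun F"
  shows "\<exists>B R. 0 \<le> B \<and> (\<forall>p. \<bar>F p\<bar> \<le> B) \<and> (\<forall>x y. F (x, y) \<noteq> 0 \<longrightarrow> \<bar>x\<bar> \<le> R \<and> \<bar>y\<bar> \<le> R)"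
proof -
  from assms obtain B R where B: "\<forall>p. \<bar>F p\<bar> \<le> B" "\<forall>x y. F (x, y) \<noteq> 0 \<longrightarrow> \<bar>x\<bar> \<le> R \<and> \<bar>y\<bar> \<le> R"
    unfolding test_fun_def by blast
  have "0 \<le> \<bar>F 0\<bar>" by simp
  also have "\<dots> \<le> B" using B(1) by blast
  finally show ?thesis using B by blast
qed

lemma integrable_bounded_support:
  fixes f :: "'a \<Rightarrow> real"
  assumes "f \<in> borel_measurable M" "A \<in> sets M" "emeasure M A < \<infinity>"
    and "\<And>x. \<bar>f x\<bar> \<le> B" "\<And>x. x \<in> space M \<Longrightarrow> f x \<noteq> 0 \<Longrightarrow> x \<in> A"
  shows "integrable M f"
proof (rule integrableI_bounded_set)
  show "A \<in> sets M" "f \<in> borel_measurable M" "emeasure M A < \<infinity>" by fact+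
  show "AE x in M. x \<in> A \<longrightarrow> norm (f x) \<le> B" using assms by auto
  show "AE x in M. x \<notin> A \<longrightarrow> f x = 0" using assms by (auto intro!: AE_I2)
qed

text \<open>The point \<open>p = ((z, z'), (y, y'))\<close> lists the vertices of a four-cycle, and the product runs over
  its edges: $F(z,y)\,F(z',y)\,H(z,y')\,H(z',y')$. Such products arise from squaring an
  integral of $F(z,y)\,H(z,y')$ in $z$.\<close>
definition cross :: "(real \<times> real \<Rightarrow> real) \<Rightarrow> (real \<times> real \<Rightarrow> real) \<Rightarrow> (real \<times> real) \<times> (real \<times> real) \<Rightarrow> real" where
  "cross F H p = F (fst (fst p), fst (snd p)) * F (snd (fst p), fst (snd p)) *
    (H (fst (fst p), snd (snd p)) * H (snd (fst p), snd (snd p)))"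

lemma measurable_cross [measurable]:
  assumes [measurable]: "F \<in> borel_measurable plane" "H \<in> borel_measurable plane"
  shows "cross F H \<in> borel_measurable quad"
  unfolding cross_def by measurable

lemma emeasure_square: "emeasure plane ({-R..R} \<times> {-R..R}) < \<infinity>"
  by (subst lborel.emeasure_pair_measure_Times) (auto simp: ennreal_mult_less_top emeasure_lborel_Icc_eq)

lemma sigma_finite_plane: "sigma_finite_measure plane"
  by (intro sigma_finite_pair_measure lborel.sigma_finite_measure_axioms)

interpretation plane: sigma_finite_measure plane
  by (rule sigma_finite_plane)

interpretation quad: pair_sigma_finite plane plane
  by unfold_locales

lemma test_fun_integrable_row:
  assumes "test_fun F" shows "integrable lborel (\<lambda>y. F (z, y) * F (z', y))"
proof -
  obtain B R where B: "0 \<le> B" "\<forall>p. \<bar>F p\<bar> \<le> B" "\<forall>x y. F (x, y) \<noteq> 0 \<longrightarrow> \<bar>x\<bar> \<le> R \<and> \<bar>y\<bar> \<le> R"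
    using test_fun_bounds[OF assms] by blast
  note B = B(1) B(2)[rule_format] B(3)[rule_format]
  note [measurable] = test_fun_measurable[OF assms]
  show ?thesis
  proof (rule integrable_bounded_support[where A = "{-R..R}" and B = "B * B"])
    show "\<bar>F (z, y) * F (z', y)\<bar> \<le> B * B" for y
      unfolding abs_mult using B(1,2) by (intro mult_mono) auto
    show "y \<in> {-R..R}" if "F (z, y) * F (z', y) \<noteq> 0" for y
    proof -
      from that have "F (z, y) \<noteq> 0" by auto
      from B(3)[OF this] show ?thesis by auto
    qed
  qed (auto simp: emeasure_lborel_Icc_eq)
qed

lemma test_fun_integrable_column:
  assumes F: "test_fun F" and H: "test_fun H"
  shows "integrable lborel (\<lambda>z. F (z, y) * H (z, y'))"
proof -
  obtain B R where B: "0 \<le> B" "\<forall>p. \<bar>F p\<bar> \<le> B" "\<forall>x y. F (x, y) \<noteq> 0 \<longrightarrow> \<bar>x\<bar> \<le> R \<and> \<bar>y\<bar> \<le> R"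
    using test_fun_bounds[OF F] by blast
  obtain B' where B': "\<forall>p. \<bar>H p\<bar> \<le> B'"
    using test_fun_bounds[OF H] by blast
  note [measurable] = F[THEN test_fun_measurable] H[THEN test_fun_measurable]
  show ?thesis
  proof (rule integrable_bounded_support[where A = "{-R..R}" and B = "B * B'"])
    show "\<bar>F (z, y) * H (z, y')\<bar> \<le> B * B'" for z
      unfolding abs_mult using B(1,2) B' by (intro mult_mono) auto
    show "z \<in> {-R..R}" if "F (z, y) * H (z, y') \<noteq> 0" for z
      using that B(3)[rule_format, of z y] by auto
  qed (auto simp: emeasure_lborel_Icc_eq)
qed

lemma integrable_cross:
  assumes "test_fun F" "test_fun H" shows "integrable quad (cross F H)"
proof -
  obtain B R where B: "0 \<le> B" "\<forall>p. \<bar>F p\<bar> \<le> B" "\<forall>x y. F (x, y) \<noteq> 0 \<longrightarrow> \<bar>x\<bar> \<le> R \<and> \<bar>y\<bar> \<le> R"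
    using test_fun_bounds[OF assms(1)] by blast
  note B = B(1) B(2)[rule_format] B(3)[rule_format]
  obtain B' R' where B': "0 \<le> B'" "\<forall>p. \<bar>H p\<bar> \<le> B'" "\<forall>x y. H (x, y) \<noteq> 0 \<longrightarrow> \<bar>x\<bar> \<le> R' \<and> \<bar>y\<bar> \<le> R'"
    using test_fun_bounds[OF assms(2)] by blast
  note B' = B'(1) B'(2)[rule_format] B'(3)[rule_format]
  note [measurable] = assms[THEN test_fun_measurable]
  define S where "S = {- max R R' .. max R R'}"
  show ?thesis
  proof (rule integrable_bounded_support[where A = "(S \<times> S) \<times> (S \<times> S)" and B = "B * B * (B' * B')"])
    show "cross F H \<in> borel_measurable quad" by measurable
    show "(S \<times> S) \<times> (S \<times> S) \<in> sets quad" by (auto simp: S_def)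
    show "emeasure quad ((S \<times> S) \<times> (S \<times> S)) < \<infinity>"
      using emeasure_square[of "max R R'"]
      by (subst sigma_finite_measure.emeasure_pair_measure_Times[OF sigma_finite_plane]) (auto simp: ennreal_mult_less_top S_def)
    show "\<bar>cross F H p\<bar> \<le> B * B * (B' * B')" for p
      unfolding cross_def abs_mult using B B' by (intro mult_mono mult_nonneg_nonneg) auto
    show "p \<in> (S \<times> S) \<times> (S \<times> S)" if "cross F H p \<noteq> 0" for p
    proof -
      obtain z z' y y' where p: "p = ((z, z'), (y, y'))" by (metis surj_pair)
      show ?thesis using that unfolding p cross_def S_def
        using B(3)[of z y] B(3)[of z' y] B'(3)[of z y'] B'(3)[of z' y'] by force
    qed
  qed
qed

lemma integrable_time_slices:
  fixes g :: "'a \<times> real \<Rightarrow> real"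
  assumes M: "sigma_finite_measure M" and \<Phi>: "integrable M \<Phi>"
    and g: "g \<in> borel_measurable (M \<Otimes>\<^sub>M lborel)"
    and bd: "\<And>x t. t \<in> {\<epsilon>..T} \<Longrightarrow> \<bar>g (x, t)\<bar> \<le> B"
  shows "integrable (M \<Otimes>\<^sub>M lborel) (\<lambda>(x, t). indicator {\<epsilon>..T} t * (\<Phi> x * g (x, t)))"
    and "set_integrable lborel {\<epsilon>..T} (\<lambda>t. \<integral>x. \<Phi> x * g (x, t) \<partial>M)"
    and "(LINT t:{\<epsilon>..T}|lborel. (\<integral>x. \<Phi> x * g (x, t) \<partial>M))
       = (\<integral>x. \<Phi> x * (LINT t:{\<epsilon>..T}|lborel. g (x, t)) \<partial>M)"
proof -
  interpret M: sigma_finite_measure M by fact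
  interpret P: pair_sigma_finite M lborel by unfold_locales
  have [measurable]: "\<Phi> \<in> borel_measurable M" using \<Phi> by auto
  note g[measurable]
  have "integrable (M \<Otimes>\<^sub>M lborel) (\<lambda>p. (\<Phi> (fst p) * indicator {\<epsilon>..T} (snd p)) * (indicator {\<epsilon>..T} (snd p) * g p))"
  proof (rule integrable_mult_bounded[where B = "\<bar>B\<bar>"])
    show "integrable (M \<Otimes>\<^sub>M lborel) (\<lambda>p. \<Phi> (fst p) * indicator {\<epsilon>..T} (snd p))"
      by (rule integrable_mult_product[OF M lborel.sigma_finite_measure_axioms \<Phi>])
         (auto simp: emeasure_lborel_Icc_eq)
    show "\<bar>indicator {\<epsilon>..T} (snd p) * g p\<bar> \<le> \<bar>B\<bar>" for p
      using bd[of "snd p" "fst p"] by (auto simp: indicator_def)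
  qed measurable
  moreover have "(\<lambda>p. (\<Phi> (fst p) * indicator {\<epsilon>..T} (snd p)) * (indicator {\<epsilon>..T} (snd p) * g p))
     = (\<lambda>(x, t). indicator {\<epsilon>..T} t * (\<Phi> x * g (x, t)))"
    by (auto simp: fun_eq_iff indicator_def)
  ultimately show i: "integrable (M \<Otimes>\<^sub>M lborel) (\<lambda>(x, t). indicator {\<epsilon>..T} t * (\<Phi> x * g (x, t)))"
    by simp
  have "integrable lborel (\<lambda>t. \<integral>x. indicator {\<epsilon>..T} t * (\<Phi> x * g (x, t)) \<partial>M)"
    using P.integrable_snd[OF i] by simp
  then show "set_integrable lborel {\<epsilon>..T} (\<lambda>t. \<integral>x. \<Phi> x * g (x, t) \<partial>M)"
    unfolding set_integrable_def by simp
  have "(LINT t:{\<epsilon>..T}|lborel. (\<integral>x. \<Phi> x * g (x, t) \<partial>M)) = (\<integral>t. (\<integral>x. indicator {\<epsilon>..T} t * (\<Phi> x * g (x, t)) \<partial>M) \<partial>lborel)"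
    unfolding set_lebesgue_integral_def by simp
  also have "\<dots> = (\<integral>x. (\<integral>t. indicator {\<epsilon>..T} t * (\<Phi> x * g (x, t)) \<partial>lborel) \<partial>M)"
    by (rule P.Fubini_integral) (use i in simp)
  also have "\<dots> = (\<integral>x. \<Phi> x * (LINT t:{\<epsilon>..T}|lborel. g (x, t)) \<partial>M)"
    unfolding set_lebesgue_integral_def
    by (intro Bochner_Integration.integral_cong refl)
       (simp add: mult.left_commute[of "indicator _ _"])
  finally show "(LINT t:{\<epsilon>..T}|lborel. (\<integral>x. \<Phi> x * g (x, t) \<partial>M))
       = (\<integral>x. \<Phi> x * (LINT t:{\<epsilon>..T}|lborel. g (x, t)) \<partial>M)" .
qed

definition heat :: "real \<Rightarrow> real \<Rightarrow> real" where
  "heat q t = exp (- q / t\<^sup>2) / t\<^sup>2"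

text \<open>Minus the derivative of \<open>heat q\<close>. The prefactor $t^{-2}$ of \<open>heat\<close> normalises the two Gaussian variables
  that the quadratic form \<open>q\<close> controls.\<close>
definition heat_decay :: "real \<Rightarrow> real \<Rightarrow> real" where
  "heat_decay q t = (2 - 2 * q / t\<^sup>2) * exp (- q / t\<^sup>2) / t ^ 3"

lemma measurable_heat:
  "(\<lambda>p. heat (fst p) (snd p)) \<in> borel_measurable (borel \<Otimes>\<^sub>M borel)"
  "(\<lambda>p. heat_decay (fst p) (snd p)) \<in> borel_measurable (borel \<Otimes>\<^sub>M borel)"
  unfolding heat_def heat_decay_def by measurable

lemma heat_has_derivative:
  assumes "t \<noteq> 0"
  shows "((\<lambda>t. - heat q t) has_real_derivative heat_decay q t) (at t)"
proof -
  have "((\<lambda>t. - q * inverse t ^ 2) has_real_derivative - q * (2 * inverse t * (- (inverse t * inverse t)))) (at t)"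
    using assms by (auto intro!: derivative_eq_intros)
  then have "((\<lambda>t. - (exp (- q * inverse t ^ 2) * inverse t ^ 2)) has_real_derivative
     - (exp (- q * inverse t ^ 2) * (- q * (2 * inverse t * (- (inverse t * inverse t)))) * inverse t ^ 2
      + (2 * inverse t * (- (inverse t * inverse t))) * exp (- q * inverse t ^ 2))) (at t)"
    by (intro DERIV_minus DERIV_mult DERIV_fun_exp) (use assms in \<open>auto intro!: derivative_eq_intros\<close>)
  moreover have "- (exp (- q * inverse t ^ 2) * (- q * (2 * inverse t * (- (inverse t * inverse t)))) * inverse t ^ 2
      + (2 * inverse t * (- (inverse t * inverse t))) * exp (- q * inverse t ^ 2)) = heat_decay q t"
    unfolding heat_decay_def by (simp add: divide_inverse power_inverse power2_eq_square power3_eq_cube algebra_simps)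
  ultimately show ?thesis
    unfolding heat_def by (simp add: divide_inverse power_inverse)
qed

lemma heat_decay_integral:
  assumes "0 < \<epsilon>" "\<epsilon> \<le> T"
  shows "(LINT t:{\<epsilon>..T}|lborel. heat_decay q t) = heat q \<epsilon> - heat q T"
proof -
  have "(\<integral>t. indicator {\<epsilon>..T} t *\<^sub>R heat_decay q t \<partial>lborel) = (- heat q T) - (- heat q \<epsilon>)"
  proof (rule integral_FTC_atLeastAtMost[OF assms(2)])
    show "((\<lambda>t. - heat q t) has_vector_derivative heat_decay q x) (at x within {\<epsilon>..T})"
      if "\<epsilon> \<le> x" "x \<le> T" for x
      using heat_has_derivative[of x q] that assms
      by (auto simp: has_real_derivative_iff_has_vector_derivative intro: has_vector_derivative_at_within)
    show "continuous_on {\<epsilon>..T} (heat_decay q)"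
      unfolding heat_decay_def using assms by (intro continuous_intros) auto
  qed
  then show ?thesis by (simp add: set_lebesgue_integral_def)
qed

lemma abs_heat_decay_le:
  assumes "0 < \<epsilon>" "\<epsilon> \<le> t" "0 \<le> q"
  shows "\<bar>heat_decay q t\<bar> \<le> 4 / \<epsilon> ^ 3"
proof -
  have t: "0 < t" using assms by simp
  have "\<bar>(2 - 2 * q / t\<^sup>2) * exp (- q / t\<^sup>2)\<bar> \<le> 2 * exp (- (q / t\<^sup>2)) + 2 * ((q / t\<^sup>2) * exp (- (q / t\<^sup>2)))"
  proof -
    have "\<bar>2 - 2 * q / t\<^sup>2\<bar> \<le> 2 + 2 * (q / t\<^sup>2)" using assms t by (auto simp: abs_le_iff)
    then have "\<bar>2 - 2 * q / t\<^sup>2\<bar> * exp (- (q / t\<^sup>2)) \<le> (2 + 2 * (q / t\<^sup>2)) * exp (- (q / t\<^sup>2))"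
      by (intro mult_right_mono) auto
    then show ?thesis by (simp add: abs_mult distrib_right)
  qed
  also have "\<dots> \<le> 2 * 1 + 2 * 1"
    using assms t by (intro add_mono mult_left_mono abs_mult_exp_le) auto
  finally have a: "\<bar>(2 - 2 * q / t\<^sup>2) * exp (- q / t\<^sup>2)\<bar> \<le> 4" by simp
  have "\<bar>heat_decay q t\<bar> = \<bar>(2 - 2 * q / t\<^sup>2) * exp (- q / t\<^sup>2)\<bar> / t ^ 3"
    using t unfolding heat_decay_def by (simp add: abs_mult)
  also have "\<dots> \<le> 4 / \<epsilon> ^ 3"
    using a assms by (intro frac_le power_mono) auto
  finally show ?thesis .
qed

text \<open>The telescoping step: integration in the scale \<open>t\<close> collapses to the two end scales, so no
  constant depends on \<open>\<epsilon>\<close> or \<open>T\<close>.\<close>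
lemma integral_heat_decay:
  assumes M: "sigma_finite_measure M" and \<Phi>: "integrable M \<Phi>"
    and Q [measurable]: "Q \<in> borel_measurable M" and Q0: "\<And>x. 0 \<le> Q x"
    and eT: "0 < \<epsilon>" "\<epsilon> \<le> T"
  shows "(LINT t:{\<epsilon>..T}|lborel. (\<integral>x. \<Phi> x * heat_decay (Q x) t \<partial>M))
     = (\<integral>x. \<Phi> x * heat (Q x) \<epsilon> \<partial>M) - (\<integral>x. \<Phi> x * heat (Q x) T \<partial>M)"
    and "set_integrable lborel {\<epsilon>..T} (\<lambda>t. \<integral>x. \<Phi> x * heat_decay (Q x) t \<partial>M)"
proof -
  define g where "g = (\<lambda>(x, t). heat_decay (Q x) t)"
  have gm: "g \<in> borel_measurable (M \<Otimes>\<^sub>M lborel)"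
  proof -
    have "(\<lambda>p. heat_decay (fst (Q (fst p), snd p)) (snd (Q (fst p), snd p))) \<in> borel_measurable (M \<Otimes>\<^sub>M lborel)"
      by (rule measurable_compose[OF _ measurable_heat(2)]) measurable
    then show ?thesis by (simp add: g_def case_prod_beta')
  qed
  have bd: "\<bar>g (x, t)\<bar> \<le> 4 / \<epsilon> ^ 3" if "t \<in> {\<epsilon>..T}" for x t
    using that abs_heat_decay_le[OF eT(1) _ Q0] by (auto simp: g_def)
  note * = integrable_time_slices[OF M \<Phi>, of g \<epsilon> T, OF gm bd]
  show "set_integrable lborel {\<epsilon>..T} (\<lambda>t. \<integral>x. \<Phi> x * heat_decay (Q x) t \<partial>M)"
    using *(2) by (simp add: g_def)
  have hb: "integrable M (\<lambda>x. \<Phi> x * heat (Q x) t)" if "0 < t" for t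
  proof (rule integrable_mult_bounded[OF \<Phi>])
    show "(\<lambda>x. heat (Q x) t) \<in> borel_measurable M" unfolding heat_def by measurable
    show "\<bar>heat (Q x) t\<bar> \<le> 1 / t\<^sup>2" for x
      unfolding heat_def using Q0[of x] that by (auto simp: abs_mult divide_simps)
  qed
  have "(LINT t:{\<epsilon>..T}|lborel. (\<integral>x. \<Phi> x * heat_decay (Q x) t \<partial>M)) = (\<integral>x. \<Phi> x * (heat (Q x) \<epsilon> - heat (Q x) T) \<partial>M)"
    using *(3) by (simp add: g_def heat_decay_integral[OF eT])
  also have "\<dots> = (\<integral>x. \<Phi> x * heat (Q x) \<epsilon> \<partial>M) - (\<integral>x. \<Phi> x * heat (Q x) T \<partial>M)"
    using hb[of \<epsilon>] hb[of T] eT by (simp add: right_diff_distrib)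
  finally show "(LINT t:{\<epsilon>..T}|lborel. (\<integral>x. \<Phi> x * heat_decay (Q x) t \<partial>M))
     = (\<integral>x. \<Phi> x * heat (Q x) \<epsilon> \<partial>M) - (\<integral>x. \<Phi> x * heat (Q x) T \<partial>M)" .
qed

lemma nn_integral_quad:
  assumes [measurable]: "f \<in> borel_measurable quad"
  shows "(\<integral>\<^sup>+p. f p \<partial>quad) = (\<integral>\<^sup>+z. \<integral>\<^sup>+z'. \<integral>\<^sup>+y. \<integral>\<^sup>+y'. f ((z, z'), (y, y')) \<partial>lborel \<partial>lborel \<partial>lborel \<partial>lborel)"
proof -
  have "(\<integral>\<^sup>+p. f p \<partial>quad) = (\<integral>\<^sup>+a. \<integral>\<^sup>+b. f (a, b) \<partial>plane \<partial>plane)"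
    by (rule sigma_finite_measure.nn_integral_fst[OF sigma_finite_plane, symmetric]) measurable
  also have "\<dots> = (\<integral>\<^sup>+a. \<integral>\<^sup>+y. \<integral>\<^sup>+y'. f (a, (y, y')) \<partial>lborel \<partial>lborel \<partial>plane)"
    by (intro nn_integral_cong lborel.nn_integral_fst[symmetric]) simp
  also have "\<dots> = (\<integral>\<^sup>+z. \<integral>\<^sup>+z'. \<integral>\<^sup>+y. \<integral>\<^sup>+y'. f ((z, z'), (y, y')) \<partial>lborel \<partial>lborel \<partial>lborel \<partial>lborel)"
    by (rule lborel.nn_integral_fst[symmetric]) measurable
  finally show ?thesis .
qed

text \<open>Each factor of \<open>cross\<close> depends on one of \<open>z, z'\<close> and one of \<open>y, y'\<close>. If integrating the kernel over
  the complementary pair gives the constant \<open>C\<close>, then so much mass sits above every point.\<close>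
lemma quad_marginal:
  fixes K :: "(real \<times> real) \<times> (real \<times> real) \<Rightarrow> ennreal"
  assumes [measurable]: "K \<in> borel_measurable quad" "w \<in> borel_measurable plane"
    and y': "\<And>z z' y. (\<integral>\<^sup>+y'. K ((z, z'), (y, y')) \<partial>lborel) = g (z, z')"
    and y: "\<And>z z' y'. (\<integral>\<^sup>+y. K ((z, z'), (y, y')) \<partial>lborel) = g (z, z')"
    and z': "\<And>z. (\<integral>\<^sup>+z'. g (z, z') \<partial>lborel) = C"
    and z: "\<And>z'. (\<integral>\<^sup>+z. g (z, z') \<partial>lborel) = C"
    and [measurable]: "g \<in> borel_measurable plane"
  shows "(\<integral>\<^sup>+p. w (fst (fst p), fst (snd p)) * K p \<partial>quad) = (\<integral>\<^sup>+p. w p \<partial>plane) * C"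
    and "(\<integral>\<^sup>+p. w (snd (fst p), fst (snd p)) * K p \<partial>quad) = (\<integral>\<^sup>+p. w p \<partial>plane) * C"
    and "(\<integral>\<^sup>+p. w (fst (fst p), snd (snd p)) * K p \<partial>quad) = (\<integral>\<^sup>+p. w p \<partial>plane) * C"
    and "(\<integral>\<^sup>+p. w (snd (fst p), snd (snd p)) * K p \<partial>quad) = (\<integral>\<^sup>+p. w p \<partial>plane) * C"
proof -
  define W where "W = (\<lambda>z. \<integral>\<^sup>+y. w (z, y) \<partial>lborel)"
  have [measurable]: "W \<in> borel_measurable lborel" unfolding W_def by measurable
  have W: "(\<integral>\<^sup>+p. w p \<partial>plane) = (\<integral>\<^sup>+z. W z \<partial>lborel)"
    unfolding W_def by (rule lborel.nn_integral_fst[symmetric]) measurable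
  have in1: "(\<integral>\<^sup>+y. \<integral>\<^sup>+y'. w (a, y) * K ((z, z'), (y, y')) \<partial>lborel \<partial>lborel) = W a * g (z, z')" for a z z'
    by (simp add: nn_integral_cmult nn_integral_multc y' W_def)
  have in2: "(\<integral>\<^sup>+y. \<integral>\<^sup>+y'. w (a, y') * K ((z, z'), (y, y')) \<partial>lborel \<partial>lborel) = W a * g (z, z')" for a z z'
  proof -
    have "(\<integral>\<^sup>+y. \<integral>\<^sup>+y'. w (a, y') * K ((z, z'), (y, y')) \<partial>lborel \<partial>lborel)
        = (\<integral>\<^sup>+y'. \<integral>\<^sup>+y. w (a, y') * K ((z, z'), (y, y')) \<partial>lborel \<partial>lborel)"
      by (rule lborel_pair.Fubini') measurable
    then show ?thesis by (simp add: nn_integral_cmult nn_integral_multc y W_def)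
  qed
  have out1: "(\<integral>\<^sup>+z. \<integral>\<^sup>+z'. W z * g (z, z') \<partial>lborel \<partial>lborel) = (\<integral>\<^sup>+p. w p \<partial>plane) * C"
    by (simp add: nn_integral_cmult nn_integral_multc z' W)
  have out2: "(\<integral>\<^sup>+z. \<integral>\<^sup>+z'. W z' * g (z, z') \<partial>lborel \<partial>lborel) = (\<integral>\<^sup>+p. w p \<partial>plane) * C"
  proof -
    have "(\<integral>\<^sup>+z. \<integral>\<^sup>+z'. W z' * g (z, z') \<partial>lborel \<partial>lborel) = (\<integral>\<^sup>+z'. \<integral>\<^sup>+z. W z' * g (z, z') \<partial>lborel \<partial>lborel)"
      by (rule lborel_pair.Fubini') measurable
    then show ?thesis by (simp add: nn_integral_cmult nn_integral_multc z W)
  qed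
  show "(\<integral>\<^sup>+p. w (fst (fst p), fst (snd p)) * K p \<partial>quad) = (\<integral>\<^sup>+p. w p \<partial>plane) * C"
    by (subst nn_integral_quad, measurable) (simp add: in1 out1)
  show "(\<integral>\<^sup>+p. w (snd (fst p), fst (snd p)) * K p \<partial>quad) = (\<integral>\<^sup>+p. w p \<partial>plane) * C"
    by (subst nn_integral_quad, measurable) (simp add: in1 out2)
  show "(\<integral>\<^sup>+p. w (fst (fst p), snd (snd p)) * K p \<partial>quad) = (\<integral>\<^sup>+p. w p \<partial>plane) * C"
    by (subst nn_integral_quad, measurable) (simp add: in2 out1)
  show "(\<integral>\<^sup>+p. w (snd (fst p), snd (snd p)) * K p \<partial>quad) = (\<integral>\<^sup>+p. w p \<partial>plane) * C"
    by (subst nn_integral_quad, measurable) (simp add: in2 out2)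
qed

lemma nn_integral_gaussian:
  assumes c: "0 < c" and s: "\<bar>s\<bar> = 1"
  shows "(\<integral>\<^sup>+r. ennreal (exp (- c * (m + s * r)\<^sup>2)) \<partial>lborel) = ennreal (sqrt (pi / c))"
proof -
  have eq: "(m + s * r)\<^sup>2 = (r - (- s * m))\<^sup>2" for r
    using s by (cases "s = 1") (auto simp: abs_if power2_eq_square algebra_simps split: if_splits)
  show ?thesis
    using has_bochner_integral_quadratic_gaussian[OF c, of 1 0 "- s * m" 0]
    unfolding eq by (subst nn_integral_eq_integral) (auto simp: has_bochner_integral_iff)
qed

text \<open>Only two instances occur. With \<open>\<theta> = 0\<close>, \<open>\<sigma> = 1\<close> it is the difference \<open>y' - y\<close>, which gives the symmetric
  form of a single function; with \<open>\<theta> = 1/2\<close>, \<open>\<sigma> = -1\<close> it is the distance of the midpoint of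
  \<open>z\<close>, \<open>z'\<close> to \<open>y + y'\<close>, which comes from the bilinear average.\<close>
definition offset :: "real \<Rightarrow> real \<Rightarrow> (real \<times> real) \<times> (real \<times> real) \<Rightarrow> real" where
  "offset \<theta> \<sigma> p = \<theta> * (fst (fst p) + snd (fst p)) + \<sigma> * snd (snd p) - fst (snd p)"

definition quad_form :: "real \<Rightarrow> real \<Rightarrow> real \<Rightarrow> (real \<times> real) \<times> (real \<times> real) \<Rightarrow> real" where
  "quad_form \<tau> \<theta> \<sigma> p = (fst (fst p) - snd (fst p))\<^sup>2 / 2 + \<tau> * (offset \<theta> \<sigma> p)\<^sup>2"

lemma measurable_quad_form [measurable]:
  "offset \<theta> \<sigma> \<in> borel_measurable quad" "quad_form \<tau> \<theta> \<sigma> \<in> borel_measurable quad"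
  unfolding quad_form_def offset_def by measurable

lemma measurable_heat' [measurable]: "(\<lambda>q. heat q t) \<in> borel_measurable borel"
  unfolding heat_def by measurable

lemma quad_form_nonneg: "0 \<le> \<tau> \<Longrightarrow> 0 \<le> quad_form \<tau> \<theta> \<sigma> p"
  by (simp add: quad_form_def)

lemma heat_marginal:
  fixes \<theta> \<tau> \<sigma> t :: real
  assumes \<tau>: "0 < \<tau>" and t: "0 < t" and \<sigma>: "\<bar>\<sigma>\<bar> = 1" and w: "w \<in> borel_measurable plane"
  defines "K \<equiv> \<lambda>p. ennreal (heat (quad_form \<tau> \<theta> \<sigma> p) t)"
  defines "C \<equiv> ennreal (sqrt (2 * pi) * sqrt (pi / \<tau>))"
  shows "(\<integral>\<^sup>+p. w (fst (fst p), fst (snd p)) * K p \<partial>quad) = (\<integral>\<^sup>+p. w p \<partial>plane) * C"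
    and "(\<integral>\<^sup>+p. w (snd (fst p), fst (snd p)) * K p \<partial>quad) = (\<integral>\<^sup>+p. w p \<partial>plane) * C"
    and "(\<integral>\<^sup>+p. w (fst (fst p), snd (snd p)) * K p \<partial>quad) = (\<integral>\<^sup>+p. w p \<partial>plane) * C"
    and "(\<integral>\<^sup>+p. w (snd (fst p), snd (snd p)) * K p \<partial>quad) = (\<integral>\<^sup>+p. w p \<partial>plane) * C"
proof -
  define g where "g = (\<lambda>(z, z'). ennreal (exp (- (1 / (2 * t\<^sup>2)) * (z - z')\<^sup>2)) * ennreal (sqrt (pi / \<tau>) / t))"
  have K: "K ((z, z'), (y, y')) = ennreal (exp (- (1 / (2 * t\<^sup>2)) * (z - z')\<^sup>2) / t\<^sup>2)
     * ennreal (exp (- (\<tau> / t\<^sup>2) * (\<theta> * (z + z') + \<sigma> * y' - y)\<^sup>2))" for z z' y y'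
    unfolding K_def heat_def quad_form_def offset_def
    by (subst ennreal_mult[symmetric])
       (auto simp: exp_add[symmetric] add_divide_distrib diff_divide_distrib mult.commute)
  have sq: "sqrt (pi / (\<tau> / t\<^sup>2)) = sqrt (pi / \<tau>) * t"
    using t by (simp add: real_sqrt_mult real_sqrt_divide)
  have gg: "ennreal (exp (- (1 / (2 * t\<^sup>2)) * (z - z')\<^sup>2) / t\<^sup>2) * ennreal (sqrt (pi / (\<tau> / t\<^sup>2))) = g (z, z')" for z z'
    unfolding g_def sq prod.case using t \<tau>
    by (subst (1 2) ennreal_mult[symmetric]) (auto simp: power2_eq_square field_simps)
  have c: "0 < \<tau> / t\<^sup>2" "0 < 1 / (2 * t\<^sup>2)" using \<tau> t by auto
  note [measurable] = w
  have m: "K \<in> borel_measurable quad" unfolding K_def by measurable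
  have y': "(\<integral>\<^sup>+y'. K ((z, z'), (y, y')) \<partial>lborel) = g (z, z')" for z z' y
  proof -
    have eq: "\<theta> * (z + z') + \<sigma> * y' - y = (\<theta> * (z + z') - y) + \<sigma> * y'" for y' by simp
    have G: "(\<integral>\<^sup>+y'. ennreal (exp (- (\<tau> / t\<^sup>2) * (\<theta> * (z + z') + \<sigma> * y' - y)\<^sup>2)) \<partial>lborel) = ennreal (sqrt (pi / (\<tau> / t\<^sup>2)))"
      unfolding eq by (rule nn_integral_gaussian[OF c(1) \<sigma>])
    show ?thesis
      unfolding K gg[symmetric] by (subst nn_integral_cmult, measurable) (simp only: G)
  qed
  have y: "(\<integral>\<^sup>+y. K ((z, z'), (y, y')) \<partial>lborel) = g (z, z')" for z z' y'
  proof -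
    have "\<theta> * (z + z') + \<sigma> * y' - y = (\<theta> * (z + z') + \<sigma> * y') + (- 1) * y" for y by simp
    then show ?thesis
      unfolding K gg[symmetric]
      by (subst nn_integral_cmult) (use nn_integral_gaussian[OF c(1), of "- 1" "\<theta> * (z + z') + \<sigma> * y'"] in auto)
  qed
  have C: "ennreal (sqrt (pi / (1 / (2 * t\<^sup>2)))) * ennreal (sqrt (pi / \<tau>) / t) = C"
  proof -
    have "sqrt (pi / (1 / (2 * t\<^sup>2))) = sqrt (2 * pi) * t" using t by (simp add: real_sqrt_mult)
    then show ?thesis unfolding C_def using t \<tau> by (subst ennreal_mult[symmetric]) auto
  qed
  have z': "(\<integral>\<^sup>+z'. g (z, z') \<partial>lborel) = C" for z
    unfolding g_def prod.case C[symmetric]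
    by (subst nn_integral_multc) (use nn_integral_gaussian[OF c(2), of "- 1" z] in auto)
  have z: "(\<integral>\<^sup>+z. g (z, z') \<partial>lborel) = C" for z'
    unfolding g_def prod.case C[symmetric]
    by (subst nn_integral_multc) (use nn_integral_gaussian[OF c(2), of 1 "- z'"] in auto)
  have gm: "g \<in> borel_measurable plane" unfolding g_def by measurable
  show "(\<integral>\<^sup>+p. w (fst (fst p), fst (snd p)) * K p \<partial>quad) = (\<integral>\<^sup>+p. w p \<partial>plane) * C"
    and "(\<integral>\<^sup>+p. w (snd (fst p), fst (snd p)) * K p \<partial>quad) = (\<integral>\<^sup>+p. w p \<partial>plane) * C"
    and "(\<integral>\<^sup>+p. w (fst (fst p), snd (snd p)) * K p \<partial>quad) = (\<integral>\<^sup>+p. w p \<partial>plane) * C"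
    and "(\<integral>\<^sup>+p. w (snd (fst p), snd (snd p)) * K p \<partial>quad) = (\<integral>\<^sup>+p. w p \<partial>plane) * C"
    using quad_marginal[OF m w y' y z' z gm] by simp_all
qed

lemma abs_prod4_le: "\<bar>a * b * (c * d)\<bar> \<le> (a ^ 4 + b ^ 4 + c ^ 4 + d ^ 4) / (4 :: real)"
proof -
  have "2 * \<bar>(a * b) * (c * d)\<bar> \<le> (a * b)\<^sup>2 + (c * d)\<^sup>2"
    using sum_squares_bound[of "\<bar>a * b\<bar>" "\<bar>c * d\<bar>"] by (simp add: abs_mult mult_ac power_mult_distrib)
  moreover have "2 * (a * b)\<^sup>2 \<le> a ^ 4 + b ^ 4"
    using sum_squares_bound[of "a\<^sup>2" "b\<^sup>2"] by (simp add: power_mult_distrib flip: power_mult)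
  moreover have "2 * (c * d)\<^sup>2 \<le> c ^ 4 + d ^ 4"
    using sum_squares_bound[of "c\<^sup>2" "d\<^sup>2"] by (simp add: power_mult_distrib flip: power_mult)
  ultimately show ?thesis by simp
qed

lemma test_fun_integrable_power4:
  assumes "test_fun F" shows "integrable plane (\<lambda>p. F p ^ 4)"
proof -
  obtain B R where B: "0 \<le> B" "\<forall>p. \<bar>F p\<bar> \<le> B" "\<forall>x y. F (x, y) \<noteq> 0 \<longrightarrow> \<bar>x\<bar> \<le> R \<and> \<bar>y\<bar> \<le> R"
    using test_fun_bounds[OF assms] by blast
  note [measurable] = test_fun_measurable[OF assms]
  show ?thesis
  proof (rule integrable_bounded_support[where A = "{-R..R} \<times> {-R..R}" and B = "B ^ 4"])
    show "\<bar>F p ^ 4\<bar> \<le> B ^ 4" for p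
      unfolding power_abs using B(1) B(2)[rule_format, of p] by (intro power_mono) auto
    show "p \<in> {-R..R} \<times> {-R..R}" if "F p ^ 4 \<noteq> 0" for p
      using that B(3)[rule_format, of "fst p" "snd p"] by (cases p) auto
    show "emeasure plane ({- R..R} \<times> {- R..R}) < \<infinity>" by (rule emeasure_square)
  qed auto
qed

definition fourth_moment :: "(real \<times> real \<Rightarrow> real) \<Rightarrow> real" where
  "fourth_moment F = (\<integral>p. F p ^ 4 \<partial>plane)"

lemma fourth_moment_nonneg: "0 \<le> fourth_moment F"
  unfolding fourth_moment_def by (rule Bochner_Integration.integral_nonneg) simp

text \<open>Bound the product of four values by the mean of their fourth powers and integrate the kernel
  over the two variables that do not occur. The bound is uniform in the scale \<open>t\<close>, as the end terms of
  the telescoping identity require.\<close>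
lemma cross_heat_bound:
  assumes F: "test_fun F" and H: "test_fun H" and \<tau>: "0 < \<tau>" and t: "0 < t" and \<sigma>: "\<bar>\<sigma>\<bar> = 1"
  shows "\<bar>\<integral>p. cross F H p * heat (quad_form \<tau> \<theta> \<sigma> p) t \<partial>quad\<bar>
     \<le> sqrt (2 * pi) * sqrt (pi / \<tau>) * ((fourth_moment F + fourth_moment H) / 2)"
proof -
  note [measurable] = F[THEN test_fun_measurable] H[THEN test_fun_measurable]
  define k where "k p = heat (quad_form \<tau> \<theta> \<sigma> p) t" for p
  define K where "K p = ennreal (k p)" for p
  define C where "C = sqrt (2 * pi) * sqrt (pi / \<tau>)"
  have C0: "0 \<le> C" using \<tau> by (simp add: C_def)
  have k0: "0 \<le> k p" for p by (simp add: k_def heat_def)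
  have [measurable]: "k \<in> borel_measurable quad" unfolding k_def by measurable
  have [measurable]: "K \<in> borel_measurable quad" unfolding K_def by measurable
  define f where "f p = ennreal (F p ^ 4)" for p
  define h where "h p = ennreal (H p ^ 4)" for p
  have [measurable]: "f \<in> borel_measurable plane" "h \<in> borel_measurable plane"
    unfolding f_def h_def by measurable
  have ef: "(\<integral>\<^sup>+p. f p \<partial>plane) = ennreal (fourth_moment F)" "(\<integral>\<^sup>+p. h p \<partial>plane) = ennreal (fourth_moment H)"
    unfolding f_def h_def fourth_moment_def
    using F H by (auto intro!: nn_integral_eq_integral test_fun_integrable_power4)
  note marg = heat_marginal[OF \<tau> t \<sigma>, where \<theta> = \<theta>, folded k_def K_def C_def]
  have "ennreal \<bar>\<integral>p. cross F H p * k p \<partial>quad\<bar> \<le> (\<integral>\<^sup>+p. norm (cross F H p * k p) \<partial>quad)"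
    using integral_norm_bound_ennreal[of quad "\<lambda>p. cross F H p * k p"]
    by (cases "integrable quad (\<lambda>p. cross F H p * k p)") (auto simp: not_integrable_integral_eq)
  also have "\<dots> \<le> (\<integral>\<^sup>+p. ennreal (1 / 4) * (f (fst (fst p), fst (snd p)) * K p + f (snd (fst p), fst (snd p)) * K p
       + h (fst (fst p), snd (snd p)) * K p + h (snd (fst p), snd (snd p)) * K p) \<partial>quad)"
  proof (rule nn_integral_mono)
    fix p
    have "norm (cross F H p * k p) \<le> (F (fst (fst p), fst (snd p)) ^ 4 + F (snd (fst p), fst (snd p)) ^ 4 +
       H (fst (fst p), snd (snd p)) ^ 4 + H (snd (fst p), snd (snd p)) ^ 4) / 4 * k p"
    proof -
      have "norm (cross F H p * k p) = \<bar>cross F H p\<bar> * k p" using k0[of p] by (simp add: abs_mult)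
      also have "\<dots> \<le> (F (fst (fst p), fst (snd p)) ^ 4 + F (snd (fst p), fst (snd p)) ^ 4 +
       H (fst (fst p), snd (snd p)) ^ 4 + H (snd (fst p), snd (snd p)) ^ 4) / 4 * k p"
        unfolding cross_def by (intro mult_right_mono abs_prod4_le k0)
      finally show ?thesis .
    qed
    also have "\<dots> = 1 / 4 * (F (fst (fst p), fst (snd p)) ^ 4 * k p + F (snd (fst p), fst (snd p)) ^ 4 * k p +
       H (fst (fst p), snd (snd p)) ^ 4 * k p + H (snd (fst p), snd (snd p)) ^ 4 * k p)"
      by (simp add: field_simps)
    finally have "ennreal (norm (cross F H p * k p)) \<le> ennreal (1 / 4 * (F (fst (fst p), fst (snd p)) ^ 4 * k p + F (snd (fst p), fst (snd p)) ^ 4 * k p +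
       H (fst (fst p), snd (snd p)) ^ 4 * k p + H (snd (fst p), snd (snd p)) ^ 4 * k p))"
      by (rule ennreal_leI)
    also have "\<dots> = ennreal (1 / 4) * (f (fst (fst p), fst (snd p)) * K p + f (snd (fst p), fst (snd p)) * K p
       + h (fst (fst p), snd (snd p)) * K p + h (snd (fst p), snd (snd p)) * K p)"
      using k0[of p] by (simp add: f_def h_def K_def ennreal_mult[symmetric] ennreal_plus[symmetric] del: ennreal_plus)
    finally show "ennreal (norm (cross F H p * k p)) \<le> ennreal (1 / 4) * (f (fst (fst p), fst (snd p)) * K p + f (snd (fst p), fst (snd p)) * K p
       + h (fst (fst p), snd (snd p)) * K p + h (snd (fst p), snd (snd p)) * K p)" .
  qed
  also have "\<dots> = ennreal (1 / 4) * (ennreal (fourth_moment F) * ennreal C + ennreal (fourth_moment F) * ennreal C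
      + ennreal (fourth_moment H) * ennreal C + ennreal (fourth_moment H) * ennreal C)"
    by (simp add: nn_integral_cmult nn_integral_add marg ef)
  also have "\<dots> = ennreal (C * ((fourth_moment F + fourth_moment H) / 2))"
    using C0 fourth_moment_nonneg[of F] fourth_moment_nonneg[of H]
    by (simp add: ennreal_mult[symmetric] ennreal_plus[symmetric] field_simps del: ennreal_plus)
  finally show ?thesis
    using C0 fourth_moment_nonneg[of F] fourth_moment_nonneg[of H]
    unfolding k_def C_def by (simp add: ennreal_le_iff)
qed

lemma pd_kernel_unit: "\<bar>\<sigma>\<bar> = 1 \<Longrightarrow> pd_kernel c (\<sigma> * u) = pd_kernel c u"
  using power2_abs[of \<sigma>] by (simp add: pd_kernel_def power_mult_distrib)

lemma integrable_affine:
  fixes f :: "real \<Rightarrow> real"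
  assumes "integrable lborel f" "\<bar>\<sigma>\<bar> = 1"
  shows "integrable lborel (\<lambda>x. f (m + \<sigma> * x))"
  using assms by (intro lborel_integrable_real_affine) auto

lemma integral_affine:
  fixes f :: "real \<Rightarrow> real"
  assumes "\<bar>\<sigma>\<bar> = 1"
  shows "(\<integral>x. f (m + \<sigma> * x) \<partial>lborel) = (\<integral>x. f x \<partial>lborel)"
  using lborel_integral_real_affine[of \<sigma> f m] assms by auto

lemma pd_form_iterated:
  assumes "0 < c" "integrable lborel u" "integrable lborel v"
  shows "pd_form c u v = (\<integral>x. (\<integral>y. u x * v y * pd_kernel c (x - y) \<partial>lborel) \<partial>lborel)"
  unfolding pd_form_def using lborel_pair.integral_fst'[OF integrable_pd_form[OF assms]] by simp

text \<open>A translation and possibly a reflection of \<open>f\<close> turn the kernel in \<open>m + \<sigma> y' - y\<close> into a kernel in a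
  difference of variables, because \<open>pd_kernel\<close> is even.\<close>
lemma pd_form_shift:
  assumes c: "0 < c" and f: "integrable lborel f" and h: "integrable lborel h" and \<sigma>: "\<bar>\<sigma>\<bar> = 1"
  shows "(\<integral>q. f (fst q) * h (snd q) * pd_kernel c (m + \<sigma> * snd q - fst q) \<partial>plane) = pd_form c (\<lambda>x. f (m + \<sigma> * x)) h"
proof -
  have [measurable]: "f \<in> borel_measurable lborel" "h \<in> borel_measurable lborel" using f h by auto
  have i: "integrable plane (\<lambda>q. f (fst q) * h (snd q) * pd_kernel c (m + \<sigma> * snd q - fst q))"
    by (rule integrable_mult_bounded[OF integrable_mult_pair[OF f h], where B = 2])
       (use c in \<open>auto intro: abs_pd_kernel_le\<close>)
  have "(\<integral>q. f (fst q) * h (snd q) * pd_kernel c (m + \<sigma> * snd q - fst q) \<partial>plane)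
     = (\<integral>y. (\<integral>y'. f y * h y' * pd_kernel c (m + \<sigma> * y' - y) \<partial>lborel) \<partial>lborel)"
    using lborel_pair.integral_fst'[OF i] by simp
  also have "\<dots> = (\<integral>x. (\<integral>y'. f (m + \<sigma> * x) * h y' * pd_kernel c (m + \<sigma> * y' - (m + \<sigma> * x)) \<partial>lborel) \<partial>lborel)"
    by (rule integral_affine[OF \<sigma>, symmetric])
  also have "\<dots> = (\<integral>x. (\<integral>y'. f (m + \<sigma> * x) * h y' * pd_kernel c (x - y') \<partial>lborel) \<partial>lborel)"
  proof -
    have "pd_kernel c (m + \<sigma> * y' - (m + \<sigma> * x)) = pd_kernel c (x - y')" for x y'
      using pd_kernel_unit[of "- \<sigma>" c "x - y'"] \<sigma> by (simp add: algebra_simps)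
    then show ?thesis by simp
  qed
  also have "\<dots> = pd_form c (\<lambda>x. f (m + \<sigma> * x)) h"
    by (rule pd_form_iterated[OF c integrable_affine[OF f \<sigma>] h, symmetric])
  finally show ?thesis .
qed

lemma pd_form_affine:
  assumes c: "0 < c" and f: "integrable lborel f" and \<sigma>: "\<bar>\<sigma>\<bar> = 1"
  shows "pd_form c (\<lambda>x. f (m + \<sigma> * x)) (\<lambda>x. f (m + \<sigma> * x)) = pd_form c f f"
proof -
  note fa = integrable_affine[OF f \<sigma>, of m]
  have "pd_form c f f = (\<integral>x. (\<integral>y. f x * f y * pd_kernel c (x - y) \<partial>lborel) \<partial>lborel)"
    by (rule pd_form_iterated[OF c f f])
  also have "\<dots> = (\<integral>x. (\<integral>y. f (m + \<sigma> * x) * f y * pd_kernel c (m + \<sigma> * x - y) \<partial>lborel) \<partial>lborel)"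
    by (rule integral_affine[OF \<sigma>, symmetric])
  also have "\<dots> = (\<integral>x. (\<integral>y. f (m + \<sigma> * x) * f (m + \<sigma> * y) * pd_kernel c (m + \<sigma> * x - (m + \<sigma> * y)) \<partial>lborel) \<partial>lborel)"
    by (intro Bochner_Integration.integral_cong refl integral_affine[OF \<sigma>, symmetric])
  also have "\<dots> = (\<integral>x. (\<integral>y. f (m + \<sigma> * x) * f (m + \<sigma> * y) * pd_kernel c (x - y) \<partial>lborel) \<partial>lborel)"
  proof -
    have "pd_kernel c (m + \<sigma> * x - (m + \<sigma> * y)) = pd_kernel c (x - y)" for x y
      using pd_kernel_unit[OF \<sigma>, of c "x - y"] by (simp add: algebra_simps)
    then show ?thesis by simp
  qed
  also have "\<dots> = pd_form c (\<lambda>x. f (m + \<sigma> * x)) (\<lambda>x. f (m + \<sigma> * x))"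
    by (rule pd_form_iterated[OF c fa fa, symmetric])
  finally show ?thesis by simp
qed

definition gap :: "(real \<times> real) \<times> (real \<times> real) \<Rightarrow> real" where
  "gap p = fst (fst p) - snd (fst p)"

lemma measurable_gap [measurable]: "gap \<in> borel_measurable quad"
  unfolding gap_def by measurable

text \<open>One scale of the quadrilinear form that is cancellative in the \<open>y\<close> variables and a plain Gaussian in
  \<open>z - z'\<close>.\<close>
definition pd_slice where
  "pd_slice F H \<tau> \<theta> \<sigma> t =
     (\<integral>p. cross F H p * (exp (- (gap p)\<^sup>2 / (2 * t\<^sup>2)) * pd_kernel (\<tau> / t\<^sup>2) (offset \<theta> \<sigma> p)) \<partial>quad)"

text \<open>The product rule: differentiating a product of two Gaussians in the scale gives two terms, each
  of which is positive definite in one pair of variables and positive in the other.\<close>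
lemma heat_decay_split:
  assumes "t > 0"
  shows "heat_decay (quad_form \<tau> \<theta> \<sigma> p) t = 2 / t ^ 3 *
    (exp (- (gap p)\<^sup>2 / (2 * t\<^sup>2)) * pd_kernel (\<tau> / t\<^sup>2) (offset \<theta> \<sigma> p)
     + exp (- \<tau> * (offset \<theta> \<sigma> p)\<^sup>2 / t\<^sup>2) * pd_kernel (1 / (2 * t\<^sup>2)) (gap p))"
proof -
  define d where "d = (gap p)\<^sup>2 / (2 * t\<^sup>2)"
  define e where "e = \<tau> * (offset \<theta> \<sigma> p)\<^sup>2 / t\<^sup>2"
  have q: "quad_form \<tau> \<theta> \<sigma> p / t\<^sup>2 = d + e"
    unfolding quad_form_def d_def e_def gap_def by (simp add: add_divide_distrib)
  have "heat_decay (quad_form \<tau> \<theta> \<sigma> p) t = (2 - 2 * (d + e)) * exp (- (d + e)) / t ^ 3"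
    unfolding heat_decay_def q[symmetric] by simp
  also have "(2 - 2 * (d + e)) * exp (- (d + e)) = 2 * (exp (- d) * ((1 / 2 - e) * exp (- e)) + exp (- e) * ((1 / 2 - d) * exp (- d)))"
    unfolding minus_add_distrib exp_add by (simp add: algebra_simps)
  also have "\<dots> / t ^ 3 = 2 / t ^ 3 * (exp (- d) * ((1 / 2 - e) * exp (- e)) + exp (- e) * ((1 / 2 - d) * exp (- d)))"
    by simp
  finally show ?thesis
    by (simp add: d_def e_def pd_kernel_def)
qed

lemma abs_gauss_pd_le:
  assumes "0 < c" "0 \<le> x"
  shows "\<bar>exp (- x) * pd_kernel c u\<bar> \<le> 2"
proof -
  have "\<bar>exp (- x) * pd_kernel c u\<bar> \<le> 1 * 2"
    unfolding abs_mult using assms abs_pd_kernel_le[of c u] by (intro mult_mono) auto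
  then show ?thesis by simp
qed

lemma integrable_pd_slice:
  assumes F: "test_fun F" and H: "test_fun H" and \<tau>: "0 < \<tau>" and t: "0 < t"
  shows "integrable quad (\<lambda>p. cross F H p * (exp (- (gap p)\<^sup>2 / (2 * t\<^sup>2)) * pd_kernel (\<tau> / t\<^sup>2) (offset \<theta> \<sigma> p)))"
    and "integrable quad (\<lambda>p. cross F H p * (exp (- \<tau> * (offset \<theta> \<sigma> p)\<^sup>2 / t\<^sup>2) * pd_kernel (1 / (2 * t\<^sup>2)) (gap p)))"
proof -
  show "integrable quad (\<lambda>p. cross F H p * (exp (- (gap p)\<^sup>2 / (2 * t\<^sup>2)) * pd_kernel (\<tau> / t\<^sup>2) (offset \<theta> \<sigma> p)))"
    using abs_gauss_pd_le[of "\<tau> / t\<^sup>2" "(gap _)\<^sup>2 / (2 * t\<^sup>2)"] \<tau> t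
    by (intro integrable_mult_bounded[OF integrable_cross[OF F H], where B = 2]) auto
  show "integrable quad (\<lambda>p. cross F H p * (exp (- \<tau> * (offset \<theta> \<sigma> p)\<^sup>2 / t\<^sup>2) * pd_kernel (1 / (2 * t\<^sup>2)) (gap p)))"
    using abs_gauss_pd_le[of "1 / (2 * t\<^sup>2)" "\<tau> * (offset _ _ _)\<^sup>2 / t\<^sup>2"] \<tau> t
    by (intro integrable_mult_bounded[OF integrable_cross[OF F H], where B = 2]) auto
qed

lemma pd_slice_iterated:
  assumes F: "test_fun F" and H: "test_fun H" and \<tau>: "0 < \<tau>" and t: "0 < t" and \<sigma>: "\<bar>\<sigma>\<bar> = 1"
  defines "e \<equiv> \<lambda>q. exp (- (fst q - snd q)\<^sup>2 / (2 * t\<^sup>2))"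
  defines "c \<equiv> \<tau> / t\<^sup>2"
  defines "f \<equiv> \<lambda>q y. F (fst q, y) * F (snd q, y)"
  defines "h \<equiv> \<lambda>q y. H (fst q, y) * H (snd q, y)"
  shows "pd_slice F H \<tau> \<theta> \<sigma> t = (\<integral>q. e q * pd_form c (\<lambda>x. f q (\<theta> * (fst q + snd q) + \<sigma> * x)) (h q) \<partial>plane)"
    and "integrable plane (\<lambda>q. e q * pd_form c (\<lambda>x. f q (\<theta> * (fst q + snd q) + \<sigma> * x)) (h q))"
proof -
  have c: "0 < c" using \<tau> t by (simp add: c_def)
  have "(\<integral>r. cross F H (q, r) * (exp (- (gap (q, r))\<^sup>2 / (2 * t\<^sup>2)) * pd_kernel (\<tau> / t\<^sup>2) (offset \<theta> \<sigma> (q, r))) \<partial>plane)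
     = e q * pd_form c (\<lambda>x. f q (\<theta> * (fst q + snd q) + \<sigma> * x)) (h q)" for q
  proof -
    have "(\<integral>r. cross F H (q, r) * (exp (- (gap (q, r))\<^sup>2 / (2 * t\<^sup>2)) * pd_kernel (\<tau> / t\<^sup>2) (offset \<theta> \<sigma> (q, r))) \<partial>plane)
      = (\<integral>r. e q * (f q (fst r) * h q (snd r) * pd_kernel c (\<theta> * (fst q + snd q) + \<sigma> * snd r - fst r)) \<partial>plane)"
      unfolding cross_def gap_def offset_def e_def f_def h_def c_def by (simp add: mult_ac)
    also have "\<dots> = e q * (\<integral>r. f q (fst r) * h q (snd r) * pd_kernel c (\<theta> * (fst q + snd q) + \<sigma> * snd r - fst r) \<partial>plane)"
      by simp
    also have "\<dots> = e q * pd_form c (\<lambda>x. f q (\<theta> * (fst q + snd q) + \<sigma> * x)) (h q)"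
      by (subst pd_form_shift[OF c _ _ \<sigma>]) (auto simp: f_def h_def intro: test_fun_integrable_row F H)
    finally show ?thesis .
  qed
  with quad.integral_fst'[OF integrable_pd_slice(1)[OF F H \<tau> t, of \<theta> \<sigma>]]
    quad.integrable_fst'[OF integrable_pd_slice(1)[OF F H \<tau> t, of \<theta> \<sigma>]]
  show "pd_slice F H \<tau> \<theta> \<sigma> t = (\<integral>q. e q * pd_form c (\<lambda>x. f q (\<theta> * (fst q + snd q) + \<sigma> * x)) (h q) \<partial>plane)"
    and "integrable plane (\<lambda>q. e q * pd_form c (\<lambda>x. f q (\<theta> * (fst q + snd q) + \<sigma> * x)) (h q))"
    unfolding pd_slice_def by simp_all
qed

text \<open>For fixed \<open>z\<close> and \<open>z'\<close> the inner integral is \<open>pd_form\<close> of a shifted product of values of \<open>F\<close> and a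
  product of values of \<open>H\<close>. The Cauchy-Schwarz inequality for \<open>pd_form\<close> splits it into a part with
  \<open>F\<close> only and a part with \<open>H\<close> only; the shift disappears there by translation invariance.\<close>
lemma pd_slice_Cauchy_Schwarz:
  assumes F: "test_fun F" and H: "test_fun H" and \<tau>: "0 < \<tau>" and t: "0 < t" and \<sigma>: "\<bar>\<sigma>\<bar> = 1"
  shows "2 * \<bar>pd_slice F H \<tau> \<theta> \<sigma> t\<bar> \<le> pd_slice F F \<tau> 0 1 t + pd_slice H H \<tau> 0 1 t"
    and "0 \<le> pd_slice F F \<tau> 0 1 t"
proof -
  define e where "e q = exp (- (fst q - snd q)\<^sup>2 / (2 * t\<^sup>2))" for q :: "real \<times> real"
  define c where "c = \<tau> / t\<^sup>2"
  define f where "f q y = F (fst q, y) * F (snd q, y)" for q :: "real \<times> real" and y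
  define h where "h q y = H (fst q, y) * H (snd q, y)" for q :: "real \<times> real" and y
  have c: "0 < c" using \<tau> t by (simp add: c_def)
  have fi: "integrable lborel (f q)" and hi: "integrable lborel (h q)" for q
    unfolding f_def h_def by (auto intro: test_fun_integrable_row F H)
  note FH = pd_slice_iterated[OF F H \<tau> t \<sigma>, of \<theta>, folded e_def c_def f_def h_def]
  note FF = pd_slice_iterated[OF F F \<tau> t, of 1 0, folded e_def c_def f_def, simplified]
  note HH = pd_slice_iterated[OF H H \<tau> t, of 1 0, folded e_def c_def h_def, simplified]
  have e0: "0 \<le> e q" for q by (simp add: e_def)
  show "0 \<le> pd_slice F F \<tau> 0 1 t"
    unfolding FF(1) by (intro Bochner_Integration.integral_nonneg mult_nonneg_nonneg e0 pd_form_nonneg c fi)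
  have b: "2 * \<bar>pd_form c (\<lambda>x. f q (\<theta> * (fst q + snd q) + \<sigma> * x)) (h q)\<bar> \<le> pd_form c (f q) (f q) + pd_form c (h q) (h q)" for q
    using pd_form_Cauchy_Schwarz[OF c integrable_affine[OF fi \<sigma>] hi, of q "\<theta> * (fst q + snd q)" q]
      pd_form_affine[OF c fi \<sigma>, of q "\<theta> * (fst q + snd q)"] by simp
  have "2 * \<bar>pd_slice F H \<tau> \<theta> \<sigma> t\<bar> \<le> 2 * (\<integral>q. \<bar>e q * pd_form c (\<lambda>x. f q (\<theta> * (fst q + snd q) + \<sigma> * x)) (h q)\<bar> \<partial>plane)"
    unfolding FH(1) by (intro mult_left_mono integral_abs_bound) auto
  also have "\<dots> = (\<integral>q. 2 * \<bar>e q * pd_form c (\<lambda>x. f q (\<theta> * (fst q + snd q) + \<sigma> * x)) (h q)\<bar> \<partial>plane)"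
    by simp
  also have "\<dots> \<le> (\<integral>q. e q * pd_form c (f q) (f q) + e q * pd_form c (h q) (h q) \<partial>plane)"
  proof (rule integral_mono)
    show "integrable plane (\<lambda>q. 2 * \<bar>e q * pd_form c (\<lambda>x. f q (\<theta> * (fst q + snd q) + \<sigma> * x)) (h q)\<bar>)"
      using FH(2) by (intro integrable_mult_right integrable_abs)
    show "integrable plane (\<lambda>q. e q * pd_form c (f q) (f q) + e q * pd_form c (h q) (h q))"
      using FF(2) HH(2) by (rule Bochner_Integration.integrable_add)
    show "2 * \<bar>e q * pd_form c (\<lambda>x. f q (\<theta> * (fst q + snd q) + \<sigma> * x)) (h q)\<bar>
      \<le> e q * pd_form c (f q) (f q) + e q * pd_form c (h q) (h q)" for q
      using mult_left_mono[OF b[of q] e0[of q]] e0[of q] by (simp add: abs_mult algebra_simps)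
  qed
  also have "\<dots> = pd_slice F F \<tau> 0 1 t + pd_slice H H \<tau> 0 1 t"
    unfolding FF(1) HH(1) using FF(2) HH(2) by (rule Bochner_Integration.integral_add)
  finally show "2 * \<bar>pd_slice F H \<tau> \<theta> \<sigma> t\<bar> \<le> pd_slice F F \<tau> 0 1 t + pd_slice H H \<tau> 0 1 t" .
qed

lemma gap_slice_nonneg:
  assumes F: "test_fun F" and \<tau>: "0 < \<tau>" and t: "0 < t"
  shows "0 \<le> (\<integral>p. cross F F p * (exp (- \<tau> * (offset 0 1 p)\<^sup>2 / t\<^sup>2) * pd_kernel (1 / (2 * t\<^sup>2)) (gap p)) \<partial>quad)"
proof -
  note i = integrable_pd_slice(2)[OF F F \<tau> t, of 0 1]
  have "(\<integral>p. cross F F p * (exp (- \<tau> * (offset 0 1 p)\<^sup>2 / t\<^sup>2) * pd_kernel (1 / (2 * t\<^sup>2)) (gap p)) \<partial>quad)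
    = (\<integral>r. (\<integral>q. cross F F (q, r) * (exp (- \<tau> * (offset 0 1 (q, r))\<^sup>2 / t\<^sup>2) * pd_kernel (1 / (2 * t\<^sup>2)) (gap (q, r))) \<partial>plane) \<partial>plane)"
    using quad.integral_snd[of "\<lambda>q r. cross F F (q, r) * (exp (- \<tau> * (offset 0 1 (q, r))\<^sup>2 / t\<^sup>2) * pd_kernel (1 / (2 * t\<^sup>2)) (gap (q, r)))"] i
    by (simp add: case_prod_beta')
  also have "\<dots> \<ge> 0"
  proof (rule Bochner_Integration.integral_nonneg)
    fix r :: "real \<times> real"
    define f where "f z = F (z, fst r) * F (z, snd r)" for z
    have fi: "integrable lborel f" unfolding f_def by (rule test_fun_integrable_column[OF F F])
    have "(\<integral>q. cross F F (q, r) * (exp (- \<tau> * (offset 0 1 (q, r))\<^sup>2 / t\<^sup>2) * pd_kernel (1 / (2 * t\<^sup>2)) (gap (q, r))) \<partial>plane)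
      = (\<integral>q. exp (- \<tau> * (snd r - fst r)\<^sup>2 / t\<^sup>2) * (f (fst q) * f (snd q) * pd_kernel (1 / (2 * t\<^sup>2)) (fst q - snd q)) \<partial>plane)"
      unfolding cross_def gap_def offset_def f_def by (simp add: mult_ac)
    also have "\<dots> = exp (- \<tau> * (snd r - fst r)\<^sup>2 / t\<^sup>2) * pd_form (1 / (2 * t\<^sup>2)) f f"
      unfolding pd_form_def by simp
    also have "\<dots> \<ge> 0"
      by (intro mult_nonneg_nonneg pd_form_nonneg fi) (use t in auto)
    finally show "0 \<le> (\<integral>q. cross F F (q, r) * (exp (- \<tau> * (offset 0 1 (q, r))\<^sup>2 / t\<^sup>2) * pd_kernel (1 / (2 * t\<^sup>2)) (gap (q, r))) \<partial>plane)" .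
  qed
  finally show ?thesis .
qed

lemma set_integrable_pd_slice:
  assumes F: "test_fun F" and H: "test_fun H" and \<tau>: "0 < \<tau>" and e: "0 < \<epsilon>"
  shows "set_integrable lborel {\<epsilon>..T} (\<lambda>t. pd_slice F H \<tau> \<theta> \<sigma> t / t ^ 3)"
proof -
  define g where "g = (\<lambda>(p, t). exp (- (gap p)\<^sup>2 / (2 * t\<^sup>2)) * pd_kernel (\<tau> / t\<^sup>2) (offset \<theta> \<sigma> p) / t ^ 3)"
  have gm: "g \<in> borel_measurable (quad \<Otimes>\<^sub>M lborel)"
    unfolding g_def pd_kernel_def by measurable
  have bd: "\<bar>g (p, t)\<bar> \<le> 2 / \<epsilon> ^ 3" if "t \<in> {\<epsilon>..T}" for p t
  proof -
    have t: "0 < t" "\<epsilon> \<le> t" using that e by auto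
    have "\<bar>g (p, t)\<bar> = \<bar>exp (- ((gap p)\<^sup>2 / (2 * t\<^sup>2))) * pd_kernel (\<tau> / t\<^sup>2) (offset \<theta> \<sigma> p)\<bar> / t ^ 3"
      using t by (simp add: g_def abs_mult)
    also have "\<dots> \<le> 2 / \<epsilon> ^ 3"
      using t \<tau> e by (intro frac_le power_mono abs_gauss_pd_le) auto
    finally show ?thesis .
  qed
  have "(\<integral>p. cross F H p * g (p, t) \<partial>quad) = pd_slice F H \<tau> \<theta> \<sigma> t / t ^ 3" for t
    unfolding pd_slice_def g_def by simp
  with integrable_time_slices(2)[OF _ integrable_cross[OF F H] gm bd] show ?thesis
    by (simp add: sigma_finite_pair_measure sigma_finite_plane)
qed

lemma sigma_finite_quad: "sigma_finite_measure quad"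
  by (intro sigma_finite_pair_measure sigma_finite_plane)

text \<open>For a single function both terms of the product rule are nonnegative, so each is bounded by
  their sum, and the sum telescopes. The bound holds for every \<open>\<tau>\<close>, with the natural factor
  $\tau^{-1/2}$, although the two Gaussians live at different scales.\<close>
lemma pd_slice_energy_bound:
  assumes F: "test_fun F" and \<tau>: "0 < \<tau>" and eT: "0 < \<epsilon>" "\<epsilon> \<le> T"
  shows "(LINT t:{\<epsilon>..T}|lborel. pd_slice F F \<tau> 0 1 t / t ^ 3) \<le> sqrt (2 * pi) * sqrt (pi / \<tau>) * fourth_moment F"
proof -
  define tot where "tot t = (\<integral>p. cross F F p * heat_decay (quad_form \<tau> 0 1 p) t \<partial>quad)" for t
  note q0 = quad_form_nonneg[OF less_imp_le[OF \<tau>]]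
  note tel = integral_heat_decay[OF sigma_finite_quad integrable_cross[OF F F] measurable_quad_form(2) q0 eT, of 0 1, folded tot_def]
  have le: "pd_slice F F \<tau> 0 1 t / t ^ 3 \<le> 1 / 2 * tot t" if t: "0 < t" for t
  proof -
    have "tot t = (\<integral>p. 2 / t ^ 3 * (cross F F p * (exp (- (gap p)\<^sup>2 / (2 * t\<^sup>2)) * pd_kernel (\<tau> / t\<^sup>2) (offset 0 1 p)))
       + 2 / t ^ 3 * (cross F F p * (exp (- \<tau> * (offset 0 1 p)\<^sup>2 / t\<^sup>2) * pd_kernel (1 / (2 * t\<^sup>2)) (gap p))) \<partial>quad)"
      unfolding tot_def heat_decay_split[OF t]
      by (intro Bochner_Integration.integral_cong refl) (simp add: distrib_left mult_ac)
    also have "\<dots> = 2 / t ^ 3 * pd_slice F F \<tau> 0 1 t + 2 / t ^ 3 * (\<integral>p. cross F F p * (exp (- \<tau> * (offset 0 1 p)\<^sup>2 / t\<^sup>2) * pd_kernel (1 / (2 * t\<^sup>2)) (gap p)) \<partial>quad)"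
      unfolding pd_slice_def
      by (subst Bochner_Integration.integral_add[OF integrable_mult_right integrable_mult_right];
          (rule integrable_pd_slice[OF F F \<tau> t] | simp))
    finally show ?thesis
      using gap_slice_nonneg[OF F \<tau> t] t by (simp add: field_simps)
  qed
  have "(LINT t:{\<epsilon>..T}|lborel. pd_slice F F \<tau> 0 1 t / t ^ 3) \<le> (LINT t:{\<epsilon>..T}|lborel. 1 / 2 * tot t)"
    using le eT by (intro set_integral_mono set_integrable_pd_slice F \<tau> set_integrable_mult_right tel(2)) auto
  also have "\<dots> = 1 / 2 * (LINT t:{\<epsilon>..T}|lborel. tot t)" by simp
  also have "\<dots> \<le> 1 / 2 * (sqrt (2 * pi) * sqrt (pi / \<tau>) * ((fourth_moment F + fourth_moment F) / 2) + sqrt (2 * pi) * sqrt (pi / \<tau>) * ((fourth_moment F + fourth_moment F) / 2))"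
    unfolding tel(1)
    using abs_le_D1[OF cross_heat_bound[OF F F \<tau>, of \<epsilon> 1 0]] abs_le_D2[OF cross_heat_bound[OF F F \<tau>, of T 1 0]] eT
    by (intro mult_left_mono) linarith+
  also have "\<dots> = sqrt (2 * pi) * sqrt (pi / \<tau>) * fourth_moment F" by simp
  finally show ?thesis .
qed

section \<open>Averages against derivatives of Gaussians\<close>

text \<open>Up to a constant, the derivative of the Gaussian \<open>exp (- r\<^sup>2)\<close>.\<close>
definition hermite :: "real \<Rightarrow> real" where
  "hermite r = r * exp (- r\<^sup>2)"

lemma measurable_hermite [measurable]: "hermite \<in> borel_measurable borel"
  unfolding hermite_def by measurable

lemma abs_hermite_le: "\<bar>hermite r\<bar> \<le> 1"
proof -
  have "\<bar>r\<bar> \<le> r\<^sup>2 + 1"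
    using sum_squares_bound[of "\<bar>r\<bar>" 1] zero_le_power2[of r] by (simp add: power2_abs)
  also have "\<dots> \<le> exp (r\<^sup>2)" using exp_ge_add_one_self[of "r\<^sup>2"] by linarith
  finally show ?thesis by (simp add: hermite_def abs_mult exp_minus divide_simps)
qed

text \<open>The algebraic core of the proof. Averaged over the shift \<open>a\<close> with a Gaussian weight, the product of
  two derivatives of Gaussians is the scale derivative of a Gaussian in \<open>A - A'\<close> and \<open>A + A'\<close>, minus a term
  that carries second-order cancellation in \<open>A + A'\<close>. On the Fourier side this is
  $-2\alpha\beta = \alpha^2 + \beta^2 - (\alpha+\beta)^2$; the average over \<open>a\<close> makes the kernel even in
  \<open>A + A'\<close>, which is why no term of first order appears.\<close>
lemma hermite_correlation:
  fixes A A' \<mu> t :: real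
  assumes \<mu>: "0 < \<mu>" and t: "0 < t"
  defines "\<tau> \<equiv> 2 * \<mu> / (\<mu> + 2)"
  defines "Q \<equiv> (A - A')\<^sup>2 / 2 + \<tau> * ((A + A') / 2)\<^sup>2"
  shows "has_bochner_integral lborel
     (\<lambda>a. exp (- \<mu> * a\<^sup>2 / t\<^sup>2) * (hermite ((A - a) / t) * hermite ((A' - a) / t)))
     (t * sqrt (pi / (\<mu> + 2)) / 4 * ((2 - 2 * Q / t\<^sup>2) * exp (- Q / t\<^sup>2)
        - (\<tau> + 2) * (exp (- (A - A')\<^sup>2 / (2 * t\<^sup>2)) * pd_kernel (\<tau> / t\<^sup>2) ((A + A') / 2))))"
proof -
  define s where "s = \<mu> + 2"
  have s: "0 < s" "\<mu> = s - 2" using \<mu> by (auto simp: s_def)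
  \<comment> \<open>The centre of the product of the three Gaussians in \<open>a\<close>.\<close>
  define m where "m = (A + A') / s"
  have \<tau>: "\<tau> = 2 - 4 / s" using s unfolding \<tau>_def s(2) by (simp add: field_simps)
  define c where "c = s / t\<^sup>2"
  have c: "0 < c" using s t by (simp add: c_def)
  have ex: "\<mu> * a\<^sup>2 + (A - a)\<^sup>2 + (A' - a)\<^sup>2 = s * (a - m)\<^sup>2 + Q" for a
  proof -
    have sm: "s * m = A + A'" using s by (simp add: m_def)
    have "s * (a - m)\<^sup>2 = s * a\<^sup>2 - 2 * (s * m) * a + s * m * m"
      by (simp add: power2_eq_square algebra_simps)
    also have "\<dots> = s * a\<^sup>2 - 2 * (A + A') * a + (A + A') * m" by (simp add: sm)
    finally have "s * (a - m)\<^sup>2 + Q = s * a\<^sup>2 - 2 * (A + A') * a + (A + A')\<^sup>2 / s + Q"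
      by (simp add: m_def power2_eq_square)
    moreover have "(A + A')\<^sup>2 / s + Q = A\<^sup>2 + A'\<^sup>2"
      unfolding Q_def \<tau> using s by (simp add: field_simps power2_eq_square)
    ultimately show ?thesis
      unfolding s(2) by (simp add: power2_eq_square algebra_simps)
  qed
  have poly: "(A - a) * (A' - a) = (A - m) * (A' - m) + (- (A + A' - 2 * m)) * (a - m) + 1 * (a - m)\<^sup>2" for a
    by (simp add: power2_eq_square algebra_simps)
  have "has_bochner_integral lborel
    (\<lambda>a. exp (- Q / t\<^sup>2) / t\<^sup>2 * (((A - m) * (A' - m) + (- (A + A' - 2 * m)) * (a - m) + 1 * (a - m)\<^sup>2) * exp (- c * (a - m)\<^sup>2)))
    (exp (- Q / t\<^sup>2) / t\<^sup>2 * (sqrt (pi / c) * ((A - m) * (A' - m) + 1 / (2 * c))))"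
    by (intro has_bochner_integral_mult_right has_bochner_integral_quadratic_gaussian c)
  moreover have "exp (- Q / t\<^sup>2) / t\<^sup>2 * (((A - m) * (A' - m) + (- (A + A' - 2 * m)) * (a - m) + 1 * (a - m)\<^sup>2) * exp (- c * (a - m)\<^sup>2))
     = exp (- \<mu> * a\<^sup>2 / t\<^sup>2) * (hermite ((A - a) / t) * hermite ((A' - a) / t))" for a
  proof -
    have "exp (- Q / t\<^sup>2) * exp (- c * (a - m)\<^sup>2) = exp (- \<mu> * a\<^sup>2 / t\<^sup>2) * (exp (- ((A - a) / t)\<^sup>2) * exp (- ((A' - a) / t)\<^sup>2))"
    proof -
      have "- Q / t\<^sup>2 + - c * (a - m)\<^sup>2 = - (s * (a - m)\<^sup>2 + Q) / t\<^sup>2"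
        by (simp add: c_def add_divide_distrib diff_divide_distrib)
      also have "\<dots> = - (\<mu> * a\<^sup>2 + (A - a)\<^sup>2 + (A' - a)\<^sup>2) / t\<^sup>2"
        by (simp only: ex)
      also have "\<dots> = - \<mu> * a\<^sup>2 / t\<^sup>2 + (- ((A - a) / t)\<^sup>2 + - ((A' - a) / t)\<^sup>2)"
      proof -
        have "- (u + v + w) / r = - u / r + (- (v / r) + - (w / r))" for u v w r :: real
          by (simp add: add_divide_distrib diff_divide_distrib)
        then show ?thesis by (simp only: power_divide mult_minus_left)
      qed
      finally show ?thesis by (simp only: exp_add[symmetric])
    qed
    moreover have "hermite ((A - a) / t) * hermite ((A' - a) / t)
      = (A - a) * (A' - a) / t\<^sup>2 * (exp (- ((A - a) / t)\<^sup>2) * exp (- ((A' - a) / t)\<^sup>2))"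
      by (simp add: hermite_def power2_eq_square)
    moreover have "E / r * (P * G) = L * h" if "E * G = L * N" "h = P / r * N" for E G P r L N h :: real
    proof -
      have "E / r * (P * G) = P / r * (E * G)" by simp
      then show ?thesis unfolding that by simp
    qed
    ultimately show ?thesis
      unfolding poly[of a, symmetric] by blast
  qed
  moreover have "exp (- Q / t\<^sup>2) / t\<^sup>2 * (sqrt (pi / c) * ((A - m) * (A' - m) + 1 / (2 * c)))
    = t * sqrt (pi / (\<mu> + 2)) / 4 * ((2 - 2 * Q / t\<^sup>2) * exp (- Q / t\<^sup>2)
        - (\<tau> + 2) * (exp (- (A - A')\<^sup>2 / (2 * t\<^sup>2)) * pd_kernel (\<tau> / t\<^sup>2) ((A + A') / 2)))"
  proof -
    have sq: "sqrt (pi / c) = t * sqrt (pi / (\<mu> + 2))"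
      using t unfolding c_def s_def by (simp add: real_sqrt_mult real_sqrt_divide)
    have e: "exp (- (A - A')\<^sup>2 / (2 * t\<^sup>2)) * pd_kernel (\<tau> / t\<^sup>2) ((A + A') / 2)
      = (1 / 2 - \<tau> * ((A + A') / 2)\<^sup>2 / t\<^sup>2) * exp (- Q / t\<^sup>2)"
    proof -
      have "exp (- Q / t\<^sup>2) = exp (- (A - A')\<^sup>2 / (2 * t\<^sup>2)) * exp (- (\<tau> / t\<^sup>2) * ((A + A') / 2)\<^sup>2)"
        unfolding exp_add[symmetric] Q_def by (simp add: add_divide_distrib diff_divide_distrib)
      then show ?thesis by (simp add: pd_kernel_def)
    qed
    have main: "((A - m) * (A' - m) + 1 / (2 * c)) / t\<^sup>2 =
      1 / 4 * ((2 - 2 * Q / t\<^sup>2) - (\<tau> + 2) * (1 / 2 - \<tau> * ((A + A') / 2)\<^sup>2 / t\<^sup>2))"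
    proof -
      define E where "E = (A + A') / 2"
      define D where "D = A - A'"
      have mE: "m = E * (1 - \<tau> / 2)" unfolding m_def E_def \<tau> using s by (simp add: field_simps)
      have AD: "A = E + D / 2" "A' = E - D / 2" by (auto simp: E_def D_def field_simps)
      have c': "1 / (2 * c) = t\<^sup>2 * (1 / 4 - \<tau> / 8)" unfolding c_def \<tau> using s t by (simp add: field_simps)
      have am: "(A - m) * (A' - m) = (\<tau> * E / 2)\<^sup>2 - D\<^sup>2 / 4"
        unfolding mE AD by (simp add: power2_eq_square field_simps)
      have QQ: "Q = D\<^sup>2 / 2 + \<tau> * E\<^sup>2" by (simp add: Q_def E_def D_def)
      show ?thesis
      proof -
        have "r \<noteq> 0 \<Longrightarrow> ((\<tau> * E / 2)\<^sup>2 - D\<^sup>2 / 4 + r * (1 / 4 - \<tau> / 8)) / r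
          = 1 / 4 * (2 - 2 * (D\<^sup>2 / 2 + \<tau> * E\<^sup>2) / r - (\<tau> + 2) * (1 / 2 - \<tau> * E\<^sup>2 / r))" for r
          by (simp add: field_simps power_mult_distrib power2_eq_square)
        then show ?thesis unfolding am c' QQ E_def[symmetric] using t by simp
      qed
    qed
    have "exp (- Q / t\<^sup>2) / t\<^sup>2 * (sqrt (pi / c) * ((A - m) * (A' - m) + 1 / (2 * c)))
      = t * sqrt (pi / (\<mu> + 2)) * exp (- Q / t\<^sup>2) * (((A - m) * (A' - m) + 1 / (2 * c)) / t\<^sup>2)"
      unfolding sq by simp
    also have "\<dots> = t * sqrt (pi / (\<mu> + 2)) / 4 * ((2 - 2 * Q / t\<^sup>2) * exp (- Q / t\<^sup>2)
        - (\<tau> + 2) * ((1 / 2 - \<tau> * ((A + A') / 2)\<^sup>2 / t\<^sup>2) * exp (- Q / t\<^sup>2)))"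
    proof -
      have "T * S * E * (1 / 4 * (X - K * Y)) = T * S / 4 * (X * E - K * (Y * E))" for T S E X K Y :: real
        by (simp add: field_simps)
      then show ?thesis unfolding main by (simp only:)
    qed
    finally show ?thesis unfolding e .
  qed
  ultimately show ?thesis by (simp only:)
qed

text \<open>For \<open>F\<close> and \<open>H\<close> obtained from \<open>F\<^sub>0\<close> and \<open>G\<^sub>0\<close> by the shears below, and \<open>z = x + y + s\<close>, \<open>q = (y, x)\<close>, this
  integrates $F_0(x+s,y)\,G_0(x,y+s)$ in \<open>s\<close> against the derivative of a Gaussian of width \<open>t\<close> centred at \<open>a\<close>.\<close>
definition transform :: "(real \<times> real \<Rightarrow> real) \<Rightarrow> (real \<times> real \<Rightarrow> real) \<Rightarrow> real \<Rightarrow> real \<Rightarrow> real \<times> real \<Rightarrow> real" where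
  "transform F H t a q = (\<integral>z. F (z, fst q) * H (z, snd q) * hermite ((z - fst q - snd q - a) / t) \<partial>lborel)"

lemma integrable_gaussian_weight: "0 < c \<Longrightarrow> integrable lborel (\<lambda>a :: real. exp (- c * a\<^sup>2))" for c :: real
  using has_bochner_integral_quadratic_gaussian[of c 1 0 0 0] by (simp add: has_bochner_integral_iff)

text \<open>Square the integral, interchange the integrations and apply \<open>hermite_correlation\<close> with
  \<open>A = z - y - y'\<close> and \<open>A' = z' - y - y'\<close>.\<close>
lemma transform_energy_slice:
  assumes F: "test_fun F" and H: "test_fun H" and \<mu>: "0 < \<mu>" and t: "0 < t"
  defines "\<tau> \<equiv> 2 * \<mu> / (\<mu> + 2)"
  shows "(\<integral>\<^sup>+a. (\<integral>\<^sup>+q. ennreal (exp (- \<mu> * a\<^sup>2 / t\<^sup>2) * (transform F H t a q)\<^sup>2) \<partial>plane) \<partial>lborel)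
     = ennreal (t ^ 4 * (sqrt (pi / (\<mu> + 2)) / 4 * ((\<integral>p. cross F H p * heat_decay (quad_form \<tau> (1 / 2) (- 1) p) t \<partial>quad)
          - (\<tau> + 2) * (pd_slice F H \<tau> (1 / 2) (- 1) t / t ^ 3))))" (is "_ = ennreal ?R")
    and "0 \<le> (sqrt (pi / (\<mu> + 2)) / 4 * ((\<integral>p. cross F H p * heat_decay (quad_form \<tau> (1 / 2) (- 1) p) t \<partial>quad)
          - (\<tau> + 2) * (pd_slice F H \<tau> (1 / 2) (- 1) t / t ^ 3)))" (is "0 \<le> ?R'")
proof -
  note [measurable] = F[THEN test_fun_measurable] H[THEN test_fun_measurable]
  have \<tau>: "0 < \<tau>" using \<mu> by (simp add: \<tau>_def)
  define A where "A p = fst (fst p) - fst (snd p) - snd (snd p)" for p :: "(real \<times> real) \<times> (real \<times> real)"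
  define A' where "A' p = snd (fst p) - fst (snd p) - snd (snd p)" for p :: "(real \<times> real) \<times> (real \<times> real)"
  have [measurable]: "A \<in> borel_measurable quad" "A' \<in> borel_measurable quad" unfolding A_def A'_def by measurable
  define k where "k p a = hermite ((A p - a) / t) * hermite ((A' p - a) / t)" for p a
  define e where "e a = exp (- \<mu> * a\<^sup>2 / t\<^sup>2)" for a
  have [measurable]: "e \<in> borel_measurable borel" unfolding e_def by measurable
  have [measurable]: "(\<lambda>(p, a). k p a) \<in> borel_measurable (quad \<Otimes>\<^sub>M borel)" unfolding k_def by measurable
  have k1: "\<bar>k p a\<bar> \<le> 1" for p a
  proof -
    have "\<bar>k p a\<bar> \<le> 1 * 1" unfolding k_def abs_mult by (intro mult_mono abs_hermite_le) auto
    then show ?thesis by simp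
  qed
  define W where "W p a = cross F H p * (e a * k p a)" for p a
  have ei: "integrable lborel e"
    using integrable_gaussian_weight[of "\<mu> / t\<^sup>2"] \<mu> t by (simp add: e_def[abs_def])
  have Wi: "integrable (quad \<Otimes>\<^sub>M lborel) (\<lambda>(p, a). W p a)"
  proof -
    have "integrable (quad \<Otimes>\<^sub>M lborel) (\<lambda>x. (cross F H (fst x) * e (snd x)) * k (fst x) (snd x))"
      by (rule integrable_mult_bounded[OF integrable_mult_product[OF sigma_finite_quad lborel.sigma_finite_measure_axioms
            integrable_cross[OF F H] ei] _ k1])
         (simp add: k_def, measurable)
    then show ?thesis by (simp add: W_def case_prod_beta' mult_ac)
  qed
  interpret Q: sigma_finite_measure quad by (rule sigma_finite_quad)
  interpret QA: pair_sigma_finite quad lborel by unfold_locales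
  have quads: "quad_form \<tau> (1 / 2) (- 1) p = (A p - A' p)\<^sup>2 / 2 + \<tau> * ((A p + A' p) / 2)\<^sup>2"
    and off: "offset (1 / 2) (- 1) p = (A p + A' p) / 2" and gap: "gap p = A p - A' p" for p
    unfolding quad_form_def offset_def gap_def A_def A'_def by (auto simp: field_simps)
  have inner_a: "(\<integral>a. W p a \<partial>lborel) = t ^ 4 * (sqrt (pi / (\<mu> + 2)) / 4) * (cross F H p * heat_decay (quad_form \<tau> (1 / 2) (- 1) p) t)
      - t * (sqrt (pi / (\<mu> + 2)) / 4) * (\<tau> + 2) * (cross F H p * (exp (- (gap p)\<^sup>2 / (2 * t\<^sup>2)) * pd_kernel (\<tau> / t\<^sup>2) (offset (1 / 2) (- 1) p)))" for p
  proof -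
    have "(\<integral>a. W p a \<partial>lborel) = cross F H p * (\<integral>a. e a * k p a \<partial>lborel)"
      unfolding W_def by simp
    also have "(\<integral>a. e a * k p a \<partial>lborel) = t * sqrt (pi / (\<mu> + 2)) / 4 * ((2 - 2 * quad_form \<tau> (1 / 2) (- 1) p / t\<^sup>2) * exp (- quad_form \<tau> (1 / 2) (- 1) p / t\<^sup>2)
        - (\<tau> + 2) * (exp (- (gap p)\<^sup>2 / (2 * t\<^sup>2)) * pd_kernel (\<tau> / t\<^sup>2) (offset (1 / 2) (- 1) p)))"
      using has_bochner_integral_integral_eq[OF hermite_correlation[OF \<mu> t, of "A p" "A' p"]]
      unfolding e_def k_def quads off gap \<tau>_def[symmetric] .
    also have "(2 - 2 * quad_form \<tau> (1 / 2) (- 1) p / t\<^sup>2) * exp (- quad_form \<tau> (1 / 2) (- 1) p / t\<^sup>2) = t ^ 3 * heat_decay (quad_form \<tau> (1 / 2) (- 1) p) t"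
      using t by (simp add: heat_decay_def)
    finally show ?thesis
      by (simp add: right_diff_distrib power4_eq_xxxx power3_eq_cube mult_ac)
  qed
  have hd: "integrable quad (\<lambda>p. cross F H p * heat_decay (quad_form \<tau> (1 / 2) (- 1) p) t)"
  proof (rule integrable_mult_bounded[OF integrable_cross[OF F H]])
    show "(\<lambda>p. heat_decay (quad_form \<tau> (1 / 2) (- 1) p) t) \<in> borel_measurable quad"
      unfolding heat_decay_def by measurable
    show "\<bar>heat_decay (quad_form \<tau> (1 / 2) (- 1) p) t\<bar> \<le> 4 / t ^ 3" for p
      using \<tau> t by (intro abs_heat_decay_le quad_form_nonneg) auto
  qed
  have total: "(\<integral>p. (\<integral>a. W p a \<partial>lborel) \<partial>quad) = ?R"
  proof -
    have "(\<integral>p. (\<integral>a. W p a \<partial>lborel) \<partial>quad) =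
       t ^ 4 * (sqrt (pi / (\<mu> + 2)) / 4) * (\<integral>p. cross F H p * heat_decay (quad_form \<tau> (1 / 2) (- 1) p) t \<partial>quad)
       - t * (sqrt (pi / (\<mu> + 2)) / 4) * (\<tau> + 2) * pd_slice F H \<tau> (1 / 2) (- 1) t"
      unfolding inner_a pd_slice_def
      by (subst Bochner_Integration.integral_diff[OF integrable_mult_right[OF hd] integrable_mult_right[OF integrable_pd_slice(1)[OF F H \<tau> t]]]) simp
    also have "\<dots> = ?R" using t by (simp add: right_diff_distrib power4_eq_xxxx power3_eq_cube)
    finally show ?thesis .
  qed
  have slice_a: "integrable quad (\<lambda>p. W p a)" for a
  proof -
    have "integrable quad (\<lambda>p. cross F H p * (e a * k p a))"
    proof (rule integrable_mult_bounded[OF integrable_cross[OF F H]])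
      show "\<bar>e a * k p a\<bar> \<le> e a * 1" for p
        unfolding abs_mult using k1[of p a] by (intro mult_mono) (auto simp: e_def)
    qed (simp add: k_def, measurable)
    then show ?thesis by (simp add: W_def)
  qed
  have inner_q: "(\<integral>zz. W (zz, q) a \<partial>plane) = e a * (transform F H t a q)\<^sup>2" for a q
  proof -
    define u where "u z = F (z, fst q) * H (z, snd q) * hermite ((z - fst q - snd q - a) / t)" for z
    have ui: "integrable lborel u"
      unfolding u_def by (rule integrable_mult_bounded[OF test_fun_integrable_column[OF F H] _ abs_hermite_le]) measurable
    have "(\<integral>zz. W (zz, q) a \<partial>plane) = (\<integral>zz. e a * (u (fst zz) * u (snd zz)) \<partial>plane)"
      unfolding W_def cross_def k_def A_def A'_def u_def by (simp add: mult_ac)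
    also have "\<dots> = e a * (\<integral>zz. u (fst zz) * u (snd zz) \<partial>plane)" by simp
    also have "(\<integral>zz. u (fst zz) * u (snd zz) \<partial>plane) = (\<integral>z. (\<integral>z'. u z * u z' \<partial>lborel) \<partial>lborel)"
      using lborel_pair.integral_fst'[OF integrable_mult_pair[OF ui ui]] by simp
    also have "\<dots> = (transform F H t a q)\<^sup>2"
      by (simp add: transform_def u_def power2_eq_square)
    finally show ?thesis .
  qed
  have e0: "0 \<le> e a" for a by (simp add: e_def)
  have slice_q: "(\<integral>\<^sup>+q. ennreal (e a * (transform F H t a q)\<^sup>2) \<partial>plane) = ennreal (\<integral>p. W p a \<partial>quad)"
    and slice_nonneg: "0 \<le> (\<integral>p. W p a \<partial>quad)" for a
  proof -
    have i: "integrable quad (case_prod (\<lambda>zz q. W (zz, q) a))" using slice_a[of a] by (simp add: case_prod_beta')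
    have eq: "(\<integral>p. W p a \<partial>quad) = (\<integral>q. e a * (transform F H t a q)\<^sup>2 \<partial>plane)"
      using quad.integral_snd[OF i] by (simp add: inner_q case_prod_beta')
    show "0 \<le> (\<integral>p. W p a \<partial>quad)" unfolding eq using e0 by (intro Bochner_Integration.integral_nonneg) simp
    show "(\<integral>\<^sup>+q. ennreal (e a * (transform F H t a q)\<^sup>2) \<partial>plane) = ennreal (\<integral>p. W p a \<partial>quad)"
      unfolding eq using quad.integrable_snd[OF i] e0 by (intro nn_integral_eq_integral) (auto simp: inner_q)
  qed
  have "(\<integral>\<^sup>+a. (\<integral>\<^sup>+q. ennreal (e a * (transform F H t a q)\<^sup>2) \<partial>plane) \<partial>lborel) = ennreal (\<integral>a. (\<integral>p. W p a \<partial>quad) \<partial>lborel)"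
    unfolding slice_q using QA.integrable_snd[OF Wi]
    by (intro nn_integral_eq_integral AE_I2 slice_nonneg) simp
  also have "(\<integral>a. (\<integral>p. W p a \<partial>quad) \<partial>lborel) = ?R"
    unfolding total[symmetric] by (rule QA.Fubini_integral[OF Wi])
  finally show "(\<integral>\<^sup>+a. (\<integral>\<^sup>+q. ennreal (exp (- \<mu> * a\<^sup>2 / t\<^sup>2) * (transform F H t a q)\<^sup>2) \<partial>plane) \<partial>lborel) = ennreal ?R"
    unfolding e_def .
  have "0 \<le> (\<integral>a. (\<integral>p. W p a \<partial>quad) \<partial>lborel)" by (rule Bochner_Integration.integral_nonneg) (rule slice_nonneg)
  also have "\<dots> = t ^ 4 * ?R'"
    unfolding total[symmetric] by (rule QA.Fubini_integral[OF Wi])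
  finally show "0 \<le> ?R'" using t by (simp add: zero_le_mult_iff)
qed

text \<open>The first term of the correlation identity telescopes; the second is bounded by the
  symmetric forms of \<open>F\<close> and of \<open>H\<close>, which telescope as well.\<close>
lemma transform_energy_truncated:
  assumes F: "test_fun F" and H: "test_fun H" and \<mu>: "0 < \<mu>" and eT: "0 < \<epsilon>" "\<epsilon> \<le> T"
  shows "(\<integral>\<^sup>+t. (\<integral>\<^sup>+a. (\<integral>\<^sup>+q. ennreal (exp (- \<mu> * a\<^sup>2 / t\<^sup>2) * (transform F H t a q)\<^sup>2) \<partial>plane) \<partial>lborel)
            * ennreal (1 / t ^ 4) * indicator {\<epsilon>..T} t \<partial>lborel)
     \<le> ennreal (3 / 4 * pi * sqrt (pi / \<mu>) * (fourth_moment F + fourth_moment H))"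
proof -
  \<comment> \<open>The parameter of the convolution of \<open>exp (- \<mu> r\<^sup>2)\<close> and \<open>exp (- 2 r\<^sup>2)\<close>; the bound \<open>\<tau> \<le> 2\<close> makes the factor \<open>\<tau> + 2\<close> harmless.\<close>
  define \<tau> where "\<tau> = 2 * \<mu> / (\<mu> + 2)"
  have \<tau>: "0 < \<tau>" "\<tau> \<le> 2" using \<mu> by (auto simp: \<tau>_def field_simps)
  define c where "c = sqrt (pi / (\<mu> + 2)) / 4"
  have c0: "0 \<le> c" using \<mu> by (simp add: c_def)
  define C where "C = sqrt (2 * pi) * sqrt (pi / \<tau>)"
  have C0: "0 \<le> C" using \<tau> by (simp add: C_def)
  define P where "P t = (\<integral>p. cross F H p * heat_decay (quad_form \<tau> (1 / 2) (- 1) p) t \<partial>quad)" for t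
  define R where "R t = pd_slice F H \<tau> (1 / 2) (- 1) t / t ^ 3" for t
  define J where "J t = c * (P t - (\<tau> + 2) * R t)" for t
  note slice = transform_energy_slice[OF F H \<mu>, folded \<tau>_def, folded c_def P_def R_def, folded J_def]
  note q0 = quad_form_nonneg[OF less_imp_le[OF \<tau>(1)]]
  note tel = integral_heat_decay[OF sigma_finite_quad integrable_cross[OF F H] measurable_quad_form(2) q0 eT, of "1 / 2" "- 1", folded P_def]
  have Ri: "set_integrable lborel {\<epsilon>..T} R"
    unfolding R_def by (rule set_integrable_pd_slice[OF F H \<tau>(1) eT(1)])
  have Ji: "set_integrable lborel {\<epsilon>..T} J"
    unfolding J_def by (intro set_integrable_mult_right set_integral_diff(1) tel(2) Ri)
  have "(\<integral>\<^sup>+t. (\<integral>\<^sup>+a. (\<integral>\<^sup>+q. ennreal (exp (- \<mu> * a\<^sup>2 / t\<^sup>2) * (transform F H t a q)\<^sup>2) \<partial>plane) \<partial>lborel)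
            * ennreal (1 / t ^ 4) * indicator {\<epsilon>..T} t \<partial>lborel)
     = (\<integral>\<^sup>+t. ennreal (indicator {\<epsilon>..T} t *\<^sub>R J t) \<partial>lborel)"
  proof (rule nn_integral_cong)
    fix t
    show "(\<integral>\<^sup>+a. (\<integral>\<^sup>+q. ennreal (exp (- \<mu> * a\<^sup>2 / t\<^sup>2) * (transform F H t a q)\<^sup>2) \<partial>plane) \<partial>lborel)
            * ennreal (1 / t ^ 4) * indicator {\<epsilon>..T} t = ennreal (indicator {\<epsilon>..T} t *\<^sub>R J t)"
    proof (cases "t \<in> {\<epsilon>..T}")
      case True
      then have t: "0 < t" using eT by auto
      have "ennreal (t ^ 4 * J t) * ennreal (1 / t ^ 4) = ennreal (J t)"
        using t slice(2)[OF t] by (subst ennreal_mult[symmetric]) auto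
      then show ?thesis using True unfolding slice(1)[OF t] by simp
    qed simp
  qed
  also have "\<dots> = ennreal (LINT t:{\<epsilon>..T}|lborel. J t)"
    unfolding set_lebesgue_integral_def
  proof (rule nn_integral_eq_integral)
    show "integrable lborel (\<lambda>t. indicator {\<epsilon>..T} t *\<^sub>R J t)" using Ji unfolding set_integrable_def .
    show "AE t in lborel. 0 \<le> indicator {\<epsilon>..T} t *\<^sub>R J t"
      using slice(2) eT by (auto simp: indicator_def)
  qed
  also have "\<dots> \<le> ennreal (3 / 4 * pi * sqrt (pi / \<mu>) * (fourth_moment F + fourth_moment H))"
  proof (rule ennreal_leI)
    have "(LINT t:{\<epsilon>..T}|lborel. J t) = c * ((LINT t:{\<epsilon>..T}|lborel. P t) - (\<tau> + 2) * (LINT t:{\<epsilon>..T}|lborel. R t))"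
      unfolding J_def using set_integral_diff(2)[OF tel(2) set_integrable_mult_right[OF Ri, of "\<tau> + 2"]] by simp
    also have "\<dots> \<le> c * (C * (fourth_moment F + fourth_moment H) + 4 * (C * (fourth_moment F + fourth_moment H) / 2))"
    proof (intro mult_left_mono c0)
      have PT: "(LINT t:{\<epsilon>..T}|lborel. P t) \<le> C * (fourth_moment F + fourth_moment H)"
      proof -
        have T0: "0 < T" using eT by simp
        have half: "C * ((fourth_moment F + fourth_moment H) / 2) + C * ((fourth_moment F + fourth_moment H) / 2) = C * (fourth_moment F + fourth_moment H)"
          by (simp add: field_simps)
        show ?thesis
          unfolding tel(1)
          using abs_le_D1[OF cross_heat_bound[OF F H \<tau>(1) eT(1), of "- 1" "1 / 2"]]
            abs_le_D2[OF cross_heat_bound[OF F H \<tau>(1) T0, of "- 1" "1 / 2"]] half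
          unfolding C_def[symmetric] by simp
      qed
      have "- (LINT t:{\<epsilon>..T}|lborel. R t) \<le> (LINT t:{\<epsilon>..T}|lborel. 1 / 2 * (pd_slice F F \<tau> 0 1 t / t ^ 3) + 1 / 2 * (pd_slice H H \<tau> 0 1 t / t ^ 3))"
        unfolding set_integral_uminus[OF Ri, symmetric]
      proof (rule set_integral_mono)
        show "set_integrable lborel {\<epsilon>..T} (\<lambda>t. - R t)" using set_integrable_mult_right[of "- 1", OF Ri] by simp
        show "set_integrable lborel {\<epsilon>..T} (\<lambda>t. 1 / 2 * (pd_slice F F \<tau> 0 1 t / t ^ 3) + 1 / 2 * (pd_slice H H \<tau> 0 1 t / t ^ 3))"
          by (intro set_integral_add(1) set_integrable_mult_right set_integrable_pd_slice F H \<tau> eT)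
        fix t assume "t \<in> {\<epsilon>..T}"
        then have t: "0 < t" using eT by auto
        have "- 2 * pd_slice F H \<tau> (1 / 2) (- 1) t \<le> pd_slice F F \<tau> 0 1 t + pd_slice H H \<tau> 0 1 t"
          using pd_slice_Cauchy_Schwarz(1)[OF F H \<tau>(1) t, of "- 1" "1 / 2"] by simp
        then show "- R t \<le> 1 / 2 * (pd_slice F F \<tau> 0 1 t / t ^ 3) + 1 / 2 * (pd_slice H H \<tau> 0 1 t / t ^ 3)"
          unfolding R_def using t by (simp add: field_simps)
      qed
      also have "\<dots> = 1 / 2 * (LINT t:{\<epsilon>..T}|lborel. pd_slice F F \<tau> 0 1 t / t ^ 3) + 1 / 2 * (LINT t:{\<epsilon>..T}|lborel. pd_slice H H \<tau> 0 1 t / t ^ 3)"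
        by (simp only: set_integral_add(2)[OF set_integrable_mult_right[OF set_integrable_pd_slice[OF F F \<tau>(1) eT(1)]]
              set_integrable_mult_right[OF set_integrable_pd_slice[OF H H \<tau>(1) eT(1)]]] set_integral_mult_right)
      also have "\<dots> \<le> C * (fourth_moment F + fourth_moment H) / 2"
        using pd_slice_energy_bound[OF F \<tau>(1) eT] pd_slice_energy_bound[OF H \<tau>(1) eT]
        by (simp add: C_def[symmetric] distrib_left)
      finally have RT: "- (LINT t:{\<epsilon>..T}|lborel. R t) \<le> C * (fourth_moment F + fourth_moment H) / 2" .
      have X0: "0 \<le> C * (fourth_moment F + fourth_moment H) / 2" using C0 fourth_moment_nonneg[of F] fourth_moment_nonneg[of H] by simp
      have "(\<tau> + 2) * (- (LINT t:{\<epsilon>..T}|lborel. R t)) \<le> (\<tau> + 2) * (C * (fourth_moment F + fourth_moment H) / 2)"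
        using \<tau> by (intro mult_left_mono RT) auto
      also have "\<dots> \<le> 4 * (C * (fourth_moment F + fourth_moment H) / 2)"
        using \<tau> X0 by (intro mult_right_mono) auto
      finally show "(LINT t:{\<epsilon>..T}|lborel. P t) - (\<tau> + 2) * (LINT t:{\<epsilon>..T}|lborel. R t)
         \<le> C * (fourth_moment F + fourth_moment H) + 4 * (C * (fourth_moment F + fourth_moment H) / 2)"
        using PT by simp
    qed
    also have "\<dots> = 3 * (c * C) * (fourth_moment F + fourth_moment H)" by (simp add: field_simps)
    also have "c * C = 1 / 4 * pi * sqrt (pi / \<mu>)"
    proof -
      have "4 * c * C = sqrt (pi / (\<mu> + 2) * (2 * pi * (pi / \<tau>)))"
        unfolding c_def C_def by (simp add: real_sqrt_mult[symmetric] mult.assoc)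
      also have "pi / (\<mu> + 2) * (2 * pi * (pi / \<tau>)) = pi\<^sup>2 * (pi / \<mu>)"
      proof -
        have "(\<mu> + 2) * \<tau> = 2 * \<mu>" unfolding \<tau>_def using \<mu> by (simp add: field_simps)
        moreover have "pi / (\<mu> + 2) * (2 * pi * (pi / \<tau>)) = 2 * pi ^ 3 / ((\<mu> + 2) * \<tau>)"
          by (simp add: power3_eq_cube)
        ultimately show ?thesis using \<mu> by (simp add: power2_eq_square power3_eq_cube)
      qed
      also have "sqrt \<dots> = pi * sqrt (pi / \<mu>)" by (subst real_sqrt_mult) simp
      finally show ?thesis by simp
    qed
    finally show "(LINT t:{\<epsilon>..T}|lborel. J t) \<le> 3 / 4 * pi * sqrt (pi / \<mu>) * (fourth_moment F + fourth_moment H)" by simp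
  qed
  finally show ?thesis .
qed

section \<open>Arbitrary mean-zero profiles\<close>

text \<open>A weight for which the integral in \<open>nn_integral_scaled_decay\<close> is elementary.\<close>
definition decay :: "real \<Rightarrow> real" where
  "decay x = 1 / (1 + x\<^sup>2)\<^sup>2"

lemma measurable_decay [measurable]: "decay \<in> borel_measurable borel"
  unfolding decay_def by measurable

lemma decay_pos: "0 < decay x"
  unfolding decay_def by (intro divide_pos_pos zero_less_power add_pos_nonneg) auto

lemma decay_le: "decay x \<le> 1 / (1 + x\<^sup>2)" "decay x \<le> 1"
proof -
  have "1 \<le> 1 + x\<^sup>2" by simp
  then have "1 * (1 + x\<^sup>2) \<le> (1 + x\<^sup>2) * (1 + x\<^sup>2)" by (intro mult_right_mono) auto
  then show a: "decay x \<le> 1 / (1 + x\<^sup>2)"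
    unfolding decay_def power2_eq_square[of "1 + x\<^sup>2"] by (intro divide_left_mono) (auto simp: add_pos_nonneg)
  also have "\<dots> \<le> 1" by (simp add: divide_simps add_pos_nonneg)
  finally show "decay x \<le> 1" .
qed

lemma integrable_decay: "integrable lborel decay"
proof (rule Bochner_Integration.integrable_bound)
  show "integrable lborel (\<lambda>x :: real. inverse (1 + x\<^sup>2))"
    using integrable_inverse_1_plus_square by (simp add: set_integrable_def)
  show "AE x in lborel. norm (decay x) \<le> norm (inverse (1 + x\<^sup>2))"
    using decay_le(1) decay_pos by (auto intro!: AE_I2 simp: inverse_eq_divide less_imp_le abs_of_pos add_pos_nonneg)
qed measurable

lemma integrable_hermite: "integrable lborel hermite"
proof -
  have i: "integrable lborel (\<lambda>r :: real. 2 * exp (- (1 / 2) * r\<^sup>2))"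
    by (intro integrable_mult_right integrable_gaussian_weight) simp
  show ?thesis
  proof (rule Bochner_Integration.integrable_bound[OF i])
    show "AE r in lborel. norm (hermite r) \<le> norm (2 * exp (- (1 / 2) * r\<^sup>2))"
    proof (rule AE_I2)
      fix r :: real
      have "\<bar>r\<bar> \<le> 2 * (1 + r\<^sup>2 / 2)"
        using sum_squares_bound[of "\<bar>r\<bar>" 1] zero_le_power2[of r] by (simp add: power2_abs)
      also have "\<dots> \<le> 2 * exp (r\<^sup>2 / 2)" by (intro mult_left_mono exp_ge_add_one_self) auto
      finally have "\<bar>r\<bar> * exp (- r\<^sup>2) \<le> 2 * exp (r\<^sup>2 / 2) * exp (- r\<^sup>2)" by (intro mult_right_mono) auto
      also have "\<dots> = 2 * exp (- (1 / 2) * r\<^sup>2)" by (simp add: exp_add[symmetric])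
      finally show "norm (hermite r) \<le> norm (2 * exp (- (1 / 2) * r\<^sup>2))"
        by (simp add: hermite_def abs_mult)
    qed
  qed measurable
qed

lemma integral_derivative_zero:
  fixes F f :: "real \<Rightarrow> complex"
  assumes F: "\<And>x. (F has_vector_derivative f x) (at x)" and f: "continuous_on UNIV f"
    and i: "integrable lborel f"
    and top: "(F \<longlongrightarrow> 0) at_top" and bot: "(F \<longlongrightarrow> 0) at_bot"
  shows "(\<integral>x. f x \<partial>lborel) = 0"
proof -
  have "(LBINT x=-\<infinity>..\<infinity>. f x) = 0 - 0"
  proof (rule interval_integral_FTC_integrable)
    show "(F has_vector_derivative f x) (at x)" for x by (rule F)
    show "isCont f x" for x using f by (simp add: continuous_on_eq_continuous_at)
    show "set_integrable lborel (einterval (- \<infinity>) \<infinity>) f" using i by (simp add: set_integrable_def)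
    show "((F \<circ> real_of_ereal) \<longlongrightarrow> 0) (at_right (- \<infinity>))"
      using bot by (simp add: ereal_tendsto_simps)
    show "((F \<circ> real_of_ereal) \<longlongrightarrow> 0) (at_left \<infinity>)"
      using top by (simp add: ereal_tendsto_simps)
  qed simp
  then show ?thesis by (simp add: interval_lebesgue_integral_def set_lebesgue_integral_def)
qed

text \<open>The profile \<open>\<psi>\<close> has mean zero in the strong form that it is the derivative of a decaying function
  \<open>\<eta>\<close>.\<close>
locale decaying_profile =
  fixes \<eta> \<psi> \<psi>' :: "real \<Rightarrow> complex" and B :: real
  assumes d\<eta>: "\<And>x. (\<eta> has_vector_derivative \<psi> x) (at x)"
    and d\<psi>: "\<And>x. (\<psi> has_vector_derivative \<psi>' x) (at x)"
    and cont: "continuous_on UNIV \<psi>'"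
    and bound_\<eta>: "\<And>x. norm (\<eta> x) \<le> B * decay x"
    and bound_\<psi>: "\<And>x. norm (\<psi> x) \<le> B * decay x"
    and bound_\<psi>': "\<And>x. norm (\<psi>' x) \<le> B * decay x"
begin

lemma cont_\<eta>: "continuous_on UNIV \<eta>" and cont_\<psi>: "continuous_on UNIV \<psi>"
  using d\<eta> d\<psi> by (meson continuous_at_imp_continuous_on has_vector_derivative_continuous)+

lemma measurable_profile [measurable]:
  "\<eta> \<in> borel_measurable borel" "\<psi> \<in> borel_measurable borel" "\<psi>' \<in> borel_measurable borel"
  using cont cont_\<eta> cont_\<psi> by (auto intro: borel_measurable_continuous_onI)

lemma B_nonneg: "0 \<le> B"
  using order_trans[OF norm_ge_zero bound_\<eta>, of 0] decay_pos[of 0] by (simp add: zero_le_mult_iff)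

lemma norm_profile_le: "norm (\<eta> x) \<le> B" "norm (\<psi> x) \<le> B" "norm (\<psi>' x) \<le> B"
proof -
  have *: "B * decay x \<le> B" using B_nonneg decay_le(2) by (simp add: mult_left_le)
  show "norm (\<eta> x) \<le> B" "norm (\<psi> x) \<le> B" "norm (\<psi>' x) \<le> B"
    using bound_\<eta>[of x] bound_\<psi>[of x] bound_\<psi>'[of x] * by linarith+
qed

text \<open>The coefficient with which the derivative of a Gaussian of width \<open>l\<close> centred at \<open>a\<close> enters \<open>\<psi>\<close>, up to
  normalisation. The factor $1-l^2$ is a cutoff that vanishes at \<open>l = 1\<close>; the primitive \<open>\<eta>\<close> appears when its derivative is
  integrated by parts.\<close>
definition source :: "real \<Rightarrow> real \<Rightarrow> complex" where
  "source a l = (1 - l\<^sup>2) *\<^sub>R \<psi>' a - 4 * \<eta> a"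

lemma measurable_source [measurable]: "(\<lambda>(a, l). source a l) \<in> borel_measurable (borel \<Otimes>\<^sub>M borel)"
  unfolding source_def by measurable

lemma norm_source_le: "0 \<le> l \<Longrightarrow> l \<le> 1 \<Longrightarrow> norm (source a l) \<le> 5 * B * decay a"
proof -
  assume l: "0 \<le> l" "l \<le> 1"
  have "l\<^sup>2 \<le> 1" using l by (simp add: power_le_one)
  then have "norm (source a l) \<le> 1 * norm (\<psi>' a) + 4 * norm (\<eta> a)"
    unfolding source_def
    by (intro order_trans[OF norm_triangle_ineq4] add_mono) (auto simp: norm_mult intro!: mult_left_le_one_le)
  also have "\<dots> \<le> 5 * B * decay a" using bound_\<eta>[of a] bound_\<psi>'[of a] by simp
  finally show ?thesis .
qed

lemma integral_by_parts_gaussian: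
  "l *\<^sub>R (\<integral>r. exp (- r\<^sup>2) *\<^sub>R \<psi> (s - l * r) \<partial>lborel) = - 2 * (\<integral>r. hermite r *\<^sub>R \<eta> (s - l * r) \<partial>lborel)"
proof -
  have g: "integrable lborel (\<lambda>r :: real. exp (- r\<^sup>2))" using integrable_gaussian_weight[of 1] by simp
  have i1: "integrable lborel (\<lambda>r. exp (- r\<^sup>2) *\<^sub>R \<psi> (s - l * r))"
  proof (rule Bochner_Integration.integrable_bound)
    show "integrable lborel (\<lambda>r :: real. exp (- r\<^sup>2) * B)" using g by simp
  qed (use norm_profile_le B_nonneg in \<open>auto intro!: AE_I2 mult_left_mono\<close>)
  have i2: "integrable lborel (\<lambda>r. hermite r *\<^sub>R \<eta> (s - l * r))"
  proof (rule Bochner_Integration.integrable_bound)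
    show "integrable lborel (\<lambda>r. hermite r * B)" using integrable_hermite by simp
  qed (use norm_profile_le B_nonneg in \<open>auto intro!: AE_I2 mult_left_mono simp: abs_mult\<close>)
  have lim: "((\<lambda>r. exp (- r\<^sup>2) *\<^sub>R \<eta> (s - l * r)) \<longlongrightarrow> 0) F"
    if F: "((\<lambda>r :: real. exp (- r\<^sup>2)) \<longlongrightarrow> 0) F" for F
  proof (rule Lim_null_comparison)
    show "\<forall>\<^sub>F r in F. norm (exp (- r\<^sup>2) *\<^sub>R \<eta> (s - l * r)) \<le> exp (- r\<^sup>2) * B"
      using norm_profile_le by (intro always_eventually allI) (auto intro!: mult_left_mono)
    show "((\<lambda>r. exp (- r\<^sup>2) * B) \<longlongrightarrow> 0) F" using tendsto_mult_right[OF F, of B] by (simp add: tendsto_mult_left_zero F)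
  qed
  have "(\<integral>r. exp (- r\<^sup>2) *\<^sub>R ((- l) *\<^sub>R \<psi> (s - l * r)) + (- 2 * hermite r) *\<^sub>R \<eta> (s - l * r) \<partial>lborel) = 0"
  proof (rule integral_derivative_zero[where F = "\<lambda>r. exp (- r\<^sup>2) *\<^sub>R \<eta> (s - l * r)"])
    show "((\<lambda>r. exp (- r\<^sup>2) *\<^sub>R \<eta> (s - l * r)) has_vector_derivative
         exp (- x\<^sup>2) *\<^sub>R ((- l) *\<^sub>R \<psi> (s - l * x)) + (- 2 * hermite x) *\<^sub>R \<eta> (s - l * x)) (at x)" for x
    proof (rule has_vector_derivative_scaleR)
      show "((\<lambda>r. exp (- r\<^sup>2)) has_real_derivative - 2 * hermite x) (at x)"
        by (auto intro!: derivative_eq_intros simp: hermite_def)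
      show "((\<lambda>r. \<eta> (s - l * r)) has_vector_derivative (- l) *\<^sub>R \<psi> (s - l * x)) (at x)"
        by (rule vector_diff_chain_at[where f = "\<lambda>r. s - l * r" and g = \<eta>, unfolded o_def])
           (auto intro!: derivative_eq_intros d\<eta>)
    qed
    show "continuous_on UNIV (\<lambda>r. exp (- r\<^sup>2) *\<^sub>R ((- l) *\<^sub>R \<psi> (s - l * r)) + (- 2 * hermite r) *\<^sub>R \<eta> (s - l * r))"
      unfolding hermite_def
      by (intro continuous_intros continuous_on_compose2[OF cont_\<psi>] continuous_on_compose2[OF cont_\<eta>]) auto
    show "integrable lborel (\<lambda>r. exp (- r\<^sup>2) *\<^sub>R ((- l) *\<^sub>R \<psi> (s - l * r)) + (- 2 * hermite r) *\<^sub>R \<eta> (s - l * r))"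
    proof -
      have "integrable lborel (\<lambda>r. (- l) *\<^sub>R (exp (- r\<^sup>2) *\<^sub>R \<psi> (s - l * r)) + (- 2) *\<^sub>R (hermite r *\<^sub>R \<eta> (s - l * r)))"
        by (intro Bochner_Integration.integrable_add integrable_scaleR_right i1 i2)
      then show ?thesis by (simp add: mult_ac)
    qed
    show "((\<lambda>r. exp (- r\<^sup>2) *\<^sub>R \<eta> (s - l * r)) \<longlongrightarrow> 0) at_top"
      by (rule lim) real_asymp
    show "((\<lambda>r. exp (- r\<^sup>2) *\<^sub>R \<eta> (s - l * r)) \<longlongrightarrow> 0) at_bot"
      by (rule lim) real_asymp
  qed
  moreover have "(\<integral>r. exp (- r\<^sup>2) *\<^sub>R ((- l) *\<^sub>R \<psi> (s - l * r)) + (- 2 * hermite r) *\<^sub>R \<eta> (s - l * r) \<partial>lborel)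
      = (\<integral>r. (- l) *\<^sub>R (exp (- r\<^sup>2) *\<^sub>R \<psi> (s - l * r)) + (- 2) *\<^sub>R (hermite r *\<^sub>R \<eta> (s - l * r)) \<partial>lborel)"
    by (simp add: mult_ac)
  moreover have "\<dots> = (- l) *\<^sub>R (\<integral>r. exp (- r\<^sup>2) *\<^sub>R \<psi> (s - l * r) \<partial>lborel) + (- 2) *\<^sub>R (\<integral>r. hermite r *\<^sub>R \<eta> (s - l * r) \<partial>lborel)"
    by (subst Bochner_Integration.integral_add[OF integrable_scaleR_right[OF i1] integrable_scaleR_right[OF i2]])
       (simp only: integral_scaleR_right)
  ultimately show ?thesis
    by (simp add: scaleR_conv_of_real eq_neg_iff_add_eq_0 add.commute)
qed

text \<open>The fundamental theorem of calculus for $l \mapsto (1-l^2)\,\psi(s-lr)$.\<close>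
lemma profile_FTC:
  "(LINT l:{0..1}|lborel. (2 * l) *\<^sub>R \<psi> (s - l * r) + ((1 - l\<^sup>2) * r) *\<^sub>R \<psi>' (s - l * r)) = \<psi> s"
proof -
  have "(\<integral>l. indicator {0..1} l *\<^sub>R ((2 * l) *\<^sub>R \<psi> (s - l * r) + ((1 - l\<^sup>2) * r) *\<^sub>R \<psi>' (s - l * r)) \<partial>lborel)
     = (- ((1 - 1\<^sup>2) *\<^sub>R \<psi> (s - 1 * r))) - (- ((1 - 0\<^sup>2) *\<^sub>R \<psi> (s - 0 * r)))"
  proof (rule integral_FTC_atLeastAtMost)
    show "((\<lambda>l. - ((1 - l\<^sup>2) *\<^sub>R \<psi> (s - l * r))) has_vector_derivative
        (2 * l) *\<^sub>R \<psi> (s - l * r) + ((1 - l\<^sup>2) * r) *\<^sub>R \<psi>' (s - l * r)) (at l within {0..1})" for l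
    proof -
      have "((\<lambda>l. (1 - l\<^sup>2) *\<^sub>R \<psi> (s - l * r)) has_vector_derivative
        (1 - l\<^sup>2) *\<^sub>R ((- r) *\<^sub>R \<psi>' (s - l * r)) + (- (2 * l)) *\<^sub>R \<psi> (s - l * r)) (at l)"
      proof (rule has_vector_derivative_scaleR)
        show "((\<lambda>l. 1 - l\<^sup>2) has_real_derivative - (2 * l)) (at l)"
          by (auto intro!: derivative_eq_intros)
        show "((\<lambda>l. \<psi> (s - l * r)) has_vector_derivative (- r) *\<^sub>R \<psi>' (s - l * r)) (at l)"
          by (rule vector_diff_chain_at[where f = "\<lambda>l. s - l * r" and g = \<psi>, unfolded o_def])
             (auto intro!: derivative_eq_intros d\<psi>)
      qed
      from has_vector_derivative_minus[OF this] show ?thesis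
        by (rule has_vector_derivative_at_within[THEN has_vector_derivative_eq_rhs])
           (simp add: add.commute)
    qed
    show "continuous_on {0..1} (\<lambda>l. (2 * l) *\<^sub>R \<psi> (s - l * r) + ((1 - l\<^sup>2) * r) *\<^sub>R \<psi>' (s - l * r))"
      by (intro continuous_intros continuous_on_compose2[OF cont_\<psi>] continuous_on_compose2[OF cont]) auto
  qed simp
  then show ?thesis by (simp add: set_lebesgue_integral_def)
qed

lemma integrable_source_kernel:
  assumes "0 \<le> l" "l \<le> 1"
  shows "integrable lborel (\<lambda>r. hermite r *\<^sub>R source (s - l * r) l)"
proof (rule Bochner_Integration.integrable_bound)
  show "integrable lborel (\<lambda>r. hermite r * (5 * B))" using integrable_hermite by simp
  have "norm (source a l) \<le> 5 * B" for a
  proof -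
    have "5 * B * decay a \<le> 5 * B * 1" using B_nonneg decay_le(2)[of a] by (intro mult_left_mono) auto
    then show ?thesis using norm_source_le[OF assms, of a] by simp
  qed
  then show "AE r in lborel. norm (hermite r *\<^sub>R source (s - l * r) l) \<le> norm (hermite r * (5 * B))"
    using B_nonneg by (auto intro!: AE_I2 mult_left_mono simp: abs_mult)
qed (simp add: source_def, measurable)

text \<open>A Calderon formula on scales at most one. With the Gaussian smoothing $\psi * g_l$ one has
  $\psi = -\int_0^1 \partial_l\bigl((1-l^2)\,\psi * g_l\bigr)\,dl$. If \<open>l\<close> differentiates the smoothing, it
  produces the derivative of a Gaussian; if it differentiates the cutoff, an integration by parts
  moves one derivative from \<open>\<psi>\<close> to the Gaussian. The cutoff removes all scales above one, hence no
  convergence at infinity is needed.\<close>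
lemma reproducing_formula:
  "sqrt pi *\<^sub>R \<psi> s = (LINT l:{0..1}|lborel. (\<integral>r. hermite r *\<^sub>R source (s - l * r) l \<partial>lborel))"
proof -
  define G where "G r l = exp (- r\<^sup>2) *\<^sub>R ((2 * l) *\<^sub>R \<psi> (s - l * r) + ((1 - l\<^sup>2) * r) *\<^sub>R \<psi>' (s - l * r))" for r l
  have Gm [measurable]: "(\<lambda>(r, l). G r l) \<in> borel_measurable (borel \<Otimes>\<^sub>M borel)" unfolding G_def by measurable
  have g: "integrable lborel (\<lambda>r :: real. exp (- r\<^sup>2))" using integrable_gaussian_weight[of 1] by simp
  have Gi: "integrable (lborel \<Otimes>\<^sub>M lborel) (\<lambda>(r, l). indicator {0..1} l *\<^sub>R G r l)"
  proof (rule Bochner_Integration.integrable_bound)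
    show "integrable (lborel \<Otimes>\<^sub>M lborel) (\<lambda>p :: real \<times> real. (exp (- (fst p)\<^sup>2) * (2 * B) + \<bar>hermite (fst p)\<bar> * B) * indicator {0..1} (snd p))"
      by (rule integrable_mult_product)
         (auto intro!: lborel.sigma_finite_measure_axioms Bochner_Integration.integrable_add g integrable_hermite integrable_abs integrable_mult_left integrable_real_indicator simp: emeasure_lborel_Icc_eq)
    show "AE p in lborel \<Otimes>\<^sub>M lborel. norm (case p of (r, l) \<Rightarrow> indicator {0..1} l *\<^sub>R G r l) \<le>
        norm ((exp (- (fst p)\<^sup>2) * (2 * B) + \<bar>hermite (fst p)\<bar> * B) * indicator {0..1} (snd p))"
    proof (rule AE_I2)
      fix p :: "real \<times> real"
      obtain r l where p: "p = (r, l)" by force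
      have "norm (G r l) \<le> exp (- r\<^sup>2) * (2 * B) + \<bar>hermite r\<bar> * B" if l: "0 \<le> l" "l \<le> 1"
      proof -
        have "l\<^sup>2 \<le> 1" using l by (simp add: power_le_one)
        then have le1: "\<bar>1 - l\<^sup>2\<bar> \<le> 1" by (simp add: abs_le_iff)
        have a: "norm ((2 * l) *\<^sub>R \<psi> (s - l * r)) \<le> 2 * B"
          using mult_mono[OF l(2) norm_profile_le(2)[of "s - l * r"]] l B_nonneg by simp
        have b: "norm (((1 - l\<^sup>2) * r) *\<^sub>R \<psi>' (s - l * r)) \<le> (1 * \<bar>r\<bar>) * B"
          unfolding norm_scaleR abs_mult using le1 norm_profile_le(3) B_nonneg
          by (intro mult_mono) auto
        have "norm (G r l) \<le> exp (- r\<^sup>2) * (2 * B + (1 * \<bar>r\<bar>) * B)"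
          unfolding G_def norm_scaleR abs_exp_cancel
          by (intro mult_left_mono order_trans[OF norm_triangle_ineq] add_mono a b) auto
        then show ?thesis by (simp add: hermite_def abs_mult algebra_simps)
      qed
      then show "norm (case p of (r, l) \<Rightarrow> indicator {0..1} l *\<^sub>R G r l) \<le>
        norm ((exp (- (fst p)\<^sup>2) * (2 * B) + \<bar>hermite (fst p)\<bar> * B) * indicator {0..1} (snd p))"
        using B_nonneg by (auto simp: p indicator_def)
    qed
  qed measurable
  have "sqrt pi *\<^sub>R \<psi> s = (\<integral>r. exp (- r\<^sup>2) *\<^sub>R \<psi> s \<partial>lborel)"
    using has_bochner_integral_quadratic_gaussian[of 1 1 0 0 0] by (simp add: has_bochner_integral_iff)
  also have "\<dots> = (\<integral>r. (\<integral>l. indicator {0..1} l *\<^sub>R G r l \<partial>lborel) \<partial>lborel)"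
  proof (intro Bochner_Integration.integral_cong refl)
    fix r
    have "(\<integral>l. indicator {0..1} l *\<^sub>R G r l \<partial>lborel) = (\<integral>l. exp (- r\<^sup>2) *\<^sub>R (indicator {0..1} l *\<^sub>R ((2 * l) *\<^sub>R \<psi> (s - l * r) + ((1 - l\<^sup>2) * r) *\<^sub>R \<psi>' (s - l * r))) \<partial>lborel)"
      unfolding G_def by (simp only: scaleR_left_commute)
    also have "\<dots> = exp (- r\<^sup>2) *\<^sub>R \<psi> s"
      unfolding integral_scaleR_right by (simp only: profile_FTC[unfolded set_lebesgue_integral_def])
    finally show "exp (- r\<^sup>2) *\<^sub>R \<psi> s = (\<integral>l. indicator {0..1} l *\<^sub>R G r l \<partial>lborel)" ..
  qed
  also have "\<dots> = (\<integral>l. (\<integral>r. indicator {0..1} l *\<^sub>R G r l \<partial>lborel) \<partial>lborel)"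
    by (rule lborel_pair.Fubini_integral[OF Gi, symmetric])
  also have "\<dots> = (LINT l:{0..1}|lborel. (\<integral>r. hermite r *\<^sub>R source (s - l * r) l \<partial>lborel))"
    unfolding set_lebesgue_integral_def
  proof (intro Bochner_Integration.integral_cong refl)
    fix l :: real
    have "(\<integral>r. G r l \<partial>lborel) = (\<integral>r. hermite r *\<^sub>R source (s - l * r) l \<partial>lborel)"
    proof -
      have i1: "integrable lborel (\<lambda>r. exp (- r\<^sup>2) *\<^sub>R \<psi> (s - l * r))"
      proof (rule Bochner_Integration.integrable_bound)
        show "integrable lborel (\<lambda>r :: real. exp (- r\<^sup>2) * B)" using g by simp
      qed (use norm_profile_le B_nonneg in \<open>auto intro!: AE_I2 mult_left_mono\<close>)
      have i2: "integrable lborel (\<lambda>r. hermite r *\<^sub>R f (s - l * r))"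
        if [measurable]: "f \<in> borel_measurable borel" and f: "\<And>x. norm (f x) \<le> B" for f :: "real \<Rightarrow> complex"
      proof (rule Bochner_Integration.integrable_bound)
        show "integrable lborel (\<lambda>r. hermite r * B)" using integrable_hermite by simp
      qed (use f B_nonneg in \<open>auto intro!: AE_I2 mult_left_mono simp: abs_mult\<close>)
      note ic = i2[OF measurable_profile(1) norm_profile_le(1)] and id = i2[OF measurable_profile(3) norm_profile_le(3)]
      have "(\<integral>r. G r l \<partial>lborel) = (\<integral>r. (2 * l) *\<^sub>R (exp (- r\<^sup>2) *\<^sub>R \<psi> (s - l * r)) + (1 - l\<^sup>2) *\<^sub>R (hermite r *\<^sub>R \<psi>' (s - l * r)) \<partial>lborel)"
        unfolding G_def hermite_def by (simp add: scaleR_right_distrib mult_ac)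
      also have "\<dots> = (2 * l) *\<^sub>R (\<integral>r. exp (- r\<^sup>2) *\<^sub>R \<psi> (s - l * r) \<partial>lborel) + (1 - l\<^sup>2) *\<^sub>R (\<integral>r. hermite r *\<^sub>R \<psi>' (s - l * r) \<partial>lborel)"
        by (subst Bochner_Integration.integral_add[OF integrable_scaleR_right[OF i1] integrable_scaleR_right[OF id]])
             (simp only: integral_scaleR_right)
      also have "(2 * l) *\<^sub>R (\<integral>r. exp (- r\<^sup>2) *\<^sub>R \<psi> (s - l * r) \<partial>lborel) = (- 4) *\<^sub>R (\<integral>r. hermite r *\<^sub>R \<eta> (s - l * r) \<partial>lborel)"
      proof -
        have "(2 * l) *\<^sub>R (\<integral>r. exp (- r\<^sup>2) *\<^sub>R \<psi> (s - l * r) \<partial>lborel) = 2 *\<^sub>R (l *\<^sub>R (\<integral>r. exp (- r\<^sup>2) *\<^sub>R \<psi> (s - l * r) \<partial>lborel))"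
          by simp
        then show ?thesis unfolding integral_by_parts_gaussian by (simp add: scaleR_conv_of_real)
      qed
      also have "(- 4) *\<^sub>R (\<integral>r. hermite r *\<^sub>R \<eta> (s - l * r) \<partial>lborel) + (1 - l\<^sup>2) *\<^sub>R (\<integral>r. hermite r *\<^sub>R \<psi>' (s - l * r) \<partial>lborel)
         = (\<integral>r. (- 4) *\<^sub>R (hermite r *\<^sub>R \<eta> (s - l * r)) + (1 - l\<^sup>2) *\<^sub>R (hermite r *\<^sub>R \<psi>' (s - l * r)) \<partial>lborel)"
        by (subst Bochner_Integration.integral_add[OF integrable_scaleR_right[OF ic] integrable_scaleR_right[OF id]])
             (simp only: integral_scaleR_right)
      also have "\<dots> = (\<integral>r. hermite r *\<^sub>R source (s - l * r) l \<partial>lborel)"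
        unfolding source_def by (intro Bochner_Integration.integral_cong refl) (simp add: scaleR_conv_of_real algebra_simps)
      finally show ?thesis .
    qed
    then show "(\<integral>r. indicator {0..1} l *\<^sub>R G r l \<partial>lborel) = indicator {0..1} l *\<^sub>R (\<integral>r. hermite r *\<^sub>R source (s - l * r) l \<partial>lborel)"
      by simp
  qed
  finally show ?thesis .
qed

end

definition wavelet :: "(real \<Rightarrow> complex) \<Rightarrow> real \<Rightarrow> real \<Rightarrow> complex" where
  "wavelet P a l = (\<integral>s. hermite ((s - a) / l) *\<^sub>R P s \<partial>lborel)"

lemma measurable_wavelet:
  assumes [measurable]: "P \<in> borel_measurable borel"
  shows "(\<lambda>(a, l). wavelet P a l) \<in> borel_measurable (borel \<Otimes>\<^sub>M borel)"
  unfolding wavelet_def by measurable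

lemma norm_integral_le_nn:
  fixes f :: "'a \<Rightarrow> complex"
  shows "ennreal (norm (\<integral>x. f x \<partial>M)) \<le> (\<integral>\<^sup>+x. ennreal (norm (f x)) \<partial>M)"
  by (cases "integrable M f") (auto simp: integral_norm_bound_ennreal not_integrable_integral_eq)

lemma integrable_product_bounded:
  fixes f :: "'a \<Rightarrow> complex" and g :: "'b \<Rightarrow> complex" and k :: "'a \<times> 'b \<Rightarrow> complex"
  assumes "sigma_finite_measure M" "sigma_finite_measure N"
    and f: "integrable M f" and g: "integrable N g"
    and k: "k \<in> borel_measurable (M \<Otimes>\<^sub>M N)" and bd: "\<And>x y. norm (k (x, y)) \<le> C * (norm (f x) * norm (g y))"
  shows "integrable (M \<Otimes>\<^sub>M N) k"
proof (rule Bochner_Integration.integrable_bound)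
  show "integrable (M \<Otimes>\<^sub>M N) (\<lambda>p. C * (norm (f (fst p)) * norm (g (snd p))))"
    by (intro integrable_mult_right integrable_mult_product assms integrable_norm)
  show "AE p in M \<Otimes>\<^sub>M N. norm (k p) \<le> norm (C * (norm (f (fst p)) * norm (g (snd p))))"
  proof (rule AE_I2)
    fix p
    have "norm (k p) \<le> C * (norm (f (fst p)) * norm (g (snd p)))" using bd[of "fst p" "snd p"] by simp
    then show "norm (k p) \<le> norm (C * (norm (f (fst p)) * norm (g (snd p))))" by simp
  qed
qed (rule k)

lemma ennreal_mult_assoc_eq:
  "0 \<le> c \<Longrightarrow> 0 \<le> x \<Longrightarrow> c * x = y \<Longrightarrow> ennreal c * (ennreal x * i) = ennreal y * i"
  by (auto simp: ennreal_mult mult.assoc)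

text \<open>This integral over the scales below one turns \<open>decay\<close> into the Poisson weight.\<close>
lemma nn_integral_scaled_decay:
  "(\<integral>\<^sup>+l. ennreal (l * decay (l * x)) * indicator {0..1} l \<partial>lborel) = ennreal (1 / (2 * (1 + x\<^sup>2)))"
proof -
  have pos: "0 < 1 + (l * x)\<^sup>2" for l :: real by (simp add: add_pos_nonneg)
  have "(\<integral>\<^sup>+l. ennreal (l * decay (l * x)) * indicator {0..1} l \<partial>lborel) = ennreal (1\<^sup>2 / (2 * (1 + (1 * x)\<^sup>2)) - 0\<^sup>2 / (2 * (1 + (0 * x)\<^sup>2)))"
  proof (rule nn_integral_FTC_Icc[where F = "\<lambda>l. l\<^sup>2 / (2 * (1 + (l * x)\<^sup>2))"])
    show "(\<lambda>l. l * decay (l * x)) \<in> borel_measurable borel" by measurable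
    show "((\<lambda>l. l\<^sup>2 / (2 * (1 + (l * x)\<^sup>2))) has_real_derivative l * decay (l * x)) (at l)" for l
    proof -
      have "((\<lambda>l. l\<^sup>2 / (2 * (1 + (l * x)\<^sup>2))) has_real_derivative
         ((2 * l) * (2 * (1 + (l * x)\<^sup>2)) - l\<^sup>2 * (2 * (2 * (l * x) * x))) / ((2 * (1 + (l * x)\<^sup>2)) * (2 * (1 + (l * x)\<^sup>2)))) (at l)"
        using pos[of l] by (auto intro!: derivative_eq_intros simp: power2_eq_square)
      moreover have "((2 * l) * (2 * (1 + (l * x)\<^sup>2)) - l\<^sup>2 * (2 * (2 * (l * x) * x))) / ((2 * (1 + (l * x)\<^sup>2)) * (2 * (1 + (l * x)\<^sup>2))) = l * decay (l * x)"
      proof -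
        have "(2 * l) * (2 * (1 + (l * x)\<^sup>2)) - l\<^sup>2 * (2 * (2 * (l * x) * x)) = 4 * l"
          by (simp add: power2_eq_square algebra_simps)
        moreover have "4 * l / ((2 * D) * (2 * D)) = l * (1 / D\<^sup>2)" for D :: real
          by (simp add: power2_eq_square)
        ultimately show ?thesis by (simp only: decay_def)
      qed
      ultimately show ?thesis by simp
    qed
    show "0 \<le> l * decay (l * x)" if "l \<in> {0..1}" for l
      using that decay_pos[of "l * x"] by simp
  qed simp
  then show ?thesis by simp
qed

context decaying_profile
begin

lemma integrable_source:
  assumes l: "0 \<le> l" "l \<le> 1" and t: "0 < t"
  shows "integrable lborel (\<lambda>a. source (a / t) l)"
proof (rule Bochner_Integration.integrable_bound)
  show "integrable lborel (\<lambda>a. 5 * B * decay (a / t))"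
    using lborel_integrable_real_affine[OF integrable_decay, of "1 / t" 0] t by simp
  show "AE a in lborel. norm (source (a / t) l) \<le> norm (5 * B * decay (a / t))"
    using norm_source_le[OF l] by (auto intro!: AE_I2 order_trans[OF norm_source_le[OF l] abs_ge_self])
qed (simp add: source_def, measurable)

lemma source_kernel_rescaled:
  assumes l: "0 < l" "l \<le> 1" and t: "0 < t"
  shows "(\<integral>r. hermite r *\<^sub>R source (s / t - l * r) l \<partial>lborel)
    = (1 / (l * t)) *\<^sub>R (\<integral>a. hermite ((s - a) / (l * t)) *\<^sub>R source (a / t) l \<partial>lborel)"
proof -
  have "(\<integral>r. hermite r *\<^sub>R source (s / t - l * r) l \<partial>lborel)
    = \<bar>- 1 / (l * t)\<bar> *\<^sub>R (\<integral>a. hermite (s / (l * t) + (- 1 / (l * t)) * a) *\<^sub>R source (s / t - l * (s / (l * t) + (- 1 / (l * t)) * a)) l \<partial>lborel)"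
    using l t by (intro lborel_integral_real_affine) auto
  also have "\<dots> = (1 / (l * t)) *\<^sub>R (\<integral>a. hermite ((s - a) / (l * t)) *\<^sub>R source (a / t) l \<partial>lborel)"
  proof -
    have "s / (l * t) + (- 1 / (l * t)) * a = (s - a) / (l * t)" for a
      by (simp add: diff_divide_distrib)
    moreover have "s / t - l * ((s - a) / (l * t)) = a / t" for a
      using l t by (simp add: field_simps)
    ultimately show ?thesis using l t by simp
  qed
  finally show ?thesis .
qed

lemma pairing_slice:
  assumes P: "integrable lborel P" and l: "0 < l" "l \<le> 1" and t: "0 < t"
  shows "(\<integral>s. P s * (\<integral>r. hermite r *\<^sub>R source (s / t - l * r) l \<partial>lborel) \<partial>lborel)
    = (\<integral>a. (1 / (l * t)) *\<^sub>R (source (a / t) l * wavelet P a (l * t)) \<partial>lborel)"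
proof -
  have [measurable]: "P \<in> borel_measurable borel" using P by auto
  define k where "k = (\<lambda>(s, a). P s * (hermite ((s - a) / (l * t)) *\<^sub>R source (a / t) l))"
  have ki: "integrable (lborel \<Otimes>\<^sub>M lborel) k"
  proof (rule integrable_product_bounded[OF lborel.sigma_finite_measure_axioms lborel.sigma_finite_measure_axioms P
        integrable_source[OF less_imp_le[OF l(1)] l(2) t]])
    show "k \<in> borel_measurable (lborel \<Otimes>\<^sub>M lborel)" unfolding k_def source_def by measurable
    show "norm (k (s, a)) \<le> 1 * (norm (P s) * norm (source (a / t) l))" for s a
      using abs_hermite_le[of "(s - a) / (l * t)"]
      by (auto simp: k_def norm_mult intro!: mult_left_mono mult_left_le_one_le)
  qed
  have "(\<integral>s. P s * (\<integral>r. hermite r *\<^sub>R source (s / t - l * r) l \<partial>lborel) \<partial>lborel)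
     = (\<integral>s. (1 / (l * t)) *\<^sub>R (\<integral>a. k (s, a) \<partial>lborel) \<partial>lborel)"
  proof -
    have "(\<integral>a. k (s, a) \<partial>lborel) = P s * (\<integral>a. hermite ((s - a) / (l * t)) *\<^sub>R source (a / t) l \<partial>lborel)" for s
      unfolding k_def prod.case by (rule integral_mult_right_zero)
    then show ?thesis unfolding source_kernel_rescaled[OF l t] by (simp only: mult_scaleR_right)
  qed
  also have "\<dots> = (1 / (l * t)) *\<^sub>R (\<integral>s. (\<integral>a. k (s, a) \<partial>lborel) \<partial>lborel)" by simp
  also have "(\<integral>s. (\<integral>a. k (s, a) \<partial>lborel) \<partial>lborel) = (\<integral>a. (\<integral>s. k (s, a) \<partial>lborel) \<partial>lborel)"
    using lborel_pair.Fubini_integral[of "\<lambda>s a. k (s, a)"] ki by (simp add: case_prod_eta)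
  also have "\<dots> = (\<integral>a. source (a / t) l * wavelet P a (l * t) \<partial>lborel)"
  proof (intro Bochner_Integration.integral_cong refl)
    fix a
    have "(\<integral>s. k (s, a) \<partial>lborel) = (\<integral>s. source (a / t) l * (hermite ((s - a) / (l * t)) *\<^sub>R P s) \<partial>lborel)"
      by (simp add: k_def mult_ac)
    then show "(\<integral>s. k (s, a) \<partial>lborel) = source (a / t) l * wavelet P a (l * t)"
      by (simp add: wavelet_def del: mult_scaleR_right)
  qed
  finally show ?thesis by simp
qed

lemma pairing_bound:
  assumes P: "integrable lborel P" and t: "0 < t"
  shows "ennreal (norm (\<integral>s. P s * \<psi> (s / t) \<partial>lborel))
    \<le> (\<integral>\<^sup>+l. (\<integral>\<^sup>+a. ennreal (5 * B * decay (a / t) / (l * t) * norm (wavelet P a (l * t))) \<partial>lborel) * indicator {0<..1} l \<partial>lborel)"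
proof -
  have [measurable]: "P \<in> borel_measurable borel" using P by auto
  define K where "K s l = (\<integral>r. hermite r *\<^sub>R source (s / t - l * r) l \<partial>lborel)" for s l
  define c0 where "c0 = (\<integral>r. \<bar>hermite r\<bar> * (5 * B) \<partial>lborel)"
  have Kb: "norm (K s l) \<le> c0" if l: "0 \<le> l" "l \<le> 1" for s l
    unfolding K_def c0_def
  proof (rule Bochner_Integration.integral_norm_bound_integral)
    show "integrable lborel (\<lambda>r. hermite r *\<^sub>R source (s / t - l * r) l)"
      by (rule integrable_source_kernel[OF l])
    show "integrable lborel (\<lambda>r. \<bar>hermite r\<bar> * (5 * B))" using integrable_hermite by simp
    fix r
    have "5 * B * decay (s / t - l * r) \<le> 5 * B * 1" using B_nonneg decay_le(2) by (intro mult_left_mono) auto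
    then show "norm (hermite r *\<^sub>R source (s / t - l * r) l) \<le> \<bar>hermite r\<bar> * (5 * B)"
      using norm_source_le[OF l, of "s / t - l * r"] by (auto intro!: mult_left_mono)
  qed
  define k where "k = (\<lambda>(s, l). indicator {0..1} l *\<^sub>R (P s * K s l))"
  have ki: "integrable (lborel \<Otimes>\<^sub>M lborel) k"
  proof (rule integrable_product_bounded[OF lborel.sigma_finite_measure_axioms lborel.sigma_finite_measure_axioms P])
    show "integrable lborel (\<lambda>l :: real. complex_of_real (indicator {0..1} l))"
      by (intro integrable_of_real integrable_real_indicator) (auto simp: emeasure_lborel_Icc_eq)
    show "k \<in> borel_measurable (lborel \<Otimes>\<^sub>M lborel)" unfolding k_def K_def source_def by measurable
    show "norm (k (s, l)) \<le> c0 * (norm (P s) * norm (complex_of_real (indicator {0..1} l)))" for s l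
      using Kb[of l s] by (auto simp: k_def indicator_def norm_mult mult.commute[of c0] intro!: mult_left_mono)
  qed
  have eq: "sqrt pi *\<^sub>R (\<integral>s. P s * \<psi> (s / t) \<partial>lborel) = (\<integral>l. (\<integral>s. k (s, l) \<partial>lborel) \<partial>lborel)"
  proof -
    have "sqrt pi *\<^sub>R (\<integral>s. P s * \<psi> (s / t) \<partial>lborel) = (\<integral>s. sqrt pi *\<^sub>R (P s * \<psi> (s / t)) \<partial>lborel)"
      by (rule integral_scaleR_right[symmetric])
    also have "\<dots> = (\<integral>s. (\<integral>l. k (s, l) \<partial>lborel) \<partial>lborel)"
    proof (intro Bochner_Integration.integral_cong refl)
      fix s
      have "sqrt pi *\<^sub>R (P s * \<psi> (s / t)) = P s * (sqrt pi *\<^sub>R \<psi> (s / t))" by simp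
      also have "\<dots> = P s * (\<integral>l. indicator {0..1} l *\<^sub>R K s l \<partial>lborel)"
        unfolding reproducing_formula[of "s / t"] K_def set_lebesgue_integral_def ..
      also have "\<dots> = (\<integral>l. k (s, l) \<partial>lborel)"
        by (simp add: k_def flip: integral_mult_right_zero)
      finally show "sqrt pi *\<^sub>R (P s * \<psi> (s / t)) = (\<integral>l. k (s, l) \<partial>lborel)" .
    qed
    also have "\<dots> = (\<integral>l. (\<integral>s. k (s, l) \<partial>lborel) \<partial>lborel)"
      using lborel_pair.Fubini_integral[of "\<lambda>s l. k (s, l)"] ki by (simp add: case_prod_eta)
    finally show ?thesis .
  qed
  have "1 \<le> sqrt pi" using pi_gt3 by simp
  then have "norm (\<integral>s. P s * \<psi> (s / t) \<partial>lborel) \<le> sqrt pi * norm (\<integral>s. P s * \<psi> (s / t) \<partial>lborel)"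
    by (simp add: mult_le_cancel_right1)
  also have "\<dots> = norm (\<integral>l. (\<integral>s. k (s, l) \<partial>lborel) \<partial>lborel)"
    unfolding eq[symmetric] by simp
  finally have "ennreal (norm (\<integral>s. P s * \<psi> (s / t) \<partial>lborel)) \<le> ennreal (norm (\<integral>l. (\<integral>s. k (s, l) \<partial>lborel) \<partial>lborel))"
    by (rule ennreal_leI)
  also have "\<dots> \<le> (\<integral>\<^sup>+l. ennreal (norm (\<integral>s. k (s, l) \<partial>lborel)) \<partial>lborel)"
    by (rule norm_integral_le_nn)
  also have "\<dots> \<le> (\<integral>\<^sup>+l. (\<integral>\<^sup>+a. ennreal (5 * B * decay (a / t) / (l * t) * norm (wavelet P a (l * t))) \<partial>lborel) * indicator {0<..1} l \<partial>lborel)"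
  proof (rule nn_integral_mono_AE)
    have "AE l in lborel. l \<noteq> (0 :: real)" by (rule AE_lborel_singleton)
    then show "AE l in lborel. ennreal (norm (\<integral>s. k (s, l) \<partial>lborel)) \<le>
      (\<integral>\<^sup>+a. ennreal (5 * B * decay (a / t) / (l * t) * norm (wavelet P a (l * t))) \<partial>lborel) * indicator {0<..1} l"
    proof (rule AE_mp, intro AE_I2 impI)
      fix l :: real assume l0: "l \<noteq> 0"
      show "ennreal (norm (\<integral>s. k (s, l) \<partial>lborel)) \<le>
        (\<integral>\<^sup>+a. ennreal (5 * B * decay (a / t) / (l * t) * norm (wavelet P a (l * t))) \<partial>lborel) * indicator {0<..1} l"
      proof (cases "l \<in> {0..1}")
        case True
        with l0 have l: "0 < l" "l \<le> 1" by auto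
        have "(\<integral>s. k (s, l) \<partial>lborel) = (\<integral>a. (1 / (l * t)) *\<^sub>R (source (a / t) l * wavelet P a (l * t)) \<partial>lborel)"
          using pairing_slice[OF P l t] True by (simp add: k_def K_def)
        then have "ennreal (norm (\<integral>s. k (s, l) \<partial>lborel)) \<le> (\<integral>\<^sup>+a. ennreal (norm ((1 / (l * t)) *\<^sub>R (source (a / t) l * wavelet P a (l * t)))) \<partial>lborel)"
          by (simp only: norm_integral_le_nn)
        also have "\<dots> \<le> (\<integral>\<^sup>+a. ennreal (5 * B * decay (a / t) / (l * t) * norm (wavelet P a (l * t))) \<partial>lborel)"
        proof (intro nn_integral_mono ennreal_leI)
          fix a
          have "norm ((1 / (l * t)) *\<^sub>R (source (a / t) l * wavelet P a (l * t))) = norm (source (a / t) l) / (l * t) * norm (wavelet P a (l * t))"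
            using l t by (simp add: norm_mult)
          also have "\<dots> \<le> 5 * B * decay (a / t) / (l * t) * norm (wavelet P a (l * t))"
            using l t by (intro mult_right_mono divide_right_mono norm_source_le) auto
          finally show "norm ((1 / (l * t)) *\<^sub>R (source (a / t) l * wavelet P a (l * t))) \<le> 5 * B * decay (a / t) / (l * t) * norm (wavelet P a (l * t))" .
        qed
        finally show ?thesis using l by simp
      next
        case False
        then show ?thesis by (simp add: k_def)
      qed
    qed
  qed
  finally show ?thesis .
qed

text \<open>Cauchy-Schwarz in the measure with density \<open>decay (a / t) / t\<close> on the strip of scales \<open>l\<close> in
  $(0,1]$. The mass of this measure does not depend on \<open>t\<close>.\<close>
lemma pairing_square_bound:
  assumes P: "integrable lborel P" and t: "0 < t"
  shows "ennreal ((norm (\<integral>s. P s * \<psi> (s / t) \<partial>lborel))\<^sup>2)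
    \<le> ennreal (25 * B\<^sup>2 * (\<integral>x. decay x \<partial>lborel)) *
      (\<integral>\<^sup>+l. (\<integral>\<^sup>+a. ennreal (decay (a / t) / (l\<^sup>2 * t) * (norm (wavelet P a (l * t)))\<^sup>2) * indicator {0<..1} l \<partial>lborel) \<partial>lborel)"
proof -
  have [measurable]: "P \<in> borel_measurable borel" using P by auto
  note [measurable] = measurable_wavelet[of P]
  define f where "f = (\<lambda>(l :: real, a). ennreal (sqrt (decay (a / t) / t)) * indicator {0<..1} l)"
  define g where "g = (\<lambda>(l, a). ennreal (5 * B * sqrt (decay (a / t) / t) / l * norm (wavelet P a (l * t))) * indicator {0<..1} l)"
  have [measurable]: "f \<in> borel_measurable (lborel \<Otimes>\<^sub>M lborel)" unfolding f_def by measurable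
  have [measurable]: "g \<in> borel_measurable (lborel \<Otimes>\<^sub>M lborel)" unfolding g_def by measurable
  have "ennreal (norm (\<integral>s. P s * \<psi> (s / t) \<partial>lborel)) \<le> (\<integral>\<^sup>+l. (\<integral>\<^sup>+a. f (l, a) * g (l, a) \<partial>lborel) \<partial>lborel)"
  proof (rule order_trans[OF pairing_bound[OF P t]], rule nn_integral_mono)
    fix l :: real
    show "(\<integral>\<^sup>+a. ennreal (5 * B * decay (a / t) / (l * t) * norm (wavelet P a (l * t))) \<partial>lborel) * indicator {0<..1} l
       \<le> (\<integral>\<^sup>+a. f (l, a) * g (l, a) \<partial>lborel)"
    proof (cases "l \<in> {0<..1}")
      case True
      then have l: "0 < l" "l \<le> 1" by auto
      have "5 * B * decay (a / t) / (l * t) * norm (wavelet P a (l * t)) =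
         sqrt (decay (a / t) / t) * (5 * B * sqrt (decay (a / t) / t) / l * norm (wavelet P a (l * t)))" for a
      proof -
        \<comment> \<open>The square root of the density goes to each of the two factors.\<close>
        define q where "q = sqrt (decay (a / t) / t)"
        have qq: "q * q = decay (a / t) / t"
          using t decay_pos[of "a / t"] by (simp add: q_def less_imp_le)
        have "5 * B * decay (a / t) / (l * t) * n = (q * q) * (5 * B / l * n)" for n
          unfolding qq by (simp add: mult_ac)
        moreover have "(q * q) * (5 * B / l * n) = q * (5 * B * q / l * n)" for n by simp
        ultimately show ?thesis unfolding q_def by metis
      qed
      then have "ennreal (5 * B * decay (a / t) / (l * t) * norm (wavelet P a (l * t))) = f (l, a) * g (l, a)" for a
        unfolding f_def g_def using True l t B_nonneg decay_pos[of "a / t"]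
        by (simp add: ennreal_mult[symmetric])
      then show ?thesis using True by simp
    qed simp
  qed
  also have "\<dots> = (\<integral>\<^sup>+p. f p * g p \<partial>(lborel \<Otimes>\<^sub>M lborel))"
    by (rule lborel.nn_integral_fst) measurable
  finally have "(ennreal (norm (\<integral>s. P s * \<psi> (s / t) \<partial>lborel)))\<^sup>2 \<le> (\<integral>\<^sup>+p. f p * g p \<partial>(lborel \<Otimes>\<^sub>M lborel))\<^sup>2"
    by (intro power_mono) auto
  also have "\<dots> \<le> (\<integral>\<^sup>+p. (f p)\<^sup>2 \<partial>(lborel \<Otimes>\<^sub>M lborel)) * (\<integral>\<^sup>+p. (g p)\<^sup>2 \<partial>(lborel \<Otimes>\<^sub>M lborel))"
    by (rule Cauchy_Schwarz_nn_integral) measurable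
  also have "(\<integral>\<^sup>+p. (f p)\<^sup>2 \<partial>(lborel \<Otimes>\<^sub>M lborel)) = ennreal (\<integral>x. decay x \<partial>lborel)"
  proof -
    have d: "(\<integral>\<^sup>+a. ennreal (decay (a / t) / t) \<partial>lborel) = ennreal (\<integral>x. decay x \<partial>lborel)"
    proof -
      have "(\<integral>\<^sup>+x. ennreal (decay x) \<partial>lborel) = ennreal \<bar>1 / t\<bar> * (\<integral>\<^sup>+a. ennreal (decay (0 + (1 / t) * a)) \<partial>lborel)"
        using t by (intro nn_integral_real_affine) auto
      also have "\<dots> = (\<integral>\<^sup>+a. ennreal (1 / t) * ennreal (decay (a / t)) \<partial>lborel)"
        using t by (subst nn_integral_cmult) auto
      also have "\<dots> = (\<integral>\<^sup>+a. ennreal (decay (a / t) / t) \<partial>lborel)"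
        using t decay_pos by (intro nn_integral_cong) (simp add: ennreal_mult[symmetric] less_imp_le)
      finally show ?thesis
        using nn_integral_eq_integral[OF integrable_decay] decay_pos by (simp add: less_imp_le)
    qed
    have "(\<integral>\<^sup>+p. (f p)\<^sup>2 \<partial>(lborel \<Otimes>\<^sub>M lborel)) = (\<integral>\<^sup>+l. (\<integral>\<^sup>+a. (f (l, a))\<^sup>2 \<partial>lborel) \<partial>lborel)"
      by (rule lborel.nn_integral_fst[symmetric]) measurable
    also have "\<dots> = (\<integral>\<^sup>+l. (\<integral>\<^sup>+a. ennreal (decay (a / t) / t) * indicator {0<..1 :: real} l \<partial>lborel) \<partial>lborel)"
      unfolding f_def using t decay_pos
      by (intro nn_integral_cong) (auto simp: indicator_def ennreal_power less_imp_le)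
    also have "\<dots> = (\<integral>\<^sup>+l. ennreal (\<integral>x. decay x \<partial>lborel) * indicator {0<..1 :: real} l \<partial>lborel)"
      by (intro nn_integral_cong) (simp add: nn_integral_multc d)
    also have "\<dots> = ennreal (\<integral>x. decay x \<partial>lborel)"
      by (subst nn_integral_cmult_indicator) auto
    finally show ?thesis .
  qed
  also have "(\<integral>\<^sup>+p. (g p)\<^sup>2 \<partial>(lborel \<Otimes>\<^sub>M lborel)) = ennreal (25 * B\<^sup>2) *
      (\<integral>\<^sup>+l. (\<integral>\<^sup>+a. ennreal (decay (a / t) / (l\<^sup>2 * t) * (norm (wavelet P a (l * t)))\<^sup>2) * indicator {0<..1} l \<partial>lborel) \<partial>lborel)"
  proof -
    have "(\<integral>\<^sup>+p. (g p)\<^sup>2 \<partial>(lborel \<Otimes>\<^sub>M lborel)) = (\<integral>\<^sup>+l. (\<integral>\<^sup>+a. (g (l, a))\<^sup>2 \<partial>lborel) \<partial>lborel)"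
      by (rule lborel.nn_integral_fst[symmetric]) measurable
    also have "\<dots> = (\<integral>\<^sup>+l. (\<integral>\<^sup>+a. ennreal (25 * B\<^sup>2) * (ennreal (decay (a / t) / (l\<^sup>2 * t) * (norm (wavelet P a (l * t)))\<^sup>2) * indicator {0<..1} l) \<partial>lborel) \<partial>lborel)"
    proof (intro nn_integral_cong)
      fix l a :: real
      show "(g (l, a))\<^sup>2 = ennreal (25 * B\<^sup>2) * (ennreal (decay (a / t) / (l\<^sup>2 * t) * (norm (wavelet P a (l * t)))\<^sup>2) * indicator {0<..1} l)"
      proof (cases "l \<in> {0<..1}")
        case True
        have "(5 * B * sqrt (decay (a / t) / t) / l * norm (wavelet P a (l * t)))\<^sup>2 = 25 * B\<^sup>2 * (decay (a / t) / (l\<^sup>2 * t) * (norm (wavelet P a (l * t)))\<^sup>2)"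
          using True t decay_pos[of "a / t"] by (simp add: power_mult_distrib power_divide mult_ac)
        then show ?thesis
          unfolding g_def using True t B_nonneg decay_pos[of "a / t"]
          by (simp add: ennreal_power ennreal_mult[symmetric])
      qed (simp add: g_def)
    qed
    also have "\<dots> = ennreal (25 * B\<^sup>2) *
      (\<integral>\<^sup>+l. (\<integral>\<^sup>+a. ennreal (decay (a / t) / (l\<^sup>2 * t) * (norm (wavelet P a (l * t)))\<^sup>2) * indicator {0<..1} l \<partial>lborel) \<partial>lborel)"
      by (simp add: nn_integral_cmult)
    finally show ?thesis .
  qed
  also have "ennreal (\<integral>x. decay x \<partial>lborel) * (ennreal (25 * B\<^sup>2) * X) = ennreal (25 * B\<^sup>2 * (\<integral>x. decay x \<partial>lborel)) * X" for X
    using B_nonneg decay_pos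
    by (subst ennreal_mult) (auto intro!: Bochner_Integration.integral_nonneg simp: less_imp_le mult_ac)
  finally show ?thesis by (simp add: ennreal_power)
qed

text \<open>A square function with an arbitrary mean-zero profile is dominated, for every single function
  \<open>P\<close>, by the one with the derivative of a Gaussian and a Poisson average over its centre \<open>a\<close>. The
  substitution $t \mapsto t/l$ makes the width of the Gaussian independent of \<open>l\<close>, and the integral
  over \<open>l\<close> then produces the weight $1/(t^2+a^2)$.\<close>
lemma square_function_pointwise:
  assumes P: "integrable lborel P"
  shows "(\<integral>\<^sup>+t. ennreal ((norm (\<integral>s. P s * \<psi> (s / t) \<partial>lborel))\<^sup>2 / t ^ 3) * indicator {0<..} t \<partial>lborel)
    \<le> ennreal (25 * B\<^sup>2 * (\<integral>x. decay x \<partial>lborel)) *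
      (\<integral>\<^sup>+t. (\<integral>\<^sup>+a. ennreal ((norm (wavelet P a t))\<^sup>2 / (t\<^sup>2 * (t\<^sup>2 + a\<^sup>2))) * indicator {0<..} t \<partial>lborel) \<partial>lborel)"
proof -
  have [measurable]: "P \<in> borel_measurable borel" using P by auto
  note [measurable] = measurable_wavelet[of P]
  define C where "C = ennreal (25 * B\<^sup>2 * (\<integral>x. decay x \<partial>lborel))"
  define h where "h l t = (\<integral>\<^sup>+a. ennreal (decay (a / t) / (l\<^sup>2 * t ^ 4) * (norm (wavelet P a (l * t)))\<^sup>2) * (indicator {0<..1} l * indicator {0<..} t) \<partial>lborel)" for l t :: real
  have [measurable]: "(\<lambda>(l, t). h l t) \<in> borel_measurable (borel \<Otimes>\<^sub>M borel)" unfolding h_def by measurable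
  have "(\<integral>\<^sup>+t. ennreal ((norm (\<integral>s. P s * \<psi> (s / t) \<partial>lborel))\<^sup>2 / t ^ 3) * indicator {0<..} t \<partial>lborel)
     \<le> (\<integral>\<^sup>+t. C * (\<integral>\<^sup>+l. h l t \<partial>lborel) \<partial>lborel)"
  proof (rule nn_integral_mono)
    fix t :: real
    show "ennreal ((norm (\<integral>s. P s * \<psi> (s / t) \<partial>lborel))\<^sup>2 / t ^ 3) * indicator {0<..} t \<le> C * (\<integral>\<^sup>+l. h l t \<partial>lborel)"
    proof (cases "0 < t")
      case t: True
      have "ennreal ((norm (\<integral>s. P s * \<psi> (s / t) \<partial>lborel))\<^sup>2 / t ^ 3) = ennreal (1 / t ^ 3) * ennreal ((norm (\<integral>s. P s * \<psi> (s / t) \<partial>lborel))\<^sup>2)"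
        using t by (subst ennreal_mult[symmetric]) auto
      also have "\<dots> \<le> ennreal (1 / t ^ 3) * (C * (\<integral>\<^sup>+l. (\<integral>\<^sup>+a. ennreal (decay (a / t) / (l\<^sup>2 * t) * (norm (wavelet P a (l * t)))\<^sup>2) * indicator {0<..1} l \<partial>lborel) \<partial>lborel))"
        unfolding C_def by (intro mult_left_mono pairing_square_bound[OF P t]) auto
      also have "\<dots> = C * (\<integral>\<^sup>+l. (\<integral>\<^sup>+a. ennreal (1 / t ^ 3) * (ennreal (decay (a / t) / (l\<^sup>2 * t) * (norm (wavelet P a (l * t)))\<^sup>2) * indicator {0<..1} l) \<partial>lborel) \<partial>lborel)"
      proof -
        have "(\<integral>\<^sup>+a. ennreal (1 / t ^ 3) * (ennreal (decay (a / t) / (l\<^sup>2 * t) * (norm (wavelet P a (l * t)))\<^sup>2) * indicator {0<..1} l) \<partial>lborel)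
          = ennreal (1 / t ^ 3) * (\<integral>\<^sup>+a. ennreal (decay (a / t) / (l\<^sup>2 * t) * (norm (wavelet P a (l * t)))\<^sup>2) * indicator {0<..1} l \<partial>lborel)" for l
          by (rule nn_integral_cmult) measurable
        moreover have "(\<integral>\<^sup>+l. ennreal (1 / t ^ 3) * (\<integral>\<^sup>+a. ennreal (decay (a / t) / (l\<^sup>2 * t) * (norm (wavelet P a (l * t)))\<^sup>2) * indicator {0<..1} l \<partial>lborel) \<partial>lborel)
          = ennreal (1 / t ^ 3) * (\<integral>\<^sup>+l. (\<integral>\<^sup>+a. ennreal (decay (a / t) / (l\<^sup>2 * t) * (norm (wavelet P a (l * t)))\<^sup>2) * indicator {0<..1} l \<partial>lborel) \<partial>lborel)"
          by (rule nn_integral_cmult) measurable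
        ultimately show ?thesis by (simp only: mult.left_commute)
      qed
      also have "\<dots> = C * (\<integral>\<^sup>+l. h l t \<partial>lborel)"
      proof -
        have "ennreal (1 / t ^ 3) * (ennreal (decay (a / t) / (l\<^sup>2 * t) * (norm (wavelet P a (l * t)))\<^sup>2) * indicator {0<..1} l)
          = ennreal (decay (a / t) / (l\<^sup>2 * t ^ 4) * (norm (wavelet P a (l * t)))\<^sup>2) * (indicator {0<..1} l * indicator {0<..} t)" for l a
        proof -
          have "1 / t ^ 3 * (decay (a / t) / (l\<^sup>2 * t) * (norm (wavelet P a (l * t)))\<^sup>2) = decay (a / t) / (l\<^sup>2 * t ^ 4) * (norm (wavelet P a (l * t)))\<^sup>2"
            using t by (simp add: power3_eq_cube power4_eq_xxxx)
          from ennreal_mult_assoc_eq[OF _ _ this] show ?thesis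
            using t decay_pos[of "a / t"] by (simp add: less_imp_le)
        qed
        then show ?thesis by (simp add: h_def)
      qed
      finally show ?thesis using t by simp
    qed simp
  qed
  also have "\<dots> = C * (\<integral>\<^sup>+t. (\<integral>\<^sup>+l. h l t \<partial>lborel) \<partial>lborel)" by (simp add: nn_integral_cmult)
  also have "(\<integral>\<^sup>+t. (\<integral>\<^sup>+l. h l t \<partial>lborel) \<partial>lborel) = (\<integral>\<^sup>+l. (\<integral>\<^sup>+t. h l t \<partial>lborel) \<partial>lborel)"
    by (rule lborel_pair.Fubini') measurable
  also have "\<dots> = (\<integral>\<^sup>+l. (\<integral>\<^sup>+t. (\<integral>\<^sup>+a. ennreal (l * decay (l * (a / t)) * ((norm (wavelet P a t))\<^sup>2 / t ^ 4)) * (indicator {0<..1} l * indicator {0<..} t) \<partial>lborel) \<partial>lborel) \<partial>lborel)"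
  proof (rule nn_integral_cong)
    fix l :: real
    show "(\<integral>\<^sup>+t. h l t \<partial>lborel) = (\<integral>\<^sup>+t. (\<integral>\<^sup>+a. ennreal (l * decay (l * (a / t)) * ((norm (wavelet P a t))\<^sup>2 / t ^ 4)) * (indicator {0<..1} l * indicator {0<..} t) \<partial>lborel) \<partial>lborel)"
    proof (cases "l \<in> {0<..1}")
      case True
      then have l: "0 < l" by simp
      have "(\<integral>\<^sup>+t. h l t \<partial>lborel) = ennreal \<bar>1 / l\<bar> * (\<integral>\<^sup>+t. h l (0 + (1 / l) * t) \<partial>lborel)"
        using l by (intro nn_integral_real_affine) auto
      also have "\<dots> = (\<integral>\<^sup>+t. (\<integral>\<^sup>+a. ennreal (1 / l) * (ennreal (decay (a / (t / l)) / (l\<^sup>2 * (t / l) ^ 4) * (norm (wavelet P a (l * (t / l))))\<^sup>2) * (indicator {0<..1} l * indicator {0<..} (t / l))) \<partial>lborel) \<partial>lborel)"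
        unfolding h_def using l by (simp add: nn_integral_cmult)
      also have "\<dots> = (\<integral>\<^sup>+t. (\<integral>\<^sup>+a. ennreal (l * decay (l * (a / t)) * ((norm (wavelet P a t))\<^sup>2 / t ^ 4)) * (indicator {0<..1} l * indicator {0<..} t) \<partial>lborel) \<partial>lborel)"
      proof (intro nn_integral_cong)
        fix t a :: real
        show "ennreal (1 / l) * (ennreal (decay (a / (t / l)) / (l\<^sup>2 * (t / l) ^ 4) * (norm (wavelet P a (l * (t / l))))\<^sup>2) * (indicator {0<..1} l * indicator {0<..} (t / l)))
          = ennreal (l * decay (l * (a / t)) * ((norm (wavelet P a t))\<^sup>2 / t ^ 4)) * (indicator {0<..1} l * indicator {0<..} t)"
        proof (cases "0 < t")
          case t: True
          have e: "a / (t / l) = l * (a / t)" "l * (t / l) = t" using l t by auto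
          have "1 / l * (decay (l * (a / t)) / (l\<^sup>2 * (t / l) ^ 4) * (norm (wavelet P a t))\<^sup>2) = l * decay (l * (a / t)) * ((norm (wavelet P a t))\<^sup>2 / t ^ 4)"
            using l t by (simp add: power_divide power2_eq_square power4_eq_xxxx mult_ac)
          then show ?thesis
            unfolding e using t l decay_pos[of "l * (a / t)"]
            by (subst ennreal_mult_assoc_eq) (auto simp: less_imp_le)
        next
          case False
          then show ?thesis using l by (simp add: zero_less_divide_iff)
        qed
      qed
      finally show ?thesis .
    qed (simp add: h_def)
  qed
  also have "\<dots> = (\<integral>\<^sup>+t. (\<integral>\<^sup>+l. (\<integral>\<^sup>+a. ennreal (l * decay (l * (a / t)) * ((norm (wavelet P a t))\<^sup>2 / t ^ 4)) * (indicator {0<..1} l * indicator {0<..} t) \<partial>lborel) \<partial>lborel) \<partial>lborel)"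
    by (rule lborel_pair.Fubini') measurable
  also have "\<dots> = (\<integral>\<^sup>+t. (\<integral>\<^sup>+a. (\<integral>\<^sup>+l. ennreal (l * decay (l * (a / t)) * ((norm (wavelet P a t))\<^sup>2 / t ^ 4)) * (indicator {0<..1} l * indicator {0<..} t) \<partial>lborel) \<partial>lborel) \<partial>lborel)"
    by (intro nn_integral_cong lborel_pair.Fubini') measurable
  also have "\<dots> \<le> (\<integral>\<^sup>+t. (\<integral>\<^sup>+a. ennreal ((norm (wavelet P a t))\<^sup>2 / (t\<^sup>2 * (t\<^sup>2 + a\<^sup>2))) * indicator {0<..} t \<partial>lborel) \<partial>lborel)"
  proof (intro nn_integral_mono)
    fix t a :: real
    show "(\<integral>\<^sup>+l. ennreal (l * decay (l * (a / t)) * ((norm (wavelet P a t))\<^sup>2 / t ^ 4)) * (indicator {0<..1} l * indicator {0<..} t) \<partial>lborel)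
       \<le> ennreal ((norm (wavelet P a t))\<^sup>2 / (t\<^sup>2 * (t\<^sup>2 + a\<^sup>2))) * indicator {0<..} t"
    proof (cases "0 < t")
      case t: True
      have "(\<integral>\<^sup>+l. ennreal (l * decay (l * (a / t)) * ((norm (wavelet P a t))\<^sup>2 / t ^ 4)) * (indicator {0<..1} l * indicator {0<..} t) \<partial>lborel)
        \<le> (\<integral>\<^sup>+l. (ennreal (l * decay (l * (a / t))) * indicator {0..1} l) * ennreal ((norm (wavelet P a t))\<^sup>2 / t ^ 4) \<partial>lborel)"
      proof (rule nn_integral_mono)
        fix l :: real
        show "ennreal (l * decay (l * (a / t)) * ((norm (wavelet P a t))\<^sup>2 / t ^ 4)) * (indicator {0<..1} l * indicator {0<..} t)
          \<le> (ennreal (l * decay (l * (a / t))) * indicator {0..1} l) * ennreal ((norm (wavelet P a t))\<^sup>2 / t ^ 4)"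
          using t decay_pos[of "l * (a / t)"] by (auto simp: indicator_def ennreal_mult[symmetric])
      qed
      also have "\<dots> = ennreal (1 / (2 * (1 + (a / t)\<^sup>2))) * ennreal ((norm (wavelet P a t))\<^sup>2 / t ^ 4)"
        by (subst nn_integral_multc, measurable) (simp only: nn_integral_scaled_decay)
      also have "\<dots> = ennreal (1 / (2 * (1 + (a / t)\<^sup>2)) * ((norm (wavelet P a t))\<^sup>2 / t ^ 4))"
        by (subst ennreal_mult) (auto simp: add_nonneg_nonneg)
      also have "\<dots> \<le> ennreal ((norm (wavelet P a t))\<^sup>2 / (t\<^sup>2 * (t\<^sup>2 + a\<^sup>2)))"
      proof (rule ennreal_leI)
        have "1 / (2 * (1 + (a / t)\<^sup>2)) * ((norm (wavelet P a t))\<^sup>2 / t ^ 4) = ((norm (wavelet P a t))\<^sup>2 / (t\<^sup>2 * (t\<^sup>2 + a\<^sup>2))) / 2"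
        proof -
          have "1 + (a / t)\<^sup>2 = (t\<^sup>2 + a\<^sup>2) / t\<^sup>2" using t by (simp add: power_divide add_divide_distrib)
          then show ?thesis using t by (simp add: power2_eq_square power4_eq_xxxx)
        qed
        also have "\<dots> \<le> (norm (wavelet P a t))\<^sup>2 / (t\<^sup>2 * (t\<^sup>2 + a\<^sup>2))"
        proof -
          have "x / 2 \<le> x" if "0 \<le> x" for x :: real using that by simp
          note * = this
          show ?thesis by (rule *) simp
        qed
        finally show "1 / (2 * (1 + (a / t)\<^sup>2)) * ((norm (wavelet P a t))\<^sup>2 / t ^ 4) \<le> (norm (wavelet P a t))\<^sup>2 / (t\<^sup>2 * (t\<^sup>2 + a\<^sup>2))" .
      qed
      finally show ?thesis using t by simp
    qed simp
  qed
  finally show ?thesis unfolding C_def by (simp add: mult_left_mono)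
qed

end

section \<open>From Gaussian weights to Poisson weights\<close>

lemma measurable_compose2:
  assumes k: "(\<lambda>(x, y). k x y) \<in> measurable (A \<Otimes>\<^sub>M B) N"
    and [measurable]: "x \<in> measurable M A" "y \<in> measurable M B"
  shows "(\<lambda>w. k (x w) (y w)) \<in> measurable M N"
proof -
  have "(\<lambda>w. (x w, y w)) \<in> measurable M (A \<Otimes>\<^sub>M B)" by measurable
  from measurable_compose[OF this k] show ?thesis by simp
qed

lemma measurable_compose3:
  assumes k: "(\<lambda>(x, y, z). k x y z) \<in> measurable (A \<Otimes>\<^sub>M B \<Otimes>\<^sub>M C) N"
    and [measurable]: "x \<in> measurable M A" "y \<in> measurable M B" "z \<in> measurable M C"
  shows "(\<lambda>w. k (x w) (y w) (z w)) \<in> measurable M N"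
proof -
  have "(\<lambda>w. (x w, y w, z w)) \<in> measurable M (A \<Otimes>\<^sub>M B \<Otimes>\<^sub>M C)" by measurable
  from measurable_compose[OF this k] show ?thesis by simp
qed

lemma nn_integral_greaterThan_le:
  fixes f :: "real \<Rightarrow> ennreal"
  assumes [measurable]: "f \<in> borel_measurable borel"
    and le: "\<And>\<epsilon> T. 0 < \<epsilon> \<Longrightarrow> \<epsilon> \<le> T \<Longrightarrow> (\<integral>\<^sup>+t. f t * indicator {\<epsilon>..T} t \<partial>lborel) \<le> B"
  shows "(\<integral>\<^sup>+t. f t * indicator {0<..} t \<partial>lborel) \<le> B"
proof -
  define u where "u n t = f t * indicator {1 / real (Suc n)..real (Suc n)} t" for n t
  have inc: "incseq u"
  proof (rule incseq_SucI, rule le_funI)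
    fix n t
    have "1 / real (Suc (Suc n)) \<le> 1 / real (Suc n)" by (simp add: frac_le)
    then show "u n t \<le> u (Suc n) t" by (auto simp: u_def indicator_def)
  qed
  have "(SUP n. u n t) = f t * indicator {0<..} t" for t
  proof (cases "0 < t")
    case True
    obtain n1 where n1: "t < real n1" using reals_Archimedean2 by blast
    obtain n2 where n2: "1 / t < real n2" using reals_Archimedean2 by blast
    define n where "n = max n1 n2"
    have "t \<le> real (Suc n)" using n1 by (simp add: n_def)
    moreover have "1 / real (Suc n) \<le> t"
    proof -
      have "1 / t \<le> real (Suc n)" using n2 by (simp add: n_def)
      then show ?thesis using True by (simp add: field_simps)
    qed
    ultimately have "u n t = f t" by (simp add: u_def)
    then have "f t \<le> (SUP n. u n t)" by (metis SUP_upper UNIV_I)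
    moreover have "(SUP n. u n t) \<le> f t" by (rule SUP_least) (auto simp: u_def indicator_def)
    ultimately show ?thesis using True by simp
  next
    case False
    have "u n t = 0" for n
    proof -
      have "0 < 1 / real (Suc n)" by simp
      then have "t \<notin> {1 / real (Suc n)..real (Suc n)}" using False unfolding atLeastAtMost_iff by linarith
      then show ?thesis by (simp add: u_def)
    qed
    then show ?thesis using False by simp
  qed
  then have "(\<integral>\<^sup>+t. f t * indicator {0<..} t \<partial>lborel) = (\<integral>\<^sup>+t. (SUP n. u n t) \<partial>lborel)" by simp
  also have "\<dots> = (SUP n. (\<integral>\<^sup>+t. u n t \<partial>lborel))"
    by (rule nn_integral_monotone_convergence_SUP[OF inc]) (simp add: u_def[abs_def])
  also have "\<dots> \<le> B"
  proof (rule SUP_least)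
    fix n
    have "1 / real (Suc n) \<le> 1" by simp
    also have "\<dots> \<le> real (Suc n)" by simp
    finally show "(\<integral>\<^sup>+t. u n t \<partial>lborel) \<le> B" unfolding u_def by (intro le) auto
  qed
  finally show ?thesis .
qed

lemma measurable_transform:
  assumes "test_fun F" "test_fun H"
    and "t \<in> borel_measurable M" "a \<in> borel_measurable M" "q \<in> measurable M plane"
  shows "(\<lambda>x. transform F H (t x) (a x) (q x)) \<in> borel_measurable M"
proof (rule measurable_compose3[OF _ assms(3-5)])
  note [measurable] = assms(1,2)[THEN test_fun_measurable]
  show "(\<lambda>(t, a, q). transform F H t a q) \<in> borel_measurable (borel \<Otimes>\<^sub>M borel \<Otimes>\<^sub>M plane)"
    unfolding transform_def by measurable
qed

text \<open>Poisson weights are superpositions of Gaussian weights.\<close>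
lemma nn_integral_gaussian_mixture:
  assumes "0 < (c :: real)"
  shows "(\<integral>\<^sup>+v. ennreal (2 * v * exp (- v\<^sup>2 * c)) * indicator {0..} v \<partial>lborel) = ennreal (1 / c)"
proof -
  have "(\<integral>\<^sup>+v. ennreal (2 * v * exp (- v\<^sup>2 * c)) * indicator {0..} v \<partial>lborel) = ennreal (0 - (- exp (- 0\<^sup>2 * c) / c))"
  proof (rule nn_integral_FTC_atLeast[where F = "\<lambda>v. - exp (- v\<^sup>2 * c) / c"])
    show "((\<lambda>v. - exp (- v\<^sup>2 * c) / c) has_real_derivative 2 * v * exp (- v\<^sup>2 * c)) (at v)" for v
      using assms by (auto intro!: derivative_eq_intros)
    show "((\<lambda>v. - exp (- v\<^sup>2 * c) / c) \<longlongrightarrow> 0) at_top" using assms by real_asymp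
  qed auto
  then show ?thesis by simp
qed

text \<open>Write the Poisson weight as a superposition of the Gaussian weights with parameter \<open>\<mu> = v\<^sup>2\<close>. The
  bound for each of them grows like \<open>1 / v\<close> as \<open>v\<close> tends to zero, which the factor \<open>v\<close> of the
  superposition compensates.\<close>
lemma transform_energy_total:
  assumes F: "test_fun F" and H: "test_fun H"
  shows "(\<integral>\<^sup>+t. (\<integral>\<^sup>+a. (\<integral>\<^sup>+q. ennreal ((transform F H t a q)\<^sup>2 / (t\<^sup>2 * (t\<^sup>2 + a\<^sup>2))) * indicator {0<..} t \<partial>plane) \<partial>lborel) \<partial>lborel)
     \<le> ennreal (3 / 2 * pi\<^sup>2 * (fourth_moment F + fourth_moment H))"
proof -
  define E where "E = fourth_moment F + fourth_moment H"
  have E0: "0 \<le> E" using fourth_moment_nonneg by (simp add: E_def)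
  note [measurable (raw)] = measurable_transform[OF F H]
  define W where "W v t = (\<integral>\<^sup>+a. (\<integral>\<^sup>+q. ennreal (exp (- v\<^sup>2 * a\<^sup>2 / t\<^sup>2) * (transform F H t a q)\<^sup>2) \<partial>plane) \<partial>lborel)" for v t
  have Wm [measurable]: "(\<lambda>(v, t). W v t) \<in> borel_measurable (lborel \<Otimes>\<^sub>M lborel)"
    unfolding W_def by measurable
  have Wb: "(\<integral>\<^sup>+t. W v t * ennreal (1 / t ^ 4) * indicator {0<..} t \<partial>lborel) \<le> ennreal (3 / 4 * pi * sqrt pi / v * E)" if v: "0 < v" for v
  proof (rule nn_integral_greaterThan_le)
    fix \<epsilon> T :: real assume eT: "0 < \<epsilon>" "\<epsilon> \<le> T"
    have v2: "0 < v\<^sup>2" using v by simp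
    have "sqrt (pi / v\<^sup>2) = sqrt pi / v" using v by (simp add: real_sqrt_divide)
    then show "(\<integral>\<^sup>+t. W v t * ennreal (1 / t ^ 4) * indicator {\<epsilon>..T} t \<partial>lborel) \<le> ennreal (3 / 4 * pi * sqrt pi / v * E)"
      using transform_energy_truncated[OF F H v2 eT] unfolding W_def E_def by simp
  qed measurable
  define k where "k v t a q = ennreal (2 * v * exp (- v\<^sup>2)) * indicator {0..} v *
     (ennreal (exp (- v\<^sup>2 * a\<^sup>2 / t\<^sup>2) * (transform F H t a q)\<^sup>2) * ennreal (1 / t ^ 4) * indicator {0<..} t)" for v t a q
  have km [measurable]: "(\<lambda>(v, t, a, q). k v t a q) \<in> borel_measurable (lborel \<Otimes>\<^sub>M lborel \<Otimes>\<^sub>M lborel \<Otimes>\<^sub>M plane)"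
    unfolding k_def by measurable
  \<comment> \<open>The factor \<open>exp (- v\<^sup>2)\<close> comes from \<open>1 + a\<^sup>2 / t\<^sup>2\<close> in the exponent and makes the integral over \<open>v\<close> converge at infinity.\<close>
  have mix: "ennreal ((transform F H t a q)\<^sup>2 / (t\<^sup>2 * (t\<^sup>2 + a\<^sup>2))) * indicator {0<..} t = (\<integral>\<^sup>+v. k v t a q \<partial>lborel)" for t a q
  proof (cases "0 < t")
    case t: True
    define c where "c = 1 + a\<^sup>2 / t\<^sup>2"
    have c: "0 < c" by (simp add: c_def add_pos_nonneg)
    have "k v t a q = (ennreal (2 * v * exp (- v\<^sup>2 * c)) * indicator {0..} v) * ennreal ((transform F H t a q)\<^sup>2 / t ^ 4)" for v
    proof (cases "0 \<le> v")
      case v: True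
      have "2 * v * exp (- v\<^sup>2) * (exp (- v\<^sup>2 * a\<^sup>2 / t\<^sup>2) * (transform F H t a q)\<^sup>2 * (1 / t ^ 4))
        = (2 * v * exp (- v\<^sup>2 * c)) * ((transform F H t a q)\<^sup>2 / t ^ 4)"
      proof -
        have "exp (- v\<^sup>2 * c) = exp (- v\<^sup>2) * exp (- v\<^sup>2 * a\<^sup>2 / t\<^sup>2)"
          unfolding exp_add[symmetric] c_def by (simp add: algebra_simps)
        then show ?thesis by simp
      qed
      then show ?thesis
        using v t unfolding k_def by (simp add: ennreal_mult[symmetric])
    qed (simp add: k_def)
    then have "(\<integral>\<^sup>+v. k v t a q \<partial>lborel) = ennreal (1 / c) * ennreal ((transform F H t a q)\<^sup>2 / t ^ 4)"
      using nn_integral_gaussian_mixture[OF c] by (simp add: nn_integral_multc)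
    also have "\<dots> = ennreal ((transform F H t a q)\<^sup>2 / (t\<^sup>2 * (t\<^sup>2 + a\<^sup>2)))"
    proof -
      have "c = (t\<^sup>2 + a\<^sup>2) / t\<^sup>2" using t by (simp add: c_def add_divide_distrib)
      then have "1 / c * ((transform F H t a q)\<^sup>2 / t ^ 4) = (transform F H t a q)\<^sup>2 / (t\<^sup>2 * (t\<^sup>2 + a\<^sup>2))"
        using t by (simp add: power2_eq_square power4_eq_xxxx)
      then show ?thesis using c by (simp add: ennreal_mult[symmetric])
    qed
    finally show ?thesis using t by simp
  qed (simp add: k_def)
  have "(\<integral>\<^sup>+t. (\<integral>\<^sup>+a. (\<integral>\<^sup>+q. (\<integral>\<^sup>+v. k v t a q \<partial>lborel) \<partial>plane) \<partial>lborel) \<partial>lborel)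
    = (\<integral>\<^sup>+t. (\<integral>\<^sup>+a. (\<integral>\<^sup>+v. (\<integral>\<^sup>+q. k v t a q \<partial>plane) \<partial>lborel) \<partial>lborel) \<partial>lborel)"
  proof (intro nn_integral_cong)
    fix t a :: real
    interpret V: pair_sigma_finite lborel plane by unfold_locales
    show "(\<integral>\<^sup>+q. (\<integral>\<^sup>+v. k v t a q \<partial>lborel) \<partial>plane) = (\<integral>\<^sup>+v. (\<integral>\<^sup>+q. k v t a q \<partial>plane) \<partial>lborel)"
      by (rule V.Fubini') (unfold k_def, measurable)
  qed
  also have "\<dots> = (\<integral>\<^sup>+t. (\<integral>\<^sup>+v. (\<integral>\<^sup>+a. (\<integral>\<^sup>+q. k v t a q \<partial>plane) \<partial>lborel) \<partial>lborel) \<partial>lborel)"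
    by (rule nn_integral_cong, rule lborel_pair.Fubini') (unfold k_def, measurable)
  also have "\<dots> = (\<integral>\<^sup>+v. (\<integral>\<^sup>+t. (\<integral>\<^sup>+a. (\<integral>\<^sup>+q. k v t a q \<partial>plane) \<partial>lborel) \<partial>lborel) \<partial>lborel)"
    by (rule lborel_pair.Fubini') (unfold k_def, measurable)
  also have "\<dots> = (\<integral>\<^sup>+v. ennreal (2 * v * exp (- v\<^sup>2)) * indicator {0..} v * (\<integral>\<^sup>+t. W v t * ennreal (1 / t ^ 4) * indicator {0<..} t \<partial>lborel) \<partial>lborel)"
    unfolding k_def W_def by (simp add: nn_integral_cmult nn_integral_multc)
  also have "\<dots> \<le> (\<integral>\<^sup>+v. ennreal (3 / 2 * pi * sqrt pi * E) * ennreal (exp (- 1 * (0 + 1 * v)\<^sup>2)) \<partial>lborel)"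
  proof (rule nn_integral_mono)
    fix v :: real
    show "ennreal (2 * v * exp (- v\<^sup>2)) * indicator {0..} v * (\<integral>\<^sup>+t. W v t * ennreal (1 / t ^ 4) * indicator {0<..} t \<partial>lborel)
      \<le> ennreal (3 / 2 * pi * sqrt pi * E) * ennreal (exp (- 1 * (0 + 1 * v)\<^sup>2))"
    proof (cases "0 < v")
      case v: True
      have "ennreal (2 * v * exp (- v\<^sup>2)) * indicator {0..} v * (\<integral>\<^sup>+t. W v t * ennreal (1 / t ^ 4) * indicator {0<..} t \<partial>lborel)
         \<le> ennreal (2 * v * exp (- v\<^sup>2)) * ennreal (3 / 4 * pi * sqrt pi / v * E)"
        using v Wb[OF v] by (simp add: mult_left_mono)
      also have "\<dots> = ennreal (2 * v * exp (- v\<^sup>2) * (3 / 4 * pi * sqrt pi / v * E))"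
        by (rule ennreal_mult[symmetric]) (use v E0 in auto)
      also have "2 * v * exp (- v\<^sup>2) * (3 / 4 * pi * sqrt pi / v * E) = 3 / 2 * pi * sqrt pi * E * exp (- v\<^sup>2)"
        using v by simp
      also have "ennreal \<dots> = ennreal (3 / 2 * pi * sqrt pi * E) * ennreal (exp (- v\<^sup>2))"
        by (rule ennreal_mult) (use E0 in auto)
      finally show ?thesis by simp
    next
      case False
      then show ?thesis by (cases "v = 0") auto
    qed
  qed
  also have "\<dots> = ennreal (3 / 2 * pi * sqrt pi * E) * ennreal (sqrt (pi / 1))"
    by (subst nn_integral_cmult, measurable) (subst nn_integral_gaussian, auto)
  also have "\<dots> = ennreal (3 / 2 * pi\<^sup>2 * E)"
    using E0 by (subst ennreal_mult[symmetric]) (auto simp: power2_eq_square)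
  finally show ?thesis unfolding mix E_def .
qed

text \<open>Area-preserving changes of variables that align both functions along the common variable
  \<open>z = x + y + s\<close>.\<close>
definition shear1 :: "(real \<times> real \<Rightarrow> real) \<Rightarrow> real \<times> real \<Rightarrow> real" where
  "shear1 F = (\<lambda>(z, y). F (z - y, y))"

definition shear2 :: "(real \<times> real \<Rightarrow> real) \<Rightarrow> real \<times> real \<Rightarrow> real" where
  "shear2 G = (\<lambda>(z, x). G (x, z - x))"

lemma test_fun_shear:
  assumes "test_fun F" shows "test_fun (shear1 F)" "test_fun (shear2 F)"
proof -
  obtain B R where B: "0 \<le> B" "\<forall>p. \<bar>F p\<bar> \<le> B" "\<forall>x y. F (x, y) \<noteq> 0 \<longrightarrow> \<bar>x\<bar> \<le> R \<and> \<bar>y\<bar> \<le> R"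
    using test_fun_bounds[OF assms] by blast
  note [measurable] = test_fun_measurable[OF assms]
  have "shear1 F \<in> borel_measurable plane" "shear2 F \<in> borel_measurable plane"
    unfolding shear1_def shear2_def by measurable
  moreover have "\<forall>p. \<bar>shear1 F p\<bar> \<le> B" "\<forall>p. \<bar>shear2 F p\<bar> \<le> B"
    using B(2) by (auto simp: shear1_def shear2_def)
  moreover have "\<bar>z\<bar> \<le> 2 * R \<and> \<bar>y\<bar> \<le> 2 * R" if "shear1 F (z, y) \<noteq> 0" for z y
  proof -
    have "\<bar>z - y\<bar> \<le> R" "\<bar>y\<bar> \<le> R" using that B(3)[rule_format, of "z - y" y] by (auto simp: shear1_def)
    then show ?thesis by linarith
  qed
  moreover have "\<bar>z\<bar> \<le> 2 * R \<and> \<bar>x\<bar> \<le> 2 * R" if "shear2 F (z, x) \<noteq> 0" for z x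
  proof -
    have "\<bar>z - x\<bar> \<le> R" "\<bar>x\<bar> \<le> R" using that B(3)[rule_format, of x "z - x"] by (auto simp: shear2_def)
    then show ?thesis by linarith
  qed
  ultimately show "test_fun (shear1 F)" "test_fun (shear2 F)" unfolding test_fun_def by blast+
qed

lemma nn_integral_translate:
  fixes f :: "real \<Rightarrow> ennreal"
  assumes "f \<in> borel_measurable borel"
  shows "(\<integral>\<^sup>+z. f (c + z) \<partial>lborel) = (\<integral>\<^sup>+z. f z \<partial>lborel)"
  using nn_integral_real_affine[OF assms, of 1 c] by simp

lemma nn_integral_plane_swap:
  assumes [measurable]: "f \<in> borel_measurable plane"
  shows "(\<integral>\<^sup>+p. f p \<partial>plane) = (\<integral>\<^sup>+x. (\<integral>\<^sup>+y. f (x, y) \<partial>lborel) \<partial>lborel)"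
    and "(\<integral>\<^sup>+p. f p \<partial>plane) = (\<integral>\<^sup>+y. (\<integral>\<^sup>+x. f (x, y) \<partial>lborel) \<partial>lborel)"
proof -
  show a: "(\<integral>\<^sup>+p. f p \<partial>plane) = (\<integral>\<^sup>+x. (\<integral>\<^sup>+y. f (x, y) \<partial>lborel) \<partial>lborel)"
    by (rule lborel.nn_integral_fst[symmetric]) measurable
  show "(\<integral>\<^sup>+p. f p \<partial>plane) = (\<integral>\<^sup>+y. (\<integral>\<^sup>+x. f (x, y) \<partial>lborel) \<partial>lborel)"
    unfolding a by (rule lborel_pair.Fubini') measurable
qed

lemma fourth_moment_shear:
  assumes "test_fun F" shows "fourth_moment (shear1 F) = fourth_moment F" "fourth_moment (shear2 F) = fourth_moment F"
proof -
  note [measurable] = test_fun_measurable[OF assms] test_fun_shear[OF assms, THEN test_fun_measurable]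
  have e: "ennreal (fourth_moment G) = (\<integral>\<^sup>+p. ennreal (G p ^ 4) \<partial>plane)" if "test_fun G" for G
    unfolding fourth_moment_def using nn_integral_eq_integral[OF test_fun_integrable_power4[OF that]] by simp
  have "ennreal (fourth_moment (shear1 F)) = (\<integral>\<^sup>+y. (\<integral>\<^sup>+z. ennreal (F (- y + z, y) ^ 4) \<partial>lborel) \<partial>lborel)"
    unfolding e[OF test_fun_shear(1)[OF assms]] by (subst nn_integral_plane_swap(2)) (auto simp: shear1_def)
  also have "\<dots> = (\<integral>\<^sup>+y. (\<integral>\<^sup>+z. ennreal (F (z, y) ^ 4) \<partial>lborel) \<partial>lborel)"
    by (intro nn_integral_cong nn_integral_translate) measurable
  also have "\<dots> = ennreal (fourth_moment F)"
    unfolding e[OF assms] by (subst nn_integral_plane_swap(2)) auto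
  finally show "fourth_moment (shear1 F) = fourth_moment F" using fourth_moment_nonneg by simp
  have "ennreal (fourth_moment (shear2 F)) = (\<integral>\<^sup>+x. (\<integral>\<^sup>+z. ennreal (F (x, - x + z) ^ 4) \<partial>lborel) \<partial>lborel)"
    unfolding e[OF test_fun_shear(2)[OF assms]] by (subst nn_integral_plane_swap(2)) (auto simp: shear2_def)
  also have "\<dots> = (\<integral>\<^sup>+x. (\<integral>\<^sup>+z. ennreal (F (x, z) ^ 4) \<partial>lborel) \<partial>lborel)"
    by (intro nn_integral_cong nn_integral_translate) measurable
  also have "\<dots> = ennreal (fourth_moment F)"
    unfolding e[OF assms] by (subst nn_integral_plane_swap(1)) auto
  finally show "fourth_moment (shear2 F) = fourth_moment F" using fourth_moment_nonneg by simp
qed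

definition line_integral where
  "line_integral F G t a x y = (\<integral>s. F (x + s, y) * G (x, y + s) * hermite ((s - a) / t) \<partial>lborel)" for F G :: "real \<times> real \<Rightarrow> real"

lemma line_integral_eq_transform:
  "line_integral F G t a x y = transform (shear1 F) (shear2 G) t a (y, x)"
proof -
  have "transform (shear1 F) (shear2 G) t a (y, x) = (\<integral>z. F (z - y, y) * G (x, z - x) * hermite ((z - y - x - a) / t) \<partial>lborel)"
    by (simp add: transform_def shear1_def shear2_def)
  also have "\<dots> = (\<integral>s. F ((x + y + s) - y, y) * G (x, (x + y + s) - x) * hermite (((x + y + s) - y - x - a) / t) \<partial>lborel)"
    using integral_affine[of 1 "\<lambda>z. F (z - y, y) * G (x, z - x) * hermite ((z - y - x - a) / t)" "x + y"] by simp
  finally show ?thesis by (simp add: line_integral_def)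
qed

lemma line_integral_energy:
  assumes F: "test_fun F" and G: "test_fun G"
  shows "(\<integral>\<^sup>+q. (\<integral>\<^sup>+t. (\<integral>\<^sup>+a. ennreal ((line_integral F G t a (fst q) (snd q))\<^sup>2 / (t\<^sup>2 * (t\<^sup>2 + a\<^sup>2))) * indicator {0<..} t \<partial>lborel) \<partial>lborel) \<partial>plane)
     \<le> ennreal (3 / 2 * pi\<^sup>2 * (fourth_moment F + fourth_moment G))"
proof -
  note nF = test_fun_shear(1)[OF F] and nG = test_fun_shear(2)[OF G]
  note [measurable (raw)] = measurable_transform[OF nF nG]
  define k where "k q t a = ennreal ((transform (shear1 F) (shear2 G) t a q)\<^sup>2 / (t\<^sup>2 * (t\<^sup>2 + a\<^sup>2))) * indicator {0<..} t" for q t a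
  have [measurable]: "(\<lambda>(q, t, a). k q t a) \<in> borel_measurable (plane \<Otimes>\<^sub>M lborel \<Otimes>\<^sub>M lborel)" unfolding k_def by measurable
  have "(\<integral>\<^sup>+q. (\<integral>\<^sup>+t. (\<integral>\<^sup>+a. k (snd q, fst q) t a \<partial>lborel) \<partial>lborel) \<partial>plane) = (\<integral>\<^sup>+q. (\<integral>\<^sup>+t. (\<integral>\<^sup>+a. k q t a \<partial>lborel) \<partial>lborel) \<partial>plane)"
  proof -
    have "(\<lambda>q. \<integral>\<^sup>+t. (\<integral>\<^sup>+a. k (snd q, fst q) t a \<partial>lborel) \<partial>lborel) \<in> borel_measurable plane"
      "(\<lambda>q. \<integral>\<^sup>+t. (\<integral>\<^sup>+a. k q t a \<partial>lborel) \<partial>lborel) \<in> borel_measurable plane"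
      unfolding k_def by measurable
    then show ?thesis by (simp add: nn_integral_plane_swap(1)[of "\<lambda>q. \<integral>\<^sup>+t. (\<integral>\<^sup>+a. k (snd q, fst q) t a \<partial>lborel) \<partial>lborel"]
        nn_integral_plane_swap(2)[of "\<lambda>q. \<integral>\<^sup>+t. (\<integral>\<^sup>+a. k q t a \<partial>lborel) \<partial>lborel"])
  qed
  also have "\<dots> = (\<integral>\<^sup>+t. (\<integral>\<^sup>+q. (\<integral>\<^sup>+a. k q t a \<partial>lborel) \<partial>plane) \<partial>lborel)"
  proof -
    interpret V: pair_sigma_finite plane lborel by unfold_locales
    show ?thesis by (rule V.Fubini'[symmetric]) (unfold k_def, measurable)
  qed
  also have "\<dots> = (\<integral>\<^sup>+t. (\<integral>\<^sup>+a. (\<integral>\<^sup>+q. k q t a \<partial>plane) \<partial>lborel) \<partial>lborel)"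
  proof (rule nn_integral_cong)
    fix t :: real
    interpret V: pair_sigma_finite plane lborel by unfold_locales
    show "(\<integral>\<^sup>+q. (\<integral>\<^sup>+a. k q t a \<partial>lborel) \<partial>plane) = (\<integral>\<^sup>+a. (\<integral>\<^sup>+q. k q t a \<partial>plane) \<partial>lborel)"
      by (rule V.Fubini'[symmetric]) (unfold k_def, measurable)
  qed
  also have "\<dots> \<le> ennreal (3 / 2 * pi\<^sup>2 * (fourth_moment F + fourth_moment G))"
    unfolding k_def using transform_energy_total[OF nF nG] by (simp add: fourth_moment_shear F G)
  finally show ?thesis
    unfolding k_def line_integral_eq_transform by simp
qed

section \<open>The square function on $L^4$\<close>

lemma nn_integral_linear4:
  assumes [measurable]: "f1 \<in> borel_measurable M" "f2 \<in> borel_measurable M" "f3 \<in> borel_measurable M" "f4 \<in> borel_measurable M"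
  shows "(\<integral>\<^sup>+x. 2 * f1 x + 2 * f2 x + 2 * f3 x + 2 * f4 x \<partial>M) = 2 * (\<integral>\<^sup>+x. f1 x \<partial>M) + 2 * (\<integral>\<^sup>+x. f2 x \<partial>M) + 2 * (\<integral>\<^sup>+x. f3 x \<partial>M) + 2 * (\<integral>\<^sup>+x. f4 x \<partial>M)"
  by (simp add: nn_integral_add nn_integral_cmult)

definition fiber :: "(real \<times> real \<Rightarrow> complex) \<Rightarrow> (real \<times> real \<Rightarrow> complex) \<Rightarrow> real \<times> real \<Rightarrow> real \<Rightarrow> complex" where
  "fiber F G q s = F (fst q + s, snd q) * G (fst q, snd q + s)"

lemma measurable_fiber:
  assumes [measurable]: "F \<in> borel_measurable plane" "G \<in> borel_measurable plane"
    and "q \<in> measurable M plane" "s \<in> borel_measurable M"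
  shows "(\<lambda>x. fiber F G (q x) (s x)) \<in> borel_measurable M"
proof (rule measurable_compose2[OF _ assms(3,4)])
  show "(\<lambda>(q, s). fiber F G q s) \<in> borel_measurable (plane \<Otimes>\<^sub>M borel)"
    unfolding fiber_def by measurable
qed

text \<open>The fourth power of the $L^4$ norm.\<close>
definition quartic :: "(real \<times> real \<Rightarrow> complex) \<Rightarrow> ennreal" where
  "quartic F = (\<integral>\<^sup>+p. ennreal (norm (F p) ^ 4) \<partial>plane)"

lemma test_fun_integrable_line:
  assumes F: "test_fun F" and G: "test_fun G"
  shows "integrable lborel (\<lambda>s. F (x + s, y) * G (x, y + s))"
  using integrable_affine[OF test_fun_integrable_column[OF test_fun_shear(1)[OF F] test_fun_shear(2)[OF G], of y x], of 1 "x + y"]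
  by (simp add: shear1_def shear2_def)

definition complex_test_fun :: "(real \<times> real \<Rightarrow> complex) \<Rightarrow> bool" where
  "complex_test_fun F \<longleftrightarrow> test_fun (\<lambda>p. Re (F p)) \<and> test_fun (\<lambda>p. Im (F p))"

lemma complex_test_fun_measurable: "complex_test_fun F \<Longrightarrow> F \<in> borel_measurable plane"
  unfolding complex_test_fun_def by (subst borel_measurable_complex_iff) (auto dest: test_fun_measurable)

lemma fiber_decompose:
  "fiber F G q s = Complex
    (Re (F (fst q + s, snd q)) * Re (G (fst q, snd q + s)) - Im (F (fst q + s, snd q)) * Im (G (fst q, snd q + s)))
    (Re (F (fst q + s, snd q)) * Im (G (fst q, snd q + s)) + Im (F (fst q + s, snd q)) * Re (G (fst q, snd q + s)))"
  by (simp add: fiber_def complex_eq_iff)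

lemma integrable_fiber:
  assumes "complex_test_fun F" "complex_test_fun G"
  shows "integrable lborel (fiber F G q)"
proof -
  have n: "test_fun (\<lambda>p. Re (F p))" "test_fun (\<lambda>p. Im (F p))" "test_fun (\<lambda>p. Re (G p))" "test_fun (\<lambda>p. Im (G p))"
    using assms by (auto simp: complex_test_fun_def)
  have "integrable lborel (\<lambda>s. of_real (Re (fiber F G q s)) + \<i> * of_real (Im (fiber F G q s)))"
    unfolding fiber_decompose complex.sel
    by (intro Bochner_Integration.integrable_add integrable_mult_right integrable_of_real Bochner_Integration.integrable_diff
        test_fun_integrable_line[OF n(1) n(3)] test_fun_integrable_line[OF n(2) n(4)]
        test_fun_integrable_line[OF n(1) n(4)] test_fun_integrable_line[OF n(2) n(3)])
  then show ?thesis by (simp add: complex_eq[symmetric])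
qed

lemma norm_wavelet_fiber:
  assumes "complex_test_fun F" "complex_test_fun G"
  shows "(norm (wavelet (fiber F G q) a t))\<^sup>2 \<le>
    2 * (line_integral (\<lambda>p. Re (F p)) (\<lambda>p. Re (G p)) t a (fst q) (snd q))\<^sup>2
    + 2 * (line_integral (\<lambda>p. Im (F p)) (\<lambda>p. Im (G p)) t a (fst q) (snd q))\<^sup>2
    + 2 * (line_integral (\<lambda>p. Re (F p)) (\<lambda>p. Im (G p)) t a (fst q) (snd q))\<^sup>2
    + 2 * (line_integral (\<lambda>p. Im (F p)) (\<lambda>p. Re (G p)) t a (fst q) (snd q))\<^sup>2"
proof -
  have n: "test_fun (\<lambda>p. Re (F p))" "test_fun (\<lambda>p. Im (F p))" "test_fun (\<lambda>p. Re (G p))" "test_fun (\<lambda>p. Im (G p))"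
    using assms by (auto simp: complex_test_fun_def)
  have ih: "integrable lborel (\<lambda>s. f (fst q + s, snd q) * g (fst q, snd q + s) * hermite ((s - a) / t))"
    if "test_fun f" "test_fun g" for f g
    by (rule integrable_mult_bounded[OF test_fun_integrable_line[OF that] _ abs_hermite_le]) measurable
  have wi: "integrable lborel (\<lambda>s. hermite ((s - a) / t) *\<^sub>R fiber F G q s)"
  proof (rule Bochner_Integration.integrable_bound[OF integrable_fiber[OF assms, of q]])
    note [measurable] = borel_measurable_integrable[OF integrable_fiber[OF assms, of q]]
    show "(\<lambda>s. hermite ((s - a) / t) *\<^sub>R fiber F G q s) \<in> borel_measurable lborel" by measurable
    show "AE s in lborel. norm (hermite ((s - a) / t) *\<^sub>R fiber F G q s) \<le> norm (fiber F G q s)"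
      using abs_hermite_le by (auto intro!: AE_I2 mult_left_le_one_le)
  qed
  define L where "L f g = line_integral f g t a (fst q) (snd q)" for f g
  let ?f1 = "\<lambda>p. Re (F p)" and ?f2 = "\<lambda>p. Im (F p)" and ?g1 = "\<lambda>p. Re (G p)" and ?g2 = "\<lambda>p. Im (G p)"
  have re: "Re (wavelet (fiber F G q) a t) = L ?f1 ?g1 - L ?f2 ?g2"
  proof -
    have "Re (wavelet (fiber F G q) a t) = (\<integral>s. Re (hermite ((s - a) / t) *\<^sub>R fiber F G q s) \<partial>lborel)"
      unfolding wavelet_def by (rule integral_Re[OF wi, symmetric])
    also have "\<dots> = (\<integral>s. ?f1 (fst q + s, snd q) * ?g1 (fst q, snd q + s) * hermite ((s - a) / t)
        - ?f2 (fst q + s, snd q) * ?g2 (fst q, snd q + s) * hermite ((s - a) / t) \<partial>lborel)"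
      by (simp add: fiber_decompose algebra_simps)
    also have "\<dots> = L ?f1 ?g1 - L ?f2 ?g2"
      unfolding L_def line_integral_def by (rule Bochner_Integration.integral_diff[OF ih ih]) (rule n)+
    finally show ?thesis .
  qed
  have im: "Im (wavelet (fiber F G q) a t) = L ?f1 ?g2 + L ?f2 ?g1"
  proof -
    have "Im (wavelet (fiber F G q) a t) = (\<integral>s. Im (hermite ((s - a) / t) *\<^sub>R fiber F G q s) \<partial>lborel)"
      unfolding wavelet_def by (rule integral_Im[OF wi, symmetric])
    also have "\<dots> = (\<integral>s. ?f1 (fst q + s, snd q) * ?g2 (fst q, snd q + s) * hermite ((s - a) / t)
        + ?f2 (fst q + s, snd q) * ?g1 (fst q, snd q + s) * hermite ((s - a) / t) \<partial>lborel)"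
      by (simp add: fiber_decompose algebra_simps)
    also have "\<dots> = L ?f1 ?g2 + L ?f2 ?g1"
      unfolding L_def line_integral_def by (rule Bochner_Integration.integral_add[OF ih ih]) (rule n)+
    finally show ?thesis .
  qed
  have "(u - v)\<^sup>2 \<le> 2 * u\<^sup>2 + 2 * v\<^sup>2" "(u + v)\<^sup>2 \<le> 2 * u\<^sup>2 + 2 * v\<^sup>2" for u v :: real
    using zero_le_power2[of "u + v"] zero_le_power2[of "u - v"] by (simp_all add: power2_sum power2_diff)
  then show ?thesis
    unfolding cmod_power2 re im L_def[symmetric] by (smt (verit))
qed

lemma fourth_moment_le_quartic:
  assumes "complex_test_fun F"
  shows "ennreal (fourth_moment (\<lambda>p. Re (F p))) \<le> quartic F" "ennreal (fourth_moment (\<lambda>p. Im (F p))) \<le> quartic F"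
proof -
  have n: "test_fun (\<lambda>p. Re (F p))" "test_fun (\<lambda>p. Im (F p))" using assms by (auto simp: complex_test_fun_def)
  have e: "ennreal (fourth_moment f) = (\<integral>\<^sup>+p. ennreal (\<bar>f p\<bar> ^ 4) \<partial>plane)" if "test_fun f" for f
    unfolding fourth_moment_def using nn_integral_eq_integral[OF test_fun_integrable_power4[OF that]] by (simp add: power_even_abs)
  show "ennreal (fourth_moment (\<lambda>p. Re (F p))) \<le> quartic F" "ennreal (fourth_moment (\<lambda>p. Im (F p))) \<le> quartic F"
    unfolding e[OF n(1)] e[OF n(2)] quartic_def
    by (intro nn_integral_mono ennreal_leI power_mono abs_Re_le_cmod abs_Im_le_cmod; simp)+
qed

lemma measurable_wavelet_fiber:
  assumes F: "F \<in> borel_measurable plane" and G: "G \<in> borel_measurable plane"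
    and x: "q \<in> measurable M plane" "a \<in> borel_measurable M" "t \<in> borel_measurable M"
  shows "(\<lambda>x. wavelet (fiber F G (q x)) (a x) (t x)) \<in> borel_measurable M"
proof (rule measurable_compose3[OF _ x])
  note [measurable (raw)] = measurable_fiber[OF F G]
  show "(\<lambda>(q, a, t). wavelet (fiber F G q) a t) \<in> borel_measurable (plane \<Otimes>\<^sub>M borel \<Otimes>\<^sub>M borel)"
    unfolding wavelet_def by measurable
qed

lemma wavelet_fiber_energy:
  assumes F: "complex_test_fun F" and G: "complex_test_fun G"
  shows "(\<integral>\<^sup>+q. (\<integral>\<^sup>+t. (\<integral>\<^sup>+a. ennreal ((norm (wavelet (fiber F G q) a t))\<^sup>2 / (t\<^sup>2 * (t\<^sup>2 + a\<^sup>2))) * indicator {0<..} t \<partial>lborel) \<partial>lborel) \<partial>plane)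
    \<le> ennreal (12 * pi\<^sup>2) * (quartic F + quartic G)"
proof -
  define f where "f = (\<lambda>i p. if i then Re (F p) else Im (F p))"
  define g where "g = (\<lambda>i p. if i then Re (G p) else Im (G p))"
  have n: "test_fun (f i)" "test_fun (g i)" for i using F G by (cases i; simp add: f_def g_def complex_test_fun_def)+
  have eb: "ennreal (fourth_moment (f i)) \<le> quartic F" "ennreal (fourth_moment (g i)) \<le> quartic G" for i
    using fourth_moment_le_quartic[OF F] fourth_moment_le_quartic[OF G] by (cases i; simp add: f_def g_def)+
  define k where "k i j q t a = ennreal ((line_integral (f i) (g j) t a (fst q) (snd q))\<^sup>2 / (t\<^sup>2 * (t\<^sup>2 + a\<^sup>2))) * indicator {0<..} t" for i j q t a
  have km: "(\<lambda>(q, t, a). k i j q t a) \<in> borel_measurable (plane \<Otimes>\<^sub>M borel \<Otimes>\<^sub>M borel)" for i j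
  proof -
    note [measurable (raw)] = measurable_transform[OF test_fun_shear(1)[OF n(1)] test_fun_shear(2)[OF n(2)]]
    show ?thesis unfolding k_def line_integral_eq_transform by measurable
  qed
  note [measurable (raw)] = measurable_compose3[OF km]
  have borel_measurable_k: "(\<lambda>a. k i j q t a) \<in> borel_measurable lborel"
    "(\<lambda>t. \<integral>\<^sup>+a. k i j q t a \<partial>lborel) \<in> borel_measurable lborel"
    "(\<lambda>q. \<integral>\<^sup>+t. (\<integral>\<^sup>+a. k i j q t a \<partial>lborel) \<partial>lborel) \<in> borel_measurable plane" for i j q t
    by (measurable; simp add: space_pair_measure)+
  have kb: "(\<integral>\<^sup>+q. (\<integral>\<^sup>+t. (\<integral>\<^sup>+a. k i j q t a \<partial>lborel) \<partial>lborel) \<partial>plane) \<le> ennreal (3 / 2 * pi\<^sup>2) * (quartic F + quartic G)" for i j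
  proof -
    have "(\<integral>\<^sup>+q. (\<integral>\<^sup>+t. (\<integral>\<^sup>+a. k i j q t a \<partial>lborel) \<partial>lborel) \<partial>plane) \<le> ennreal (3 / 2 * pi\<^sup>2 * (fourth_moment (f i) + fourth_moment (g j)))"
      unfolding k_def by (rule line_integral_energy[OF n])
    also have "\<dots> = ennreal (3 / 2 * pi\<^sup>2) * (ennreal (fourth_moment (f i)) + ennreal (fourth_moment (g j)))"
      using fourth_moment_nonneg by (subst ennreal_mult) (auto simp: add_nonneg_nonneg)
    also have "\<dots> \<le> ennreal (3 / 2 * pi\<^sup>2) * (quartic F + quartic G)"
      by (intro mult_left_mono add_mono eb) auto
    finally show ?thesis .
  qed
  have "(\<integral>\<^sup>+q. (\<integral>\<^sup>+t. (\<integral>\<^sup>+a. ennreal ((norm (wavelet (fiber F G q) a t))\<^sup>2 / (t\<^sup>2 * (t\<^sup>2 + a\<^sup>2))) * indicator {0<..} t \<partial>lborel) \<partial>lborel) \<partial>plane)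
    \<le> (\<integral>\<^sup>+q. (\<integral>\<^sup>+t. (\<integral>\<^sup>+a. 2 * k True True q t a + 2 * k False False q t a + 2 * k True False q t a + 2 * k False True q t a \<partial>lborel) \<partial>lborel) \<partial>plane)"
  proof (intro nn_integral_mono)
    fix q :: "real \<times> real" and t a :: real
    let ?d = "t\<^sup>2 * (t\<^sup>2 + a\<^sup>2)"
    have "(norm (wavelet (fiber F G q) a t))\<^sup>2 / ?d \<le>
      (2 * (line_integral (f True) (g True) t a (fst q) (snd q))\<^sup>2
       + 2 * (line_integral (f False) (g False) t a (fst q) (snd q))\<^sup>2
       + 2 * (line_integral (f True) (g False) t a (fst q) (snd q))\<^sup>2
       + 2 * (line_integral (f False) (g True) t a (fst q) (snd q))\<^sup>2) / ?d"
      using norm_wavelet_fiber[OF F G] by (intro divide_right_mono) (auto simp: f_def g_def)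
    also have "\<dots> = 2 * ((line_integral (f True) (g True) t a (fst q) (snd q))\<^sup>2 / ?d)
       + 2 * ((line_integral (f False) (g False) t a (fst q) (snd q))\<^sup>2 / ?d)
       + 2 * ((line_integral (f True) (g False) t a (fst q) (snd q))\<^sup>2 / ?d)
       + 2 * ((line_integral (f False) (g True) t a (fst q) (snd q))\<^sup>2 / ?d)"
      by (simp add: add_divide_distrib)
    finally have "ennreal ((norm (wavelet (fiber F G q) a t))\<^sup>2 / ?d) \<le> ennreal (2 * ((line_integral (f True) (g True) t a (fst q) (snd q))\<^sup>2 / ?d)
       + 2 * ((line_integral (f False) (g False) t a (fst q) (snd q))\<^sup>2 / ?d)
       + 2 * ((line_integral (f True) (g False) t a (fst q) (snd q))\<^sup>2 / ?d)
       + 2 * ((line_integral (f False) (g True) t a (fst q) (snd q))\<^sup>2 / ?d))"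
      by (rule ennreal_leI)
    moreover have "ennreal (2 * x + 2 * y + 2 * z + 2 * w) = 2 * ennreal x + 2 * ennreal y + 2 * ennreal z + 2 * ennreal w"
      if "0 \<le> x" "0 \<le> y" "0 \<le> z" "0 \<le> w" for x y z w :: real
      using that by (simp add: ennreal_mult)
    ultimately have "ennreal ((norm (wavelet (fiber F G q) a t))\<^sup>2 / ?d) \<le> 2 * ennreal ((line_integral (f True) (g True) t a (fst q) (snd q))\<^sup>2 / ?d)
       + 2 * ennreal ((line_integral (f False) (g False) t a (fst q) (snd q))\<^sup>2 / ?d)
       + 2 * ennreal ((line_integral (f True) (g False) t a (fst q) (snd q))\<^sup>2 / ?d)
       + 2 * ennreal ((line_integral (f False) (g True) t a (fst q) (snd q))\<^sup>2 / ?d)"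
      by (simp only: zero_le_power2 zero_le_mult_iff zero_le_divide_iff add_nonneg_nonneg simp_thms)
    then show "ennreal ((norm (wavelet (fiber F G q) a t))\<^sup>2 / ?d) * indicator {0<..} t
      \<le> 2 * k True True q t a + 2 * k False False q t a + 2 * k True False q t a + 2 * k False True q t a"
      by (simp add: k_def indicator_def)
  qed
  also have "\<dots> = 2 * (\<integral>\<^sup>+q. (\<integral>\<^sup>+t. (\<integral>\<^sup>+a. k True True q t a \<partial>lborel) \<partial>lborel) \<partial>plane)
     + 2 * (\<integral>\<^sup>+q. (\<integral>\<^sup>+t. (\<integral>\<^sup>+a. k False False q t a \<partial>lborel) \<partial>lborel) \<partial>plane)
     + 2 * (\<integral>\<^sup>+q. (\<integral>\<^sup>+t. (\<integral>\<^sup>+a. k True False q t a \<partial>lborel) \<partial>lborel) \<partial>plane)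
     + 2 * (\<integral>\<^sup>+q. (\<integral>\<^sup>+t. (\<integral>\<^sup>+a. k False True q t a \<partial>lborel) \<partial>lborel) \<partial>plane)"
    by (simp only: nn_integral_linear4 borel_measurable_k)
  also have "\<dots> \<le> 2 * (ennreal (3 / 2 * pi\<^sup>2) * (quartic F + quartic G)) + 2 * (ennreal (3 / 2 * pi\<^sup>2) * (quartic F + quartic G))
     + 2 * (ennreal (3 / 2 * pi\<^sup>2) * (quartic F + quartic G)) + 2 * (ennreal (3 / 2 * pi\<^sup>2) * (quartic F + quartic G))"
    by (intro add_mono mult_left_mono kb) auto
  also have "\<dots> = (8 * ennreal (3 / 2 * pi\<^sup>2)) * (quartic F + quartic G)"
  proof -
    have "2 * x + 2 * x + 2 * x + 2 * x = 8 * x" for x :: ennreal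
      by (simp flip: distrib_right)
    then show ?thesis by (simp only: mult.assoc)
  qed
  also have "8 * ennreal (3 / 2 * pi\<^sup>2) = ennreal (12 * pi\<^sup>2)"
    by (subst ennreal_numeral[symmetric]) (simp add: ennreal_mult[symmetric] del: ennreal_numeral)
  finally show ?thesis .
qed

lemma decay_rescale:
  assumes "0 < t" shows "decay (s / t) \<le> (max 1 (t\<^sup>2))\<^sup>2 * decay s"
proof -
  have "1 + s\<^sup>2 \<le> max 1 (t\<^sup>2) * (1 + (s / t)\<^sup>2)"
  proof -
    have "s\<^sup>2 = t\<^sup>2 * (s / t)\<^sup>2" using assms by (simp add: power_divide)
    also have "\<dots> \<le> max 1 (t\<^sup>2) * (s / t)\<^sup>2" by (intro mult_right_mono) auto
    finally show ?thesis by (simp add: distrib_left)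
  qed
  then have "(1 + s\<^sup>2)\<^sup>2 \<le> (max 1 (t\<^sup>2) * (1 + (s / t)\<^sup>2))\<^sup>2" by (intro power_mono) auto
  moreover have "0 < 1 + x\<^sup>2" for x :: real by (rule add_pos_nonneg) auto
  from this[of s] this[of "s / t"] have "0 < (1 + s\<^sup>2)\<^sup>2" "0 < (1 + (s / t)\<^sup>2)\<^sup>2" by (intro zero_less_power; simp)+
  moreover have "1 / y \<le> m * (1 / x)" if "x \<le> m * y" "0 < x" "0 < y" for x y m :: real
    using that by (simp add: field_simps)
  ultimately show ?thesis
    unfolding decay_def power_mult_distrib by blast
qed

text \<open>The points at which all averages of \<open>F\<close> and \<open>G\<close> against profiles bounded by \<open>decay\<close> converge absolutely,
  at all scales at once.\<close>
definition tame :: "(real \<times> real \<Rightarrow> complex) \<Rightarrow> (real \<times> real \<Rightarrow> complex) \<Rightarrow> real \<times> real \<Rightarrow> bool" where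
  "tame F G q \<longleftrightarrow> integrable lborel (\<lambda>s. decay s *\<^sub>R fiber F G q s)"

lemma AE_snd_plane:
  assumes [measurable]: "Measurable.pred lborel P" and "AE y in lborel. P y"
  shows "AE q in plane. P (snd q)"
  by (rule lborel_pair.AE_pair_measure, measurable) (use assms(2) in simp)

lemma AE_fst_plane:
  assumes [measurable]: "Measurable.pred lborel P" and "AE x in lborel. P x"
  shows "AE q in plane. P (fst q)"
  by (rule lborel_pair.AE_pair_measure, measurable) (use assms(2) in \<open>auto elim!: eventually_mono\<close>)

text \<open>By Young's inequality the product $|F(x+s,y)\,G(x,y+s)|$ is at most $1 + |F|^4 + |G|^4$, so it
  suffices that almost every horizontal section of $|F|^4$ and almost every vertical section of
  $|G|^4$ is integrable. This depends on one coordinate of the point only.\<close>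
lemma AE_tame:
  assumes [measurable]: "F \<in> borel_measurable plane" "G \<in> borel_measurable plane"
    and fin: "quartic F < \<infinity>" "quartic G < \<infinity>"
  shows "AE q in plane. tame F G q"
proof -
  define f where "f y = (\<integral>\<^sup>+x. ennreal (norm (F (x, y)) ^ 4) \<partial>lborel)" for y
  define g where "g x = (\<integral>\<^sup>+y. ennreal (norm (G (x, y)) ^ 4) \<partial>lborel)" for x
  have [measurable]: "f \<in> borel_measurable lborel" "g \<in> borel_measurable lborel" unfolding f_def g_def by measurable
  have "(\<integral>\<^sup>+y. f y \<partial>lborel) \<noteq> \<infinity>"
    using fin(1) unfolding f_def quartic_def by (subst (asm) nn_integral_plane_swap(2)) auto
  then have "AE y in lborel. f y \<noteq> \<infinity>" by (intro nn_integral_PInf_AE) auto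
  then have af: "AE q in plane. f (snd q) < \<infinity>" by (intro AE_snd_plane, measurable) (auto simp: less_top)
  have "(\<integral>\<^sup>+x. g x \<partial>lborel) \<noteq> \<infinity>"
    using fin(2) unfolding g_def quartic_def by (subst (asm) nn_integral_plane_swap(1)) auto
  then have "AE x in lborel. g x \<noteq> \<infinity>" by (intro nn_integral_PInf_AE) auto
  then have ag: "AE q in plane. g (fst q) < \<infinity>" by (intro AE_fst_plane, measurable) (auto simp: less_top)
  from af ag show ?thesis
  proof eventually_elim
    fix q assume fq: "f (snd q) < \<infinity>" and gq: "g (fst q) < \<infinity>"
    have [measurable]: "fiber F G q \<in> borel_measurable lborel"
      unfolding fiber_def by measurable
    have "(\<integral>\<^sup>+s. ennreal (norm (decay s *\<^sub>R fiber F G q s)) \<partial>lborel)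
      \<le> (\<integral>\<^sup>+s. ennreal (decay s) + ennreal (norm (F (fst q + s, snd q)) ^ 4) + ennreal (norm (G (fst q, snd q + s)) ^ 4) \<partial>lborel)"
    proof (rule nn_integral_mono)
      fix s
      define u where "u = norm (F (fst q + s, snd q))"
      define v where "v = norm (G (fst q, snd q + s))"
      have d: "0 \<le> decay s" "decay s \<le> 1" using decay_pos[of s] decay_le(2)[of s] by auto
      have "2 * (u * v) \<le> u\<^sup>2 + v\<^sup>2" using sum_squares_bound[of u v] by simp
      moreover have "2 * u\<^sup>2 \<le> 1 + u ^ 4" using sum_squares_bound[of "u\<^sup>2" 1] by (simp flip: power_mult)
      moreover have "2 * v\<^sup>2 \<le> 1 + v ^ 4" using sum_squares_bound[of "v\<^sup>2" 1] by (simp flip: power_mult)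
      moreover have "0 \<le> u ^ 4" "0 \<le> v ^ 4" by auto
      ultimately have "u * v \<le> 1 + (u ^ 4 + v ^ 4)" by linarith
      then have "decay s * (u * v) \<le> decay s * (1 + (u ^ 4 + v ^ 4))" using d by (intro mult_left_mono) auto
      also have "\<dots> \<le> decay s + (u ^ 4 + v ^ 4)"
        using d mult_right_mono[OF d(2), of "u ^ 4 + v ^ 4"] by (simp add: distrib_left)
      finally have "norm (decay s *\<^sub>R fiber F G q s) \<le> decay s + u ^ 4 + v ^ 4"
        using d by (simp add: fiber_def norm_mult u_def v_def)
      then have "ennreal (norm (decay s *\<^sub>R fiber F G q s)) \<le> ennreal (decay s + u ^ 4 + v ^ 4)" by (rule ennreal_leI)
      also have "\<dots> = ennreal (decay s) + ennreal (u ^ 4) + ennreal (v ^ 4)"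
        using d by (simp add: u_def v_def)
      finally show "ennreal (norm (decay s *\<^sub>R fiber F G q s)) \<le> ennreal (decay s) + ennreal (norm (F (fst q + s, snd q)) ^ 4) + ennreal (norm (G (fst q, snd q + s)) ^ 4)"
        by (simp add: u_def v_def)
    qed
    also have "\<dots> = (\<integral>\<^sup>+s. ennreal (decay s) \<partial>lborel) + (\<integral>\<^sup>+s. ennreal (norm (F (fst q + s, snd q)) ^ 4) \<partial>lborel) + (\<integral>\<^sup>+s. ennreal (norm (G (fst q, snd q + s)) ^ 4) \<partial>lborel)"
      by (simp add: nn_integral_add)
    also have "\<dots> = (\<integral>\<^sup>+s. ennreal (decay s) \<partial>lborel) + f (snd q) + g (fst q)"
      using nn_integral_translate[of "\<lambda>x. ennreal (norm (F (x, snd q)) ^ 4)" "fst q"]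
        nn_integral_translate[of "\<lambda>y. ennreal (norm (G (fst q, y)) ^ 4)" "snd q"]
      by (simp add: f_def g_def)
    also have "\<dots> < \<infinity>"
    proof -
      have "(\<integral>\<^sup>+s. ennreal (decay s) \<partial>lborel) < \<infinity>"
        using integrable_decay decay_pos unfolding integrable_iff_bounded by (simp add: abs_of_pos)
      then show ?thesis using fq gq by (simp add: less_top)
    qed
    finally show "tame F G q" unfolding tame_def by (intro integrableI_bounded) auto
  qed
qed

context decaying_profile
begin

definition square_energy :: "(real \<times> real \<Rightarrow> complex) \<Rightarrow> (real \<times> real \<Rightarrow> complex) \<Rightarrow> ennreal" where
  "square_energy F G = (\<integral>\<^sup>+q. (\<integral>\<^sup>+t. ennreal ((norm (\<integral>s. fiber F G q s * \<psi> (s / t) \<partial>lborel))\<^sup>2 / t ^ 3) * indicator {0<..} t \<partial>lborel) \<partial>plane)"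

definition square_const :: real where
  "square_const = 25 * B\<^sup>2 * (\<integral>x. decay x \<partial>lborel) * (12 * pi\<^sup>2)"

lemma square_const_nonneg: "0 \<le> square_const"
  unfolding square_const_def using decay_pos
  by (intro mult_nonneg_nonneg Bochner_Integration.integral_nonneg) (auto simp: less_imp_le)

lemma square_energy_complex_test_fun:
  assumes F: "complex_test_fun F" and G: "complex_test_fun G"
  shows "square_energy F G \<le> ennreal square_const * (quartic F + quartic G)"
proof -
  let ?C = "ennreal (25 * B\<^sup>2 * (\<integral>x. decay x \<partial>lborel))"
  note [measurable (raw)] = measurable_wavelet_fiber[OF F[THEN complex_test_fun_measurable] G[THEN complex_test_fun_measurable]]
  have "square_energy F G \<le> (\<integral>\<^sup>+q. ?C * (\<integral>\<^sup>+t. (\<integral>\<^sup>+a. ennreal ((norm (wavelet (fiber F G q) a t))\<^sup>2 / (t\<^sup>2 * (t\<^sup>2 + a\<^sup>2))) * indicator {0<..} t \<partial>lborel) \<partial>lborel) \<partial>plane)"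
    unfolding square_energy_def by (intro nn_integral_mono square_function_pointwise integrable_fiber F G)
  also have "\<dots> = ?C * (\<integral>\<^sup>+q. (\<integral>\<^sup>+t. (\<integral>\<^sup>+a. ennreal ((norm (wavelet (fiber F G q) a t))\<^sup>2 / (t\<^sup>2 * (t\<^sup>2 + a\<^sup>2))) * indicator {0<..} t \<partial>lborel) \<partial>lborel) \<partial>plane)"
    by (rule nn_integral_cmult) measurable
  also have "\<dots> \<le> ?C * (ennreal (12 * pi\<^sup>2) * (quartic F + quartic G))"
    by (intro mult_left_mono wavelet_fiber_energy F G) auto
  also have "\<dots> = ennreal square_const * (quartic F + quartic G)"
    unfolding square_const_def using decay_pos
    by (subst (3) ennreal_mult) (auto simp: mult_ac less_imp_le intro!: Bochner_Integration.integral_nonneg mult_nonneg_nonneg)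
  finally show ?thesis .
qed

lemma norm_\<psi>_rescaled: "0 < t \<Longrightarrow> norm (\<psi> (s / t)) \<le> B * (max 1 (t\<^sup>2))\<^sup>2 * decay s"
  using order_trans[OF bound_\<psi> mult_left_mono[OF decay_rescale B_nonneg]] by (simp add: mult.assoc)

lemma tame_integrable:
  assumes "tame F G q" "0 < t" and [measurable]: "fiber F G q \<in> borel_measurable lborel"
  shows "integrable lborel (\<lambda>s. fiber F G q s * \<psi> (s / t))"
proof (rule Bochner_Integration.integrable_bound)
  show "integrable lborel (\<lambda>s. (B * (max 1 (t\<^sup>2))\<^sup>2) *\<^sub>R (decay s *\<^sub>R fiber F G q s))"
    using assms(1) unfolding tame_def by (rule integrable_scaleR_right)
  show "AE s in lborel. norm (fiber F G q s * \<psi> (s / t)) \<le> norm ((B * (max 1 (t\<^sup>2))\<^sup>2) *\<^sub>R (decay s *\<^sub>R fiber F G q s))"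
  proof (rule AE_I2)
    fix s
    have "norm (fiber F G q s * \<psi> (s / t)) \<le> norm (fiber F G q s) * (B * (max 1 (t\<^sup>2))\<^sup>2 * decay s)"
      unfolding norm_mult using norm_\<psi>_rescaled[OF assms(2)] by (intro mult_left_mono) auto
    also have "\<dots> = norm ((B * (max 1 (t\<^sup>2))\<^sup>2) *\<^sub>R (decay s *\<^sub>R fiber F G q s))"
      using B_nonneg decay_pos[of s] by (simp add: abs_mult)
    finally show "norm (fiber F G q s * \<psi> (s / t)) \<le> norm ((B * (max 1 (t\<^sup>2))\<^sup>2) *\<^sub>R (decay s *\<^sub>R fiber F G q s))" .
  qed
qed measurable

end

definition truncate :: "nat \<Rightarrow> (real \<times> real \<Rightarrow> complex) \<Rightarrow> real \<times> real \<Rightarrow> complex" where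
  "truncate n F p = (if norm (F p) \<le> real n \<and> \<bar>fst p\<bar> \<le> real n \<and> \<bar>snd p\<bar> \<le> real n then F p else 0)"

lemma measurable_truncate [measurable]:
  assumes [measurable]: "F \<in> borel_measurable plane" shows "truncate n F \<in> borel_measurable plane"
  unfolding truncate_def by measurable

lemma complex_test_fun_truncate:
  assumes "F \<in> borel_measurable plane" shows "complex_test_fun (truncate n F)"
proof -
  note [measurable] = assms
  have b: "norm (truncate n F p) \<le> real n" for p by (simp add: truncate_def)
  have s: "\<bar>x\<bar> \<le> real n \<and> \<bar>y\<bar> \<le> real n" if "truncate n F (x, y) \<noteq> 0" for x y
    using that by (auto simp: truncate_def split: if_splits)
  have "\<bar>Re (truncate n F p)\<bar> \<le> real n" "\<bar>Im (truncate n F p)\<bar> \<le> real n" for p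
    using abs_Re_le_cmod[of "truncate n F p"] abs_Im_le_cmod[of "truncate n F p"] b[of p] by linarith+
  moreover have "Re (truncate n F (x, y)) \<noteq> 0 \<longrightarrow> \<bar>x\<bar> \<le> real n \<and> \<bar>y\<bar> \<le> real n"
    "Im (truncate n F (x, y)) \<noteq> 0 \<longrightarrow> \<bar>x\<bar> \<le> real n \<and> \<bar>y\<bar> \<le> real n" for x y
    using s[of x y] by (cases "truncate n F (x, y) = 0"; simp)+
  ultimately show ?thesis
    unfolding complex_test_fun_def test_fun_def by (intro conjI exI[of _ "real n"] allI) (measurable; blast)+
qed

lemma norm_truncate_le: "norm (truncate n F p) \<le> norm (F p)"
  by (simp add: truncate_def)

lemma quartic_truncate_le: "quartic (truncate n F) \<le> quartic F"
  unfolding quartic_def by (intro nn_integral_mono ennreal_leI power_mono norm_truncate_le) simp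

lemma truncate_eventually: "\<forall>\<^sub>F n in sequentially. truncate n F p = F p"
proof -
  obtain N where N: "max (norm (F p)) (max \<bar>fst p\<bar> \<bar>snd p\<bar>) \<le> real N" using real_arch_simple by blast
  have "truncate n F p = F p" if "N \<le> n" for n
  proof -
    have "real N \<le> real n" using that by simp
    then show ?thesis using N unfolding truncate_def by auto
  qed
  then show ?thesis unfolding eventually_sequentially by blast
qed

context decaying_profile
begin

text \<open>Truncations converge at tame points by dominated convergence, so Fatou's lemma applies.\<close>
lemma square_energy_le_sum:
  assumes [measurable]: "F \<in> borel_measurable plane" "G \<in> borel_measurable plane"
    and fin: "quartic F < \<infinity>" "quartic G < \<infinity>"
  shows "square_energy F G \<le> ennreal square_const * (quartic F + quartic G)"
proof -
  define h where "h F G q t = ennreal ((norm (\<integral>s. fiber F G q s * \<psi> (s / t) \<partial>lborel))\<^sup>2 / t ^ 3) * indicator {0<..} t" for F G q t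
  define Fn where "Fn n = truncate n F" for n
  define Gn where "Gn n = truncate n G" for n
  have cn: "complex_test_fun (Fn n)" "complex_test_fun (Gn n)" for n unfolding Fn_def Gn_def by (auto intro: complex_test_fun_truncate)
  have hm: "(\<lambda>(q, t). h (Fn n) (Gn n) q t) \<in> borel_measurable (plane \<Otimes>\<^sub>M borel)" for n
  proof -
    note [measurable (raw)] = measurable_fiber[OF cn(1)[THEN complex_test_fun_measurable] cn(2)[THEN complex_test_fun_measurable]]
    show ?thesis unfolding h_def by measurable
  qed
  note [measurable (raw)] = measurable_compose2[OF hm]
  have "AE q in plane. (\<integral>\<^sup>+t. h F G q t \<partial>lborel) \<le> liminf (\<lambda>n. \<integral>\<^sup>+t. h (Fn n) (Gn n) q t \<partial>lborel)"
    using AE_tame[OF assms(1,2) fin]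
  proof eventually_elim
    fix q assume q: "tame F G q"
    have [measurable]: "fiber F G q \<in> borel_measurable lborel" "fiber (Fn n) (Gn n) q \<in> borel_measurable lborel" for n
      unfolding fiber_def Fn_def Gn_def by measurable
    have lim: "(\<lambda>n. h (Fn n) (Gn n) q t) \<longlonglongrightarrow> h F G q t" for t
    proof (cases "0 < t")
      case t: True
      have "(\<lambda>n. \<integral>s. fiber (Fn n) (Gn n) q s * \<psi> (s / t) \<partial>lborel) \<longlonglongrightarrow> (\<integral>s. fiber F G q s * \<psi> (s / t) \<partial>lborel)"
      proof (rule integral_dominated_convergence)
        show "integrable lborel (\<lambda>s. norm (fiber F G q s * \<psi> (s / t)))"
          by (intro integrable_norm tame_integrable q t) measurable
        show "AE s in lborel. (\<lambda>n. fiber (Fn n) (Gn n) q s * \<psi> (s / t)) \<longlonglongrightarrow> fiber F G q s * \<psi> (s / t)"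
        proof (rule AE_I2, rule tendsto_eventually)
          fix s
          show "\<forall>\<^sub>F n in sequentially. fiber (Fn n) (Gn n) q s * \<psi> (s / t) = fiber F G q s * \<psi> (s / t)"
            using truncate_eventually[of F "(fst q + s, snd q)"] truncate_eventually[of G "(fst q, snd q + s)"]
            by eventually_elim (simp add: fiber_def Fn_def Gn_def)
        qed
        show "AE s in lborel. norm (fiber (Fn n) (Gn n) q s * \<psi> (s / t)) \<le> norm (fiber F G q s * \<psi> (s / t))" for n
          by (rule AE_I2) (auto simp: fiber_def Fn_def Gn_def norm_mult intro!: mult_mono norm_truncate_le)
      qed measurable
      then show ?thesis unfolding h_def using t by (intro tendsto_intros) auto
    qed (simp add: h_def)
    have "(\<integral>\<^sup>+t. h F G q t \<partial>lborel) = (\<integral>\<^sup>+t. liminf (\<lambda>n. h (Fn n) (Gn n) q t) \<partial>lborel)"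
      using lim_imp_Liminf[OF _ lim] by simp
    also have "\<dots> \<le> liminf (\<lambda>n. \<integral>\<^sup>+t. h (Fn n) (Gn n) q t \<partial>lborel)"
      by (rule nn_integral_liminf) (rule measurable_compose2[OF hm]; simp add: space_pair_measure)
    finally show "(\<integral>\<^sup>+t. h F G q t \<partial>lborel) \<le> liminf (\<lambda>n. \<integral>\<^sup>+t. h (Fn n) (Gn n) q t \<partial>lborel)" .
  qed
  then have "square_energy F G \<le> (\<integral>\<^sup>+q. liminf (\<lambda>n. \<integral>\<^sup>+t. h (Fn n) (Gn n) q t \<partial>lborel) \<partial>plane)"
    unfolding square_energy_def h_def[symmetric] by (rule nn_integral_mono_AE)
  also have "\<dots> \<le> liminf (\<lambda>n. \<integral>\<^sup>+q. (\<integral>\<^sup>+t. h (Fn n) (Gn n) q t \<partial>lborel) \<partial>plane)"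
    by (rule nn_integral_liminf) measurable
  also have "\<dots> \<le> ennreal square_const * (quartic F + quartic G)"
  proof -
    have "(\<integral>\<^sup>+q. (\<integral>\<^sup>+t. h (Fn n) (Gn n) q t \<partial>lborel) \<partial>plane) \<le> ennreal square_const * (quartic F + quartic G)" for n
    proof -
      have "(\<integral>\<^sup>+q. (\<integral>\<^sup>+t. h (Fn n) (Gn n) q t \<partial>lborel) \<partial>plane) = square_energy (Fn n) (Gn n)"
        by (simp add: square_energy_def h_def)
      also have "\<dots> \<le> ennreal square_const * (quartic (Fn n) + quartic (Gn n))"
        by (rule square_energy_complex_test_fun[OF cn])
      also have "\<dots> \<le> ennreal square_const * (quartic F + quartic G)"
        unfolding Fn_def Gn_def by (intro mult_left_mono add_mono quartic_truncate_le) auto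
      finally show ?thesis .
    qed
    then have "liminf (\<lambda>n. \<integral>\<^sup>+q. (\<integral>\<^sup>+t. h (Fn n) (Gn n) q t \<partial>lborel) \<partial>plane) \<le> liminf (\<lambda>n :: nat. ennreal square_const * (quartic F + quartic G))"
      by (intro Liminf_mono always_eventually allI)
    then show ?thesis by (simp add: Liminf_const)
  qed
  finally show ?thesis .
qed

end

text \<open>Minimise over \<open>u\<close>. Enlarging \<open>p\<close> and \<open>q\<close> by a positive \<open>e\<close> first and letting \<open>e\<close> tend to zero covers
  the cases \<open>p = 0\<close> and \<open>q = 0\<close>.\<close>
lemma optimize_scaling:
  fixes x K p q :: real
  assumes K: "0 \<le> K" and pq: "0 \<le> p" "0 \<le> q" and le: "\<And>u. 0 < u \<Longrightarrow> x \<le> K * (u * p + q / u)"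
  shows "x \<le> 2 * K * sqrt (p * q)"
proof -
  have "x \<le> 2 * K * sqrt ((p + e) * (q + e))" if e: "0 < e" for e
  proof -
    define P where "P = p + e"
    define Q where "Q = q + e"
    have PQ: "0 < P" "0 < Q" using pq e by (auto simp: P_def Q_def)
    define u where "u = sqrt Q / sqrt P"
    have u: "0 < u" using PQ by (simp add: u_def)
    have "x \<le> K * (u * p + q / u)" by (rule le[OF u])
    also have "\<dots> \<le> K * (u * P + Q / u)"
      using u e K by (intro mult_left_mono add_mono divide_right_mono) (auto simp: P_def Q_def)
    also have "u * P + Q / u = 2 * (sqrt P * sqrt Q)"
    proof -
      have "w / r * (r * r) = r * w" "(w * w) / (w / r) = r * w" if "0 < r" "0 < w" for r w :: real
        using that by (auto simp: field_simps)
      note * = this[of "sqrt P" "sqrt Q"]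
      have "u * P = sqrt P * sqrt Q" "Q / u = sqrt P * sqrt Q" using * PQ by (auto simp: u_def)
      then show ?thesis by simp
    qed
    finally show ?thesis by (simp add: P_def Q_def real_sqrt_mult)
  qed
  moreover have "((\<lambda>e. 2 * K * sqrt ((p + e) * (q + e))) \<longlongrightarrow> 2 * K * sqrt ((p + 0) * (q + 0))) (at_right 0)"
    by (intro tendsto_intros)
  ultimately show ?thesis
    by (intro tendsto_lowerbound[of "\<lambda>e. 2 * K * sqrt ((p + e) * (q + e))" _ "at_right 0"])
       (auto simp: eventually_at_right_less intro: eventually_mono[OF eventually_at_right_less])
qed

context decaying_profile
begin

text \<open>The square function bound. It follows from the bound by a sum because the left side is unchanged
  when \<open>F\<close> is multiplied and \<open>G\<close> divided by the same positive number.\<close>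
theorem square_energy_bound:
  assumes [measurable]: "F \<in> borel_measurable plane" "G \<in> borel_measurable plane"
    and fin: "quartic F < \<infinity>" "quartic G < \<infinity>"
  shows "square_energy F G \<le> ennreal (2 * square_const * sqrt (enn2real (quartic F) * enn2real (quartic G)))"
proof -
  define p where "p = enn2real (quartic F)"
  define q where "q = enn2real (quartic G)"
  have pq: "quartic F = ennreal p" "quartic G = ennreal q" "0 \<le> p" "0 \<le> q"
    using fin by (auto simp: p_def q_def less_top)
  have main: "square_energy F G \<le> ennreal (square_const * (u * p + q / u))" if u: "0 < u" for u
  proof -
    \<comment> \<open>Fourth powers turn this factor into \<open>u\<close>.\<close>
    define c where "c = root 4 u"
    have c: "0 < c" "c ^ 4 = u" using u by (auto simp: c_def real_root_gt_zero)
    define F' where "F' = (\<lambda>z. of_real c * F z)"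
    define G' where "G' = (\<lambda>z. of_real (1 / c) * G z)"
    have "fiber F' G' = fiber F G"
      using c by (auto simp: fun_eq_iff fiber_def F'_def G'_def)
    then have "square_energy F G = square_energy F' G'" by (simp add: square_energy_def)
    also have "\<dots> \<le> ennreal square_const * (quartic F' + quartic G')"
    proof (rule square_energy_le_sum)
      show "F' \<in> borel_measurable plane" "G' \<in> borel_measurable plane" unfolding F'_def G'_def by measurable
      show "quartic F' < \<infinity>" "quartic G' < \<infinity>"
        using fin unfolding quartic_def F'_def G'_def norm_mult power_mult_distrib
        by (auto simp: ennreal_mult nn_integral_cmult ennreal_mult_less_top)
    qed
    also have "quartic F' = ennreal (u * p)"
    proof -
      have "quartic F' = (\<integral>\<^sup>+z. ennreal u * ennreal (norm (F z) ^ 4) \<partial>plane)"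
        unfolding quartic_def F'_def using c u by (simp add: norm_mult power_mult_distrib ennreal_mult)
      also have "\<dots> = ennreal u * quartic F" unfolding quartic_def by (rule nn_integral_cmult) measurable
      finally show ?thesis using u pq by (simp add: ennreal_mult)
    qed
    also have "quartic G' = ennreal (q / u)"
    proof -
      have "quartic G' = (\<integral>\<^sup>+z. ennreal (1 / u) * ennreal (norm (G z) ^ 4) \<partial>plane)"
        unfolding quartic_def G'_def using c u
        by (intro nn_integral_cong) (simp add: norm_mult norm_divide power_mult_distrib power_divide ennreal_mult[symmetric])
      also have "\<dots> = ennreal (1 / u) * quartic G" unfolding quartic_def by (rule nn_integral_cmult) measurable
      finally show ?thesis using u pq by (simp add: ennreal_mult[symmetric])
    qed
    also have "ennreal square_const * (ennreal (u * p) + ennreal (q / u)) = ennreal (square_const * (u * p + q / u))"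
      using u pq square_const_nonneg by (simp add: ennreal_mult[symmetric] ennreal_plus[symmetric] del: ennreal_plus)
    finally show ?thesis .
  qed
  have fine: "square_energy F G < \<infinity>"
    using main[of 1] by (auto simp: order_le_less_trans[OF _ ennreal_less_top])
  define x where "x = enn2real (square_energy F G)"
  have x: "square_energy F G = ennreal x" using fine by (simp add: x_def less_top)
  have "x \<le> 2 * square_const * sqrt (p * q)"
  proof (rule optimize_scaling[OF square_const_nonneg pq(3,4)])
    fix u :: real assume u: "0 < u"
    show "x \<le> square_const * (u * p + q / u)"
      using main[OF u] unfolding x using u pq square_const_nonneg by (subst (asm) ennreal_le_iff) auto
  qed
  then show ?thesis unfolding x p_def[symmetric] q_def[symmetric] by (rule ennreal_leI)
qed

end

section \<open>Variation within a dyadic range of scales\<close>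

text \<open>The increments over disjoint intervals are controlled by integrals over these intervals, which
  add up. Half-open intervals make them, and later the dyadic ranges of scales, disjoint.\<close>
lemma variation_square_le:
  fixes a :: "real \<Rightarrow> complex" and h :: "real \<Rightarrow> ennreal"
  assumes [measurable]: "h \<in> borel_measurable borel"
    and le: "\<And>t t'. L \<le> t \<Longrightarrow> t < t' \<Longrightarrow> t' \<le> R \<Longrightarrow>
      ennreal ((norm (a t' - a t))\<^sup>2) \<le> (\<integral>\<^sup>+u. h u * indicator {t<..t'} u \<partial>lborel)"
  shows "epowr (variation 2 {L..R} a) 2 \<le> (\<integral>\<^sup>+u. h u * indicator {L<..R} u \<partial>lborel)"
proof -
  define X where "X = (\<integral>\<^sup>+u. h u * indicator {L<..R} u \<partial>lborel)"
  have S: "ennreal (\<Sum>j = 1..m. norm (a (t j) - a (t (j - 1))) powr 2) \<le> X"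
    if t: "strict_mono_on {..m} t" "t ` {..m} \<subseteq> {L..R}" for m and t :: "nat \<Rightarrow> real"
  proof -
    have inc: "t (j - 1) < t j" "L \<le> t (j - 1)" "t j \<le> R" if "j \<in> {1..m}" for j
      using that t by (auto simp: strict_mono_on_def image_subset_iff)
    have "ennreal (\<Sum>j = 1..m. norm (a (t j) - a (t (j - 1))) powr 2) = (\<Sum>j = 1..m. ennreal ((norm (a (t j) - a (t (j - 1))))\<^sup>2))"
      by (subst sum_ennreal[symmetric]) (auto simp: powr_numeral)
    also have "\<dots> \<le> (\<Sum>j = 1..m. (\<integral>\<^sup>+u. h u * indicator {t (j - 1)<..t j} u \<partial>lborel))"
      by (intro sum_mono le inc) auto
    also have "\<dots> = (\<integral>\<^sup>+u. (\<Sum>j = 1..m. h u * indicator {t (j - 1)<..t j} u) \<partial>lborel)"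
      by (rule nn_integral_sum[symmetric]) measurable
    also have "\<dots> \<le> X"
      unfolding X_def
    proof (rule nn_integral_mono)
      fix u
      have disj: "disjoint_family_on (\<lambda>j. {t (j - 1)<..t j}) {1..m}"
      proof -
        have "{t (i - 1)<..t i} \<inter> {t (j - 1)<..t j} = {}" if ij: "i \<in> {1..m}" "j \<in> {1..m}" "i < j" for i j
        proof -
          have "t i \<le> t (j - 1)"
            using ij t(1) by (cases "i = j - 1") (auto simp: strict_mono_on_def less_imp_le)
          then show ?thesis by auto
        qed
        then show ?thesis unfolding disjoint_family_on_def by (metis Int_commute linorder_neqE_nat)
      qed
      have "(\<Sum>j = 1..m. h u * indicator {t (j - 1)<..t j} u) = h u * indicator (\<Union>j\<in>{1..m}. {t (j - 1)<..t j}) u"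
      proof -
        have "(indicator (\<Union>j\<in>{1..m}. {t (j - 1)<..t j}) u :: ennreal) = (\<Sum>j = 1..m. indicator {t (j - 1)<..t j} u)"
          by (rule indicator_UN_disjoint[OF _ disj]) simp
        then show ?thesis by (simp only: sum_distrib_left)
      qed
      also have "\<dots> \<le> h u * indicator {L<..R} u"
        using inc by (intro mult_left_mono) (fastforce simp: indicator_def)+
      finally show "(\<Sum>j = 1..m. h u * indicator {t (j - 1)<..t j} u) \<le> h u * indicator {L<..R} u" .
    qed
    finally show ?thesis .
  qed
  show ?thesis
  proof (cases "X = \<infinity>")
    case False
    then obtain x where x: "X = ennreal x" "0 \<le> x" by (cases X) auto
    have "variation 2 {L..R} a \<le> ennreal (x powr (1 / 2))"
      unfolding variation_def
    proof (rule SUP_least, clarify)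
      fix m and t :: "nat \<Rightarrow> real"
      assume t: "strict_mono_on {..m} t" "t ` {..m} \<subseteq> {L..R}"
      have "(\<Sum>j = 1..m. norm (a (t j) - a (t (j - 1))) powr 2) \<le> x"
        using S[OF t] x by (simp add: ennreal_le_iff)
      then show "ennreal ((\<Sum>j = 1..m. norm (a (t j) - a (t (j - 1))) powr 2) powr (1 / 2)) \<le> ennreal (x powr (1 / 2))"
        by (intro ennreal_leI powr_mono2 sum_nonneg) auto
    qed
    then obtain v where v: "variation 2 {L..R} a = ennreal v" "0 \<le> v" "v \<le> x powr (1 / 2)"
      by (cases "variation 2 {L..R} a") (auto simp: ennreal_le_iff top_unique)
    have "v powr 2 \<le> (x powr (1 / 2)) powr 2" using v by (intro powr_mono2) auto
    also have "\<dots> = x" using x by (simp add: powr_powr)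
    finally show ?thesis using v x unfolding X_def[symmetric] by (simp add: epowr_def ennreal_leI)
  qed (simp add: X_def)
qed

context decaying_profile
begin

text \<open>The derivative of $u^{-1}\varphi(s/u)$ in the scale \<open>u\<close> is $u^{-2}\,\psi(s/u)$ with
  $\psi(x) = -(x\,\varphi(x))'$. So \<open>\<psi>\<close> has mean zero whatever the mean of \<open>\<phi>\<close> is.\<close>
lemma average_difference:
  fixes \<phi> \<phi>' P :: "real \<Rightarrow> complex"
  assumes d\<phi>: "\<And>x. (\<phi> has_vector_derivative \<phi>' x) (at x)"
    and \<psi>_eq: "\<And>x. \<psi> x = - (\<phi> x + x *\<^sub>R \<phi>' x)"
    and bound_\<phi>: "\<And>x. norm (\<phi> x) \<le> B * decay x"
    and P: "integrable lborel (\<lambda>s. decay s *\<^sub>R P s)" and Pm [measurable]: "P \<in> borel_measurable lborel"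
    and t: "0 < t" "t \<le> t'"
  shows "(\<integral>s. P s * (of_real (inverse t') * \<phi> (inverse t' * s)) \<partial>lborel) - (\<integral>s. P s * (of_real (inverse t) * \<phi> (inverse t * s)) \<partial>lborel)
    = (LINT u:{t..t'}|lborel. (1 / u\<^sup>2) *\<^sub>R (\<integral>s. P s * \<psi> (s / u) \<partial>lborel))"
proof -
  have cont_\<phi>: "continuous_on UNIV \<phi>"
    using d\<phi> by (meson continuous_at_imp_continuous_on has_vector_derivative_continuous)
  then have [measurable]: "\<phi> \<in> borel_measurable borel" by (rule borel_measurable_continuous_onI)
  have avi: "integrable lborel (\<lambda>s. P s * (of_real (inverse u) * \<phi> (inverse u * s)))" if u: "0 < u" for u
  proof (rule Bochner_Integration.integrable_bound)
    define C where "C = inverse u * (B * (max 1 (u\<^sup>2))\<^sup>2)"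
    show "integrable lborel (\<lambda>s. C *\<^sub>R (decay s *\<^sub>R P s))" using P by (rule integrable_scaleR_right)
    show "AE s in lborel. norm (P s * (of_real (inverse u) * \<phi> (inverse u * s))) \<le> norm (C *\<^sub>R (decay s *\<^sub>R P s))"
    proof (rule AE_I2)
      fix s
      have "norm (\<phi> (inverse u * s)) \<le> B * ((max 1 (u\<^sup>2))\<^sup>2 * decay s)"
        using order_trans[OF bound_\<phi> mult_left_mono[OF decay_rescale[OF u] B_nonneg], of s] by (simp add: field_simps)
      then have "inverse u * norm (\<phi> (inverse u * s)) \<le> C * decay s"
        unfolding C_def mult.assoc using u by (intro mult_left_mono) auto
      then have "norm (P s) * (inverse u * norm (\<phi> (inverse u * s))) \<le> norm (P s) * (C * decay s)" by (intro mult_left_mono) auto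
      also have "\<dots> = norm (C *\<^sub>R (decay s *\<^sub>R P s))"
        using u B_nonneg decay_pos[of s] by (simp add: C_def abs_mult)
      finally show "norm (P s * (of_real (inverse u) * \<phi> (inverse u * s))) \<le> norm (C *\<^sub>R (decay s *\<^sub>R P s))"
        using u by (simp add: norm_mult norm_inverse)
    qed
  qed measurable
  \<comment> \<open>The fundamental theorem of calculus in the scale, for each fixed \<open>s\<close>.\<close>
  have FTC: "of_real (inverse t') * \<phi> (inverse t' * s) - of_real (inverse t) * \<phi> (inverse t * s)
     = (\<integral>u. indicator {t..t'} u *\<^sub>R ((1 / u\<^sup>2) *\<^sub>R \<psi> (s / u)) \<partial>lborel)" for s
  proof -
    have "(\<integral>u. indicator {t..t'} u *\<^sub>R ((1 / u\<^sup>2) *\<^sub>R \<psi> (s / u)) \<partial>lborel) = inverse t' *\<^sub>R \<phi> (s * inverse t') - inverse t *\<^sub>R \<phi> (s * inverse t)"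
    proof (rule integral_FTC_atLeastAtMost[OF t(2)])
      show "((\<lambda>u. inverse u *\<^sub>R \<phi> (s * inverse u)) has_vector_derivative (1 / u\<^sup>2) *\<^sub>R \<psi> (s / u)) (at u within {t..t'})"
        if "t \<le> u" "u \<le> t'" for u
      proof -
        have u: "0 < u" using that t by simp
        have "((\<lambda>u. inverse u *\<^sub>R \<phi> (s * inverse u)) has_vector_derivative
           inverse u *\<^sub>R ((- (s * (inverse u)\<^sup>2)) *\<^sub>R \<phi>' (s * inverse u)) + (- ((inverse u)\<^sup>2)) *\<^sub>R \<phi> (s * inverse u)) (at u)"
        proof (rule has_vector_derivative_scaleR)
          show "(inverse has_real_derivative - ((inverse u)\<^sup>2)) (at u)"
            using u by (auto intro!: derivative_eq_intros simp: power2_eq_square)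
          show "((\<lambda>u. \<phi> (s * inverse u)) has_vector_derivative (- (s * (inverse u)\<^sup>2)) *\<^sub>R \<phi>' (s * inverse u)) (at u)"
            by (rule vector_diff_chain_at[where f = "\<lambda>u. s * inverse u" and g = \<phi>, unfolded o_def])
               (use u in \<open>auto intro!: derivative_eq_intros d\<phi> simp: power2_eq_square has_real_derivative_iff_has_vector_derivative[symmetric]\<close>)
        qed
        moreover have "inverse u *\<^sub>R ((- (s * (inverse u)\<^sup>2)) *\<^sub>R \<phi>' (s * inverse u)) + (- ((inverse u)\<^sup>2)) *\<^sub>R \<phi> (s * inverse u)
          = (1 / u\<^sup>2) *\<^sub>R \<psi> (s / u)"
          unfolding \<psi>_eq by (simp add: divide_inverse power_inverse scaleR_conv_of_real algebra_simps power2_eq_square)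
        ultimately show ?thesis by (metis has_vector_derivative_at_within)
      qed
      show "continuous_on {t..t'} (\<lambda>u. (1 / u\<^sup>2) *\<^sub>R \<psi> (s / u))"
        using t by (intro continuous_intros continuous_on_compose2[OF cont_\<psi>]) auto
    qed
    then show ?thesis by (simp add: scaleR_conv_of_real mult.commute)
  qed
  define k where "k = (\<lambda>(s, u). indicator {t..t'} u *\<^sub>R (P s * ((1 / u\<^sup>2) *\<^sub>R \<psi> (s / u))))"
  have ki: "integrable (lborel \<Otimes>\<^sub>M lborel) k"
  proof (rule integrable_product_bounded[OF lborel.sigma_finite_measure_axioms lborel.sigma_finite_measure_axioms P])
    show "integrable lborel (\<lambda>u :: real. complex_of_real (indicator {t..t'} u))"
      by (intro integrable_of_real integrable_real_indicator) (auto simp: emeasure_lborel_Icc_eq)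
    show "k \<in> borel_measurable (lborel \<Otimes>\<^sub>M lborel)" unfolding k_def by measurable
    show "norm (k (s, u)) \<le> (B * (max 1 (t'\<^sup>2))\<^sup>2 / t\<^sup>2) * (norm (decay s *\<^sub>R P s) * norm (complex_of_real (indicator {t..t'} u)))" for s u
    proof (cases "u \<in> {t..t'}")
      case True
      then have u: "0 < u" "t \<le> u" "u \<le> t'" using t by auto
      have "norm (\<psi> (s / u)) \<le> B * (max 1 (u\<^sup>2))\<^sup>2 * decay s" by (rule norm_\<psi>_rescaled[OF u(1)])
      also have "\<dots> \<le> B * (max 1 (t'\<^sup>2))\<^sup>2 * decay s"
        using u B_nonneg decay_pos[of s] by (intro mult_right_mono mult_left_mono power_mono max.mono) auto
      finally have n: "norm (\<psi> (s / u)) \<le> B * (max 1 (t'\<^sup>2))\<^sup>2 * decay s" .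
      have "1 / u\<^sup>2 \<le> 1 / t\<^sup>2" using u t by (intro divide_left_mono power_mono) auto
      then have "1 / u\<^sup>2 * norm (\<psi> (s / u)) \<le> 1 / t\<^sup>2 * (B * (max 1 (t'\<^sup>2))\<^sup>2 * decay s)"
        using n by (intro mult_mono) auto
      then have "norm (P s) * (1 / u\<^sup>2 * norm (\<psi> (s / u))) \<le> norm (P s) * (1 / t\<^sup>2 * (B * (max 1 (t'\<^sup>2))\<^sup>2 * decay s))"
        by (intro mult_left_mono) auto
      moreover have "norm (k (s, u)) = norm (P s) * (1 / u\<^sup>2 * norm (\<psi> (s / u)))"
        using True by (simp add: k_def norm_mult)
      moreover have "norm (P s) * (1 / t\<^sup>2 * (B * (max 1 (t'\<^sup>2))\<^sup>2 * decay s)) = (B * (max 1 (t'\<^sup>2))\<^sup>2 / t\<^sup>2) * (norm (decay s *\<^sub>R P s) * norm (complex_of_real (indicator {t..t'} u)))"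
        using True decay_pos[of s] by (simp add: mult_ac)
      ultimately show ?thesis by (simp only:)
    qed (simp add: k_def)
  qed
  have "(\<integral>s. P s * (of_real (inverse t') * \<phi> (inverse t' * s)) \<partial>lborel) - (\<integral>s. P s * (of_real (inverse t) * \<phi> (inverse t * s)) \<partial>lborel)
    = (\<integral>s. P s * (of_real (inverse t') * \<phi> (inverse t' * s)) - P s * (of_real (inverse t) * \<phi> (inverse t * s)) \<partial>lborel)"
    using t by (intro Bochner_Integration.integral_diff[symmetric] avi) auto
  also have "\<dots> = (\<integral>s. (\<integral>u. k (s, u) \<partial>lborel) \<partial>lborel)"
  proof (intro Bochner_Integration.integral_cong refl)
    fix s
    have "(\<integral>u. k (s, u) \<partial>lborel) = (\<integral>u. P s * (indicator {t..t'} u *\<^sub>R ((1 / u\<^sup>2) *\<^sub>R \<psi> (s / u))) \<partial>lborel)"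
      unfolding k_def prod.case by (simp only: mult_scaleR_right)
    also have "\<dots> = P s * (\<integral>u. indicator {t..t'} u *\<^sub>R ((1 / u\<^sup>2) *\<^sub>R \<psi> (s / u)) \<partial>lborel)"
      by (rule integral_mult_right_zero)
    finally show "P s * (of_real (inverse t') * \<phi> (inverse t' * s)) - P s * (of_real (inverse t) * \<phi> (inverse t * s)) = (\<integral>u. k (s, u) \<partial>lborel)"
      unfolding FTC[symmetric] by (simp add: right_diff_distrib)
  qed
  also have "\<dots> = (\<integral>u. (\<integral>s. k (s, u) \<partial>lborel) \<partial>lborel)"
    using lborel_pair.Fubini_integral[of "\<lambda>s u. k (s, u)"] ki by (simp add: case_prod_eta)
  also have "\<dots> = (LINT u:{t..t'}|lborel. (1 / u\<^sup>2) *\<^sub>R (\<integral>s. P s * \<psi> (s / u) \<partial>lborel))"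
    unfolding set_lebesgue_integral_def k_def by (simp add: mult_scaleR_right)
  finally show ?thesis .
qed

text \<open>Cauchy-Schwarz on the interval of scales; within one dyadic range its length is at most the scale
  \<open>u\<close>, and one power of \<open>u\<close> is absorbed.\<close>
lemma average_difference_square:
  fixes \<phi> \<phi>' P :: "real \<Rightarrow> complex"
  assumes d\<phi>: "\<And>x. (\<phi> has_vector_derivative \<phi>' x) (at x)"
    and \<psi>_eq: "\<And>x. \<psi> x = - (\<phi> x + x *\<^sub>R \<phi>' x)"
    and bound_\<phi>: "\<And>x. norm (\<phi> x) \<le> B * decay x"
    and P: "integrable lborel (\<lambda>s. decay s *\<^sub>R P s)" and Pm [measurable]: "P \<in> borel_measurable lborel"
    and L: "0 < L" "L \<le> t" "t < t'" "t' \<le> 2 * L"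
  shows "ennreal ((norm ((\<integral>s. P s * (of_real (inverse t') * \<phi> (inverse t' * s)) \<partial>lborel) - (\<integral>s. P s * (of_real (inverse t) * \<phi> (inverse t * s)) \<partial>lborel)))\<^sup>2)
    \<le> (\<integral>\<^sup>+u. (ennreal ((norm (\<integral>s. P s * \<psi> (s / u) \<partial>lborel))\<^sup>2 / u ^ 3) * indicator {0<..} u) * indicator {t<..t'} u \<partial>lborel)"
proof -
  define I where "I u = (\<integral>s. P s * \<psi> (s / u) \<partial>lborel)" for u
  have [measurable]: "I \<in> borel_measurable borel" unfolding I_def by measurable
  define d where "d = (\<integral>s. P s * (of_real (inverse t') * \<phi> (inverse t' * s)) \<partial>lborel) - (\<integral>s. P s * (of_real (inverse t) * \<phi> (inverse t * s)) \<partial>lborel)"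
  have t: "0 < t" "t \<le> t'" using L by auto
  have "d = (\<integral>u. indicator {t..t'} u *\<^sub>R ((1 / u\<^sup>2) *\<^sub>R I u) \<partial>lborel)"
    using average_difference[OF d\<phi> \<psi>_eq bound_\<phi> P Pm t] unfolding d_def I_def set_lebesgue_integral_def .
  then have "ennreal (norm d) \<le> (\<integral>\<^sup>+u. ennreal (norm (indicator {t..t'} u *\<^sub>R ((1 / u\<^sup>2) *\<^sub>R I u))) \<partial>lborel)"
    by (simp only: norm_integral_le_nn)
  also have "\<dots> = (\<integral>\<^sup>+u. indicator {t<..t'} u * (ennreal (norm (I u) / u\<^sup>2) * indicator {t<..t'} u) \<partial>lborel)"
  proof (rule nn_integral_cong_AE)
    have "AE u in lborel. u \<noteq> t" by (rule AE_lborel_singleton)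
    then show "AE u in lborel. ennreal (norm (indicator {t..t'} u *\<^sub>R ((1 / u\<^sup>2) *\<^sub>R I u))) = indicator {t<..t'} u * (ennreal (norm (I u) / u\<^sup>2) * indicator {t<..t'} u)"
      by (rule AE_mp) (auto intro!: AE_I2 simp: indicator_def)
  qed
  finally have "(ennreal (norm d))\<^sup>2 \<le> (\<integral>\<^sup>+u. indicator {t<..t'} u * (ennreal (norm (I u) / u\<^sup>2) * indicator {t<..t'} u) \<partial>lborel)\<^sup>2"
    by (intro power_mono) auto
  also have "\<dots> \<le> (\<integral>\<^sup>+u. (indicator {t<..t'} u)\<^sup>2 \<partial>lborel) * (\<integral>\<^sup>+u. (ennreal (norm (I u) / u\<^sup>2) * indicator {t<..t'} u)\<^sup>2 \<partial>lborel)"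
    by (rule Cauchy_Schwarz_nn_integral) measurable
  also have "(\<integral>\<^sup>+u. (indicator {t<..t'} u)\<^sup>2 \<partial>lborel) = ennreal (t' - t)"
  proof -
    have "(indicator {t<..t'} u)\<^sup>2 = (indicator {t<..t'} u :: ennreal)" for u by (simp add: indicator_def)
    then show ?thesis using t by simp
  qed
  also have "ennreal (t' - t) * (\<integral>\<^sup>+u. (ennreal (norm (I u) / u\<^sup>2) * indicator {t<..t'} u)\<^sup>2 \<partial>lborel)
    = (\<integral>\<^sup>+u. ennreal (t' - t) * (ennreal (norm (I u) / u\<^sup>2) * indicator {t<..t'} u)\<^sup>2 \<partial>lborel)"
    by (rule nn_integral_cmult[symmetric]) measurable
  also have "\<dots> \<le> (\<integral>\<^sup>+u. (ennreal ((norm (I u))\<^sup>2 / u ^ 3) * indicator {0<..} u) * indicator {t<..t'} u \<partial>lborel)"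
  proof (rule nn_integral_mono)
    fix u
    show "ennreal (t' - t) * (ennreal (norm (I u) / u\<^sup>2) * indicator {t<..t'} u)\<^sup>2 \<le> (ennreal ((norm (I u))\<^sup>2 / u ^ 3) * indicator {0<..} u) * indicator {t<..t'} u"
    proof (cases "u \<in> {t<..t'}")
      case True
      then have u: "0 < u" "t < u" using t by auto
      have "t' - t \<le> u" using True L by auto
      then have "(t' - t) * ((norm (I u))\<^sup>2 / u ^ 4) \<le> u * ((norm (I u))\<^sup>2 / u ^ 4)" by (intro mult_right_mono) auto
      also have "\<dots> = (norm (I u))\<^sup>2 / u ^ 3" using u by (simp add: power4_eq_xxxx power3_eq_cube)
      finally have "ennreal ((t' - t) * ((norm (I u))\<^sup>2 / u ^ 4)) \<le> ennreal ((norm (I u))\<^sup>2 / u ^ 3)" by (rule ennreal_leI)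
      moreover have "ennreal (t' - t) * (ennreal (norm (I u) / u\<^sup>2))\<^sup>2 = ennreal ((t' - t) * ((norm (I u))\<^sup>2 / u ^ 4))"
        using t by (simp add: ennreal_power ennreal_mult[symmetric] power_divide flip: power_mult)
      ultimately show ?thesis using True u by simp
    qed simp
  qed
  finally show ?thesis unfolding d_def I_def by (simp add: ennreal_power)
qed

end

section \<open>Schwartz profiles and functions modulo null sets\<close>

lemma integral_lebesgue_eq_lborel:
  fixes f g :: "real \<Rightarrow> complex"
  assumes ae: "AE s in lborel. f s = g s" and g: "g \<in> borel_measurable lborel"
  shows "integral\<^sup>L lebesgue f = integral\<^sup>L lborel g"
proof -
  have ae': "AE s in lebesgue. g s = f s" using ae by (auto intro: AE_completion)
  have gm: "g \<in> borel_measurable lebesgue" using g by (rule measurable_completion)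
  have "f \<in> borel_measurable lebesgue"
    by (rule borel_measurable_AE[OF gm ae'])
  then have "integral\<^sup>L lebesgue f = integral\<^sup>L lebesgue g"
    using gm ae' by (intro integral_cong_AE) auto
  also have "\<dots> = integral\<^sup>L lborel g" by (rule integral_completion[OF g])
  finally show ?thesis .
qed

lemma schwartz_decay:
  assumes "schwartz f"
  obtains M where "0 \<le> M" "\<And>x. norm (iter_deriv n f x) \<le> M * decay x"
    "\<And>x. \<bar>x\<bar> * norm (iter_deriv n f x) \<le> M * decay x"
proof -
  define g where "g = iter_deriv n f"
  have "\<exists>M. \<forall>x. norm (x ^ k *\<^sub>R g x) \<le> M" for k
  proof -
    have "bounded (range (\<lambda>x. x ^ k *\<^sub>R g x))" using assms unfolding schwartz_def g_def by blast
    then show ?thesis unfolding bounded_iff by blast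
  qed
  then have "\<forall>k. \<exists>M. \<forall>x. norm (x ^ k *\<^sub>R g x) \<le> M" by blast
  then obtain M where "\<forall>k x. norm (x ^ k *\<^sub>R g x) \<le> M k" by (rule choice[THEN exE])
  then have M: "norm (x ^ k *\<^sub>R g x) \<le> M k" for k x by blast
  have M': "\<bar>x\<bar> ^ k * norm (g x) \<le> M k" for k x using M[of x k] by (simp add: power_abs)
  have M0: "0 \<le> M k" for k using order_trans[OF norm_ge_zero M] .
  define C where "C = M 0 + 2 * M 2 + M 4 + (M 1 + 2 * M 3 + M 5)"
  have le: "y \<le> C * decay x" if "y * (1 + x\<^sup>2)\<^sup>2 \<le> C" for x y :: real
  proof -
    have "0 < 1 + x\<^sup>2" by (rule add_pos_nonneg) auto
    then have "0 < (1 + x\<^sup>2)\<^sup>2" by simp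
    with that show ?thesis unfolding decay_def by (simp add: field_simps)
  qed
  have expand: "(1 + x\<^sup>2)\<^sup>2 = 1 + 2 * \<bar>x\<bar> ^ 2 + \<bar>x\<bar> ^ 4" for x :: real
    by (simp add: power2_eq_square power4_eq_xxxx algebra_simps)
  show thesis
  proof (rule that[of C])
    show "0 \<le> C" unfolding C_def using M0 by (intro add_nonneg_nonneg mult_nonneg_nonneg) auto
    fix x
    have "norm (g x) * (1 + x\<^sup>2)\<^sup>2 = \<bar>x\<bar> ^ 0 * norm (g x) + 2 * (\<bar>x\<bar> ^ 2 * norm (g x)) + \<bar>x\<bar> ^ 4 * norm (g x)"
      unfolding expand by (simp add: algebra_simps)
    also have "\<dots> \<le> C"
      using M'[of x 0] M'[of x 2] M'[of x 4] M0[of 1] M0[of 3] M0[of 5] unfolding C_def by linarith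
    finally show "norm (iter_deriv n f x) \<le> C * decay x" unfolding g_def[symmetric] by (rule le)
    have "(\<bar>x\<bar> * norm (g x)) * (1 + x\<^sup>2)\<^sup>2 = \<bar>x\<bar> ^ 1 * norm (g x) + 2 * (\<bar>x\<bar> ^ 3 * norm (g x)) + \<bar>x\<bar> ^ 5 * norm (g x)"
      unfolding expand by (simp add: algebra_simps eval_nat_numeral)
    also have "\<dots> \<le> C"
      using M'[of x 1] M'[of x 3] M'[of x 5] M0[of 0] M0[of 2] M0[of 4] unfolding C_def by linarith
    finally show "\<bar>x\<bar> * norm (iter_deriv n f x) \<le> C * decay x" unfolding g_def[symmetric] by (rule le)
  qed
qed

lemma schwartz_profile:
  fixes \<phi> :: "real \<Rightarrow> complex"
  assumes "schwartz \<phi>"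
  shows "\<exists>\<phi>' \<phi>'' B.
    decaying_profile (\<lambda>x. - (x *\<^sub>R \<phi> x)) (\<lambda>x. - (\<phi> x + x *\<^sub>R \<phi>' x)) (\<lambda>x. - (2 *\<^sub>R \<phi>' x + x *\<^sub>R \<phi>'' x)) B
    \<and> (\<forall>x. (\<phi> has_vector_derivative \<phi>' x) (at x)) \<and> (\<forall>x. norm (\<phi> x) \<le> B * decay x)"
proof -
  have step: "(iter_deriv n \<phi> has_vector_derivative iter_deriv (Suc n) \<phi> x) (at x)" for n x
    using assms unfolding schwartz_def iter_deriv_def by (simp add: vector_derivative_works)
  define \<phi>1 where "\<phi>1 = iter_deriv 1 \<phi>"
  define \<phi>2 where "\<phi>2 = iter_deriv 2 \<phi>"
  have d0: "(\<phi> has_vector_derivative \<phi>1 x) (at x)" for x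
    using step[of 0 x] by (simp add: \<phi>1_def iter_deriv_def)
  have d1: "(\<phi>1 has_vector_derivative \<phi>2 x) (at x)" for x
    using step[of 1 x] by (simp add: \<phi>1_def \<phi>2_def numeral_2_eq_2)
  have d2: "(\<phi>2 has_vector_derivative iter_deriv 3 \<phi> x) (at x)" for x
    using step[of 2 x] by (simp add: \<phi>2_def numeral_3_eq_3 numeral_2_eq_2)
  obtain M0 where M0: "0 \<le> M0" "\<And>x. norm (\<phi> x) \<le> M0 * decay x" "\<And>x. \<bar>x\<bar> * norm (\<phi> x) \<le> M0 * decay x"
    using schwartz_decay[OF assms, of 0] by (auto simp: iter_deriv_def)
  obtain M1 where M1: "0 \<le> M1" "\<And>x. norm (\<phi>1 x) \<le> M1 * decay x" "\<And>x. \<bar>x\<bar> * norm (\<phi>1 x) \<le> M1 * decay x"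
    using schwartz_decay[OF assms, of 1] by (auto simp: \<phi>1_def)
  obtain M2 where M2: "0 \<le> M2" "\<And>x. norm (\<phi>2 x) \<le> M2 * decay x" "\<And>x. \<bar>x\<bar> * norm (\<phi>2 x) \<le> M2 * decay x"
    using schwartz_decay[OF assms, of 2] by (auto simp: \<phi>2_def)
  define B where "B = M0 + 2 * M1 + M2"
  have pos: "0 \<le> M0 * decay x" "0 \<le> M1 * decay x" "0 \<le> M2 * decay x" for x
    using M0(1) M1(1) M2(1) decay_pos[of x] by simp_all
  have Bd: "B * decay x = M0 * decay x + 2 * (M1 * decay x) + M2 * decay x" for x
    by (simp add: B_def algebra_simps)
  show ?thesis
  proof (rule exI[of _ \<phi>1], rule exI[of _ \<phi>2], rule exI[of _ B], intro conjI allI)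
    show "(\<phi> has_vector_derivative \<phi>1 x) (at x)" for x by (rule d0)
    show "norm (\<phi> x) \<le> B * decay x" for x
      using M0(2)[of x] pos[of x] unfolding Bd by linarith
    show "decaying_profile (\<lambda>x. - (x *\<^sub>R \<phi> x)) (\<lambda>x. - (\<phi> x + x *\<^sub>R \<phi>1 x)) (\<lambda>x. - (2 *\<^sub>R \<phi>1 x + x *\<^sub>R \<phi>2 x)) B"
    proof
      have dx: "((\<lambda>x. x *\<^sub>R f x) has_vector_derivative f x + x *\<^sub>R f' x) (at x)"
        if "(f has_vector_derivative f' x) (at x)" for f f' :: "real \<Rightarrow> complex" and x
        using has_vector_derivative_scaleR[OF DERIV_ident that] by (simp add: add.commute)
      show "((\<lambda>x. - (x *\<^sub>R \<phi> x)) has_vector_derivative - (\<phi> x + x *\<^sub>R \<phi>1 x)) (at x)" for x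
        by (rule has_vector_derivative_minus[OF dx[OF d0]])
      show "((\<lambda>x. - (\<phi> x + x *\<^sub>R \<phi>1 x)) has_vector_derivative - (2 *\<^sub>R \<phi>1 x + x *\<^sub>R \<phi>2 x)) (at x)" for x
      proof -
        have "((\<lambda>x. \<phi> x + x *\<^sub>R \<phi>1 x) has_vector_derivative \<phi>1 x + (\<phi>1 x + x *\<^sub>R \<phi>2 x)) (at x)"
          by (intro has_vector_derivative_add d0 dx d1)
        from has_vector_derivative_minus[OF this] show ?thesis by (simp add: scaleR_2 add.assoc)
      qed
      have c: "continuous_on UNIV \<phi>1" "continuous_on UNIV \<phi>2"
        using d1 d2 by (meson continuous_at_imp_continuous_on has_vector_derivative_continuous)+
      show "continuous_on UNIV (\<lambda>x. - (2 *\<^sub>R \<phi>1 x + x *\<^sub>R \<phi>2 x))"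
        by (intro continuous_intros c)
      fix x
      show "norm (- (x *\<^sub>R \<phi> x)) \<le> B * decay x"
        using M0(3)[of x] pos[of x] unfolding Bd by simp
      show "norm (- (\<phi> x + x *\<^sub>R \<phi>1 x)) \<le> B * decay x"
        using norm_triangle_ineq[of "\<phi> x" "x *\<^sub>R \<phi>1 x"] M0(2)[of x] M1(3)[of x] pos[of x] unfolding Bd norm_minus_cancel norm_scaleR by linarith
      show "norm (- (2 *\<^sub>R \<phi>1 x + x *\<^sub>R \<phi>2 x)) \<le> B * decay x"
        using norm_triangle_ineq[of "2 *\<^sub>R \<phi>1 x" "x *\<^sub>R \<phi>2 x"] M1(2)[of x] M2(3)[of x] pos[of x]
        unfolding Bd norm_minus_cancel norm_scaleR by simp
    qed
  qed
qed

text \<open>The estimates above are for Borel functions, for which sections and compositions are measurable.\<close>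
lemma borel_version:
  fixes F :: "real \<times> real \<Rightarrow> complex"
  assumes "F \<in> borel_measurable lebesgue"
  obtains F' where "F' \<in> borel_measurable plane" "AE p in plane. F p = F' p"
proof -
  have m: "(\<lambda>p. Re (F p)) \<in> borel_measurable lebesgue" "(\<lambda>p. Im (F p)) \<in> borel_measurable lebesgue"
    using assms by auto
  obtain f where f: "f \<in> borel_measurable lborel" "AE p in lborel. Re (F p) = f p"
    using completion_ex_borel_measurable_real[OF m(1)] by blast
  obtain g where g: "g \<in> borel_measurable lborel" "AE p in lborel. Im (F p) = g p"
    using completion_ex_borel_measurable_real[OF m(2)] by blast
  show thesis
  proof (rule that[of "\<lambda>p. Complex (f p) (g p)"])
    show "(\<lambda>p. Complex (f p) (g p)) \<in> borel_measurable plane"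
      unfolding lborel_prod using f g by (subst borel_measurable_complex_iff) simp
    show "AE p in plane. F p = Complex (f p) (g p)"
      unfolding lborel_prod using f(2) g(2) by eventually_elim (simp add: complex_eq_iff)
  qed
qed

text \<open>A null set of the plane meets almost every horizontal line in a null set of the line, and then all
  translates along this line behave in the same way.\<close>
lemma AE_on_lines:
  assumes "AE p in plane. R p"
  shows "AE q in plane. AE s in lborel. R (fst q + s, snd q)"
    and "AE q in plane. AE s in lborel. R (fst q, snd q + s)"
proof -
  obtain N where N: "{p \<in> space plane. \<not> R p} \<subseteq> N" "emeasure plane N = 0" and Ns [measurable]: "N \<in> sets plane"
    by (rule AE_E[OF assms])
  have R: "R p" if "p \<notin> N" for p using that N(1) by (auto simp: space_pair_measure)
  define f where "f y = (\<integral>\<^sup>+x. indicator N (x, y) \<partial>lborel)" for y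
  define g where "g x = (\<integral>\<^sup>+y. indicator N (x, y) \<partial>lborel)" for x
  have [measurable]: "f \<in> borel_measurable lborel" "g \<in> borel_measurable lborel" unfolding f_def g_def by measurable
  have "(\<integral>\<^sup>+p. indicator N p \<partial>plane) = 0" using N(2) Ns by (simp add: nn_integral_indicator)
  then have "(\<integral>\<^sup>+y. f y \<partial>lborel) = 0" "(\<integral>\<^sup>+x. g x \<partial>lborel) = 0"
    using nn_integral_plane_swap[of "indicator N"] by (simp_all add: f_def g_def)
  then have "AE y in lborel. f y = 0" "AE x in lborel. g x = 0" by (simp_all add: nn_integral_0_iff_AE)
  then have z: "AE q in plane. f (snd q) = 0" "AE q in plane. g (fst q) = 0"
    by (intro AE_snd_plane[where P = "\<lambda>y. f y = 0"] AE_fst_plane[where P = "\<lambda>x. g x = 0"]; measurable)+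
  from z(1) show "AE q in plane. AE s in lborel. R (fst q + s, snd q)"
  proof eventually_elim
    case (elim q)
    have "(\<integral>\<^sup>+s. indicator N (fst q + s, snd q) \<partial>lborel) = 0"
      using elim nn_integral_translate[of "\<lambda>x. indicator N (x, snd q)" "fst q"] by (simp add: f_def)
    then have "AE s in lborel. (indicator N (fst q + s, snd q) :: ennreal) = 0" by (subst (asm) nn_integral_0_iff_AE) auto
    then show ?case by eventually_elim (auto intro!: R simp: indicator_eq_0_iff)
  qed
  from z(2) show "AE q in plane. AE s in lborel. R (fst q, snd q + s)"
  proof eventually_elim
    case (elim q)
    have "(\<integral>\<^sup>+s. indicator N (fst q, snd q + s) \<partial>lborel) = 0"
      using elim nn_integral_translate[of "\<lambda>y. indicator N (fst q, y)" "snd q"] by (simp add: g_def)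
    then have "AE s in lborel. (indicator N (fst q, snd q + s) :: ennreal) = 0" by (subst (asm) nn_integral_0_iff_AE) auto
    then show ?case by eventually_elim (auto intro!: R simp: indicator_eq_0_iff)
  qed
qed

lemma epowr_ennreal: "0 \<le> r \<Longrightarrow> epowr (ennreal r) p = ennreal (r powr p)"
  by (simp add: epowr_def)

lemma epowr_mono: "x \<le> y \<Longrightarrow> 0 \<le> p \<Longrightarrow> epowr x p \<le> epowr y p"
  by (cases x; cases y) (auto simp: epowr_def top_unique intro!: ennreal_leI powr_mono2)

lemma epowr_half_square: "(epowr x (1 / 2))\<^sup>2 = x"
proof (cases x)
  case (real r)
  have "(r powr (1 / 2))\<^sup>2 = r" using real by (simp add: powr_half_sqrt)
  then show ?thesis using real by (simp add: epowr_def ennreal_power)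
qed (simp add: epowr_def)

lemma lp_norm_4_eq:
  assumes "AE p in plane. F p = F' p"
  shows "lp_norm 4 lebesgue (\<lambda>z. ennreal (norm (F z))) = epowr (quartic F') (1 / 4)"
proof -
  have "(\<integral>\<^sup>+z. epowr (ennreal (norm (F z))) 4 \<partial>lebesgue) = (\<integral>\<^sup>+z. epowr (ennreal (norm (F z))) 4 \<partial>plane)"
    unfolding lborel_prod by (rule nn_integral_completion)
  also have "\<dots> = quartic F'"
    unfolding quartic_def by (rule nn_integral_cong_AE) (use assms in eventually_elim, simp add: epowr_def powr_numeral)
  finally show ?thesis by (simp add: lp_norm_def)
qed

lemma dyadic_disjoint: "disjoint_family_on (\<lambda>i :: int. {2 powi i<..2 powi (i + 1)} :: real set) I"
proof -
  have "{2 powi i<..2 powi (i + 1)} \<inter> {2 powi j<..2 powi (j + 1) :: real} = {}" if "i < j" for i j :: int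
  proof -
    have "(2 :: real) powi (i + 1) \<le> 2 powi j" using that by (intro power_int_increasing) auto
    then show ?thesis by auto
  qed
  then show ?thesis unfolding disjoint_family_on_def by (metis Int_commute linorder_neqE)
qed

theorem corollary3:
  fixes \<phi> :: "real \<Rightarrow> complex"
  assumes "schwartz \<phi>"
  shows "\<exists>C::real. 0 \<le> C \<and>
    (\<forall>F \<in> lp_space 4. \<forall>G \<in> lp_space 4.
       epowr
         (\<Sum>\<^sub>\<infinity>i\<in>(UNIV :: int set).
            (lp_norm 2 lebesgue
               (\<lambda>z :: real \<times> real.
                  variation 2 {2 powi i .. 2 powi (i + 1)} (\<lambda>t. bilinear_average \<phi> F G t z))) ^ 2)
         (1 / 2)
       \<le> ennreal C * lp_norm 4 lebesgue (\<lambda>z. ennreal (norm (F z)))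
                   * lp_norm 4 lebesgue (\<lambda>z. ennreal (norm (G z))))"
proof -
  obtain \<phi>' \<phi>'' B where
    prof: "decaying_profile (\<lambda>x. - (x *\<^sub>R \<phi> x)) (\<lambda>x. - (\<phi> x + x *\<^sub>R \<phi>' x)) (\<lambda>x. - (2 *\<^sub>R \<phi>' x + x *\<^sub>R \<phi>'' x)) B"
    and d\<phi>': "\<forall>x. (\<phi> has_vector_derivative \<phi>' x) (at x)" and bound_\<phi>': "\<forall>x. norm (\<phi> x) \<le> B * decay x"
    using schwartz_profile[OF assms] by blast
  note d\<phi> = d\<phi>'[rule_format] and bound_\<phi> = bound_\<phi>'[rule_format]
  \<comment> \<open>The scale derivative of \<open>\<phi>\<close>, with primitive \<open>- x \<phi>(x)\<close>.\<close>
  define \<psi> where "\<psi> x = - (\<phi> x + x *\<^sub>R \<phi>' x)" for x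
  interpret decaying_profile "\<lambda>x. - (x *\<^sub>R \<phi> x)" \<psi> "\<lambda>x. - (2 *\<^sub>R \<phi>' x + x *\<^sub>R \<phi>'' x)" B
    using prof unfolding \<psi>_def[abs_def] .
  have [measurable]: "\<phi> \<in> borel_measurable borel"
    using d\<phi> by (meson borel_measurable_continuous_onI continuous_at_imp_continuous_on has_vector_derivative_continuous)
  define C where "C = sqrt (2 * square_const)"
  have C0: "0 \<le> C" using square_const_nonneg by (simp add: C_def)
  show ?thesis
  proof (rule exI[of _ C], intro conjI ballI C0)
    fix F G :: "real \<times> real \<Rightarrow> complex"
    assume FL: "F \<in> lp_space 4" and GL: "G \<in> lp_space 4"
    obtain F' where Fm [measurable]: "F' \<in> borel_measurable plane" and FF': "AE p in plane. F p = F' p"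
      using FL borel_version[of F] unfolding lp_space_def by blast
    obtain G' where Gm [measurable]: "G' \<in> borel_measurable plane" and GG': "AE p in plane. G p = G' p"
      using GL borel_version[of G] unfolding lp_space_def by blast
    note nF = lp_norm_4_eq[OF FF'] and nG = lp_norm_4_eq[OF GG']
    have fin: "quartic F' < \<infinity>" "quartic G' < \<infinity>"
    proof -
      have "lp_norm 4 lebesgue (\<lambda>z. ennreal (norm (F z))) < \<infinity>" "lp_norm 4 lebesgue (\<lambda>z. ennreal (norm (G z))) < \<infinity>"
        using FL GL unfolding lp_space_def by blast+
      then show "quartic F' < \<infinity>" "quartic G' < \<infinity>"
        unfolding nF nG by (auto simp: epowr_def less_top split: if_splits)
    qed
    note [measurable (raw)] = measurable_fiber[OF Fm Gm]
    define h where "h q u = ennreal ((norm (\<integral>s. fiber F' G' q s * \<psi> (s / u) \<partial>lborel))\<^sup>2 / u ^ 3) * indicator {0<..} u" for q u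
    have hm: "(\<lambda>(q, u). h q u) \<in> borel_measurable (plane \<Otimes>\<^sub>M borel)" unfolding h_def by measurable
    note [measurable (raw)] = measurable_compose2[OF hm]
    define V where "V i z = variation 2 {2 powi i .. 2 powi (i + 1)} (\<lambda>t. bilinear_average \<phi> F G t z)" for i :: int and z
    \<comment> \<open>At almost every point the averages of the Borel versions are those of \<open>F\<close> and \<open>G\<close>, for all scales simultaneously.\<close>
    have var: "AE q in plane. \<forall>i. epowr (V i q) 2 \<le> (\<integral>\<^sup>+u. h q u * indicator {2 powi i<..2 powi (i + 1)} u \<partial>lborel)"
      using AE_tame[OF Fm Gm fin] AE_on_lines(1)[OF FF'] AE_on_lines(2)[OF GG']
    proof eventually_elim
      case (elim q)
      define P where "P = fiber F' G' q"
      have Pm [measurable]: "P \<in> borel_measurable lborel" unfolding P_def fiber_def by measurable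
      have Pi: "integrable lborel (\<lambda>s. decay s *\<^sub>R P s)" using elim unfolding tame_def P_def by simp
      have avg: "bilinear_average \<phi> F G t q = (\<integral>s. P s * (of_real (inverse t) * \<phi> (inverse t * s)) \<partial>lborel)" for t
      proof -
        have "AE s in lborel. F (fst q + s, snd q) * G (fst q, snd q + s) * (of_real (inverse t) * \<phi> (inverse t * s))
          = P s * (of_real (inverse t) * \<phi> (inverse t * s))"
          using elim(2,3) by eventually_elim (simp add: P_def fiber_def)
        then show ?thesis
          unfolding bilinear_average_def case_prod_beta by (rule integral_lebesgue_eq_lborel) measurable
      qed
      show ?case
      proof
        fix i :: int
        have pw: "(2 :: real) powi (i + 1) = 2 * 2 powi i" by (simp add: power_int_add)
        show "epowr (V i q) 2 \<le> (\<integral>\<^sup>+u. h q u * indicator {2 powi i<..2 powi (i + 1)} u \<partial>lborel)"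
          unfolding V_def
        proof (rule variation_square_le)
          show "h q \<in> borel_measurable borel" unfolding h_def P_def[symmetric] by measurable
          fix t t' :: real assume t: "2 powi i \<le> t" "t < t'" "t' \<le> 2 powi (i + 1)"
          show "ennreal ((norm (bilinear_average \<phi> F G t' q - bilinear_average \<phi> F G t q))\<^sup>2) \<le> (\<integral>\<^sup>+u. h q u * indicator {t<..t'} u \<partial>lborel)"
            unfolding avg h_def P_def[symmetric]
            by (rule average_difference_square[OF d\<phi> \<psi>_def bound_\<phi> Pi Pm, of "2 powi i"]) (use t pw in auto)
        qed
      qed
    qed
    have norm2: "(lp_norm 2 lebesgue (V i))\<^sup>2 \<le> (\<integral>\<^sup>+q. (\<integral>\<^sup>+u. h q u * indicator {2 powi i<..2 powi (i + 1)} u \<partial>lborel) \<partial>plane)" for i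
    proof -
      have "(lp_norm 2 lebesgue (V i))\<^sup>2 = (\<integral>\<^sup>+q. epowr (V i q) 2 \<partial>lebesgue)"
        unfolding lp_norm_def by (rule epowr_half_square)
      also have "\<dots> = (\<integral>\<^sup>+q. epowr (V i q) 2 \<partial>plane)"
        unfolding lborel_prod by (rule nn_integral_completion)
      also have "\<dots> \<le> (\<integral>\<^sup>+q. (\<integral>\<^sup>+u. h q u * indicator {2 powi i<..2 powi (i + 1)} u \<partial>lborel) \<partial>plane)"
        by (rule nn_integral_mono_AE) (use var in eventually_elim, blast)
      finally show ?thesis .
    qed
    have "(\<Sum>\<^sub>\<infinity>i\<in>(UNIV :: int set). (lp_norm 2 lebesgue (V i))\<^sup>2) \<le> square_energy F' G'"
      unfolding nonneg_infsum_complete[OF zero_le]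
    proof (rule SUP_least, clarify)
      fix I :: "int set" assume I: "finite I"
      have "(\<Sum>i\<in>I. (lp_norm 2 lebesgue (V i))\<^sup>2) \<le> (\<Sum>i\<in>I. \<integral>\<^sup>+q. (\<integral>\<^sup>+u. h q u * indicator {2 powi i<..2 powi (i + 1)} u \<partial>lborel) \<partial>plane)"
        by (intro sum_mono norm2)
      also have "\<dots> = (\<integral>\<^sup>+q. (\<Sum>i\<in>I. \<integral>\<^sup>+u. h q u * indicator {2 powi i<..2 powi (i + 1)} u \<partial>lborel) \<partial>plane)"
        by (rule nn_integral_sum[symmetric]) measurable
      also have "\<dots> \<le> (\<integral>\<^sup>+q. (\<integral>\<^sup>+u. h q u \<partial>lborel) \<partial>plane)"
      proof (rule nn_integral_mono)
        fix q
        have "(\<Sum>i\<in>I. \<integral>\<^sup>+u. h q u * indicator {2 powi i<..2 powi (i + 1)} u \<partial>lborel)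
          = (\<integral>\<^sup>+u. (\<Sum>i\<in>I. h q u * indicator {2 powi i<..2 powi (i + 1)} u) \<partial>lborel)"
          by (rule nn_integral_sum[symmetric]) (rule borel_measurable_times_ennreal, rule measurable_compose2[OF hm]; simp add: space_pair_measure)
        also have "\<dots> \<le> (\<integral>\<^sup>+u. h q u \<partial>lborel)"
        proof (rule nn_integral_mono)
          fix u
          have "(\<Sum>i\<in>I. h q u * indicator {2 powi i<..2 powi (i + 1)} u) = h q u * indicator (\<Union>i\<in>I. {2 powi i<..2 powi (i + 1)}) u"
            unfolding indicator_UN_disjoint[OF I dyadic_disjoint] by (rule sum_distrib_left[symmetric])
          also have "\<dots> \<le> h q u * 1" by (intro mult_left_mono) (auto simp: indicator_def)
          finally show "(\<Sum>i\<in>I. h q u * indicator {2 powi i<..2 powi (i + 1)} u) \<le> h q u" by simp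
        qed
        finally show "(\<Sum>i\<in>I. \<integral>\<^sup>+u. h q u * indicator {2 powi i<..2 powi (i + 1)} u \<partial>lborel) \<le> (\<integral>\<^sup>+u. h q u \<partial>lborel)" .
      qed
      also have "\<dots> = square_energy F' G'" unfolding square_energy_def h_def ..
      finally show "(\<Sum>i\<in>I. (lp_norm 2 lebesgue (V i))\<^sup>2) \<le> square_energy F' G'" .
    qed
    also have "\<dots> \<le> ennreal (2 * square_const * sqrt (enn2real (quartic F') * enn2real (quartic G')))"
      by (rule square_energy_bound[OF Fm Gm fin])
    finally have "epowr (\<Sum>\<^sub>\<infinity>i\<in>(UNIV :: int set). (lp_norm 2 lebesgue (V i))\<^sup>2) (1 / 2)
      \<le> epowr (ennreal (2 * square_const * sqrt (enn2real (quartic F') * enn2real (quartic G')))) (1 / 2)"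
      by (rule epowr_mono) simp
    also have "\<dots> = ennreal C * epowr (quartic F') (1 / 4) * epowr (quartic G') (1 / 4)"
    proof -
      define p where "p = enn2real (quartic F')"
      define q where "q = enn2real (quartic G')"
      have pq: "quartic F' = ennreal p" "quartic G' = ennreal q" "0 \<le> p" "0 \<le> q"
        using fin by (auto simp: p_def q_def less_top)
      have q4: "sqrt (sqrt x) = x powr (1 / 4)" if "0 \<le> x" for x
        using that by (simp add: powr_half_sqrt[symmetric] powr_powr)
      have "(2 * square_const * sqrt (p * q)) powr (1 / 2) = C * (p powr (1 / 4) * q powr (1 / 4))"
        using pq square_const_nonneg
        by (simp add: powr_half_sqrt C_def real_sqrt_mult q4[symmetric])
      moreover have "0 \<le> 2 * square_const * sqrt (p * q)" using pq square_const_nonneg by simp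
      ultimately have "epowr (ennreal (2 * square_const * sqrt (p * q))) (1 / 2) = ennreal (C * (p powr (1 / 4) * q powr (1 / 4)))"
        by (simp only: epowr_ennreal)
      also have "\<dots> = ennreal C * epowr (ennreal p) (1 / 4) * epowr (ennreal q) (1 / 4)"
        using pq(3,4) C0 by (simp add: epowr_ennreal ennreal_mult mult.assoc)
      finally show ?thesis
        unfolding p_def[symmetric] q_def[symmetric] unfolding pq(1,2) .
    qed
    finally show "epowr (\<Sum>\<^sub>\<infinity>i\<in>(UNIV :: int set).
            (lp_norm 2 lebesgue (\<lambda>z. variation 2 {2 powi i .. 2 powi (i + 1)} (\<lambda>t. bilinear_average \<phi> F G t z))) ^ 2) (1 / 2)
       \<le> ennreal C * lp_norm 4 lebesgue (\<lambda>z. ennreal (norm (F z))) * lp_norm 4 lebesgue (\<lambda>z. ennreal (norm (G z)))"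
      unfolding nF nG V_def .
  qed
qed

end
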